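(* Let $c,\delta,\kappa,c',p$ be real numbers with $0<c<1$, $\delta>0$, $c+\delta+\kappa>1$, $c'>0$, $\kappa-c'>1$, $\delta+c'>1$, and $0<p<1$. Then $$\frac{1}{2\pi i}\int_{(c)}\sum_{n\ge2}\frac{\Lambda(n)e^{-2\pi i p n}}{n^{s+\delta+\kappa}}\,\Gamma(s)\Gamma(s+\delta)\Gamma(1-s)(2p\pi)^{-s}e^{-\pi i s/2}\,ds$$ $$=\Gamma(1+\delta)\Big(-\frac{\zeta'}{\zeta}(\kappa)\Big)\Big[(2\pi p)^{-\delta}e^{\delta\pi i/2}\Gamma(-\delta)+K(p,1+\delta)\Big]$$ $$-\frac{\Gamma(1+\delta)}{2\pi i}\int_{c'-i\infty}^{c'+i\infty}-\frac{\zeta'}{\zeta}(\kappa-w)\Big[(2\pi p)^{-\delta-w}e^{(\delta+w)\pi i/2}\Gamma(-\delta-w)+K(p,1+\delta+w)\Big]\frac{dw}{w},$$ where $K(p,\xi)$ is the meromorphic continuation in $\xi$ of the function defined for $0<\mathrm{Re}(\xi)<1$ by $$K(p,\xi)=-\int_0^1 e^{-2\pi i p r}r^{-\xi}\,dr.$$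
   Context: $\Lambda$ is the von Mangoldt function, $\zeta$ the Riemann zeta function, and $\int_{(c)}$ denotes integration along the vertical line $\mathrm{Re}(s)=c$ from $c-i\infty$ to $c+i\infty$. The bracketed expressions are of the form $(2\pi p)^{1-\xi}e^{(\xi-1)\pi i/2}\Gamma(1-\xi)+K(p,\xi)$, which for $0<\mathrm{Re}(\xi)<1$ equals $\int_1^\infty e^{-2\pi i p y}y^{-\xi}\,dy$; they are understood by analytic continuation in $\xi$ (in particular at points where the two summands individually have poles).
   Formalization: In both brackets the power of 2πp is corrected: (2πp)^{-δ} and (2πp)^{-δ-w} become (2πp)^{δ} and (2πp)^{δ+w}; as printed the bracket does not equal ∫_1^∞ e^{-2πipy}y^{-ξ}dy, and its poles (e.g. at δ=1) do not cancel unless 2πp=1. *)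

theory Defs
  imports "HOL-Complex_Analysis.Complex_Analysis" "HOL-Number_Theory.Prime_Powers"
begin

text \<open>
  Vertical line integrals are absolutely convergent Lebesgue integrals over the
  parametrisation \<open>t \<mapsto> c + i t\<close>, with \<open>ds = i dt\<close>.
\<close>

definition vline_integrable :: "real \<Rightarrow> (complex \<Rightarrow> complex) \<Rightarrow> bool" where
  "vline_integrable c F \<longleftrightarrow> integrable lborel (\<lambda>t. F (Complex c t))"

definition vline_integral :: "real \<Rightarrow> (complex \<Rightarrow> complex) \<Rightarrow> complex" where
  "vline_integral c F = \<i> * (LINT t|lborel. F (Complex c t))"

text \<open>
  The Riemann zeta function on its half-plane of absolute convergence \<open>Re s > 1\<close>.
  Elsewhere the value is not meaningful.
\<close>

definition zeta :: "complex \<Rightarrow> complex" where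
  "zeta s = (\<Sum>n. 1 / of_nat (Suc n) powr s)"

text \<open>
  A nicely meromorphic function on the whole plane is determined by its values on
  the strip, so the description below has at most one solution. It takes the
  value \<open>0\<close> at the poles.
\<close>

definition K :: "real \<Rightarrow> complex \<Rightarrow> complex" where
  "K p = (THE f. f nicely_meromorphic_on UNIV \<and>
            (\<forall>\<xi>. 0 < Re \<xi> \<and> Re \<xi> < 1 \<longrightarrow>
               f \<xi> = - (LBINT r:{0..1}. exp (- 2 * pi * \<i> * p * r) * of_real r powr (- \<xi>))))"

text \<open>
  For \<open>0 < Re \<xi> < 1\<close> the first summand is the full integral
  \<open>\<integral>\<^sub>0\<^sup>\<infinity> exp (-2 \<pi> i p y) y powr -\<xi> dy = (2 \<pi> i p) powr (\<xi> - 1) \<Gamma>(1 - \<xi>)\<close>,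
  so the bracket is \<open>\<integral>\<^sub>1\<^sup>\<infinity> exp (-2 \<pi> i p y) y powr -\<xi> dy\<close>. It is an entire function
  of \<open>\<xi>\<close>: at \<open>\<xi> = 1, 2, \<dots>\<close> the poles of the two summands cancel, and
  \<^const>\<open>remove_sings\<close> supplies the value there. The exponent of \<open>2 \<pi> p\<close> is \<open>\<xi> - 1\<close>;
  the source prints \<open>1 - \<xi>\<close>, which is a misprint: with it neither the integral formula
  nor the cancellation of poles holds.
\<close>

definition bracket :: "real \<Rightarrow> complex \<Rightarrow> complex" where
  "bracket p = remove_sings (\<lambda>\<xi>.
     of_real (2 * pi * p) powr (\<xi> - 1) * exp ((\<xi> - 1) * pi * \<i> / 2) * Gamma (1 - \<xi>) + K p \<xi>)"

end

(*
  Put q = 2 pi p. Both sides equal Gamma(1 + delta) times the sum over n of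
  Lambda(n) n^(-kappa) int_n^infinity e^(-i q y) y^(-1-delta) dy.

  On the left, Gamma(s) Gamma(1 - s) = pi / sin(pi s) decays fast enough for Gamma(s + delta) to be
  replaced by its Euler integral under the line integral; the remaining inner integral is
  (1 / 2 pi i) int pi / sin(pi s) z^(-s) ds = 1 / (1 + z) at imaginary z, and
  1 / (x + i r) = int_0^infinity e^(-(x + i r) v) dv restores a Gamma integral.

  On the right, the bracket at xi is int_1^infinity e^(-i q y) y^(-xi) dy. Expanding -zeta'/zeta(kappa - w)
  into its Dirichlet series leaves, for each n, a Perron integral in (n / y)^w, which cuts the
  y-integral off at y = n; the first term on the right supplies the whole integral over y > 1.
*)

theory Submission
  imports Defs "HOL-Probability.Sinc_Integral" "HOL-Real_Asymp.Real_Asymp"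
begin

section \<open>Integrals along vertical lines\<close>

text \<open>Two failures of absolute convergence shape the proof. On the imaginary axis the Euler
  integral over all y > 0 is not absolutely convergent, so formulas at a = i q are proved for Re a >
  0 and only the tail over y > 1 is carried to the boundary. Perron's kernel 1 / w is not integrable
  on a line; integrating the bracket by parts once supplies a further 1 / (w + delta), and a second
  integration by parts, in y, removes it again and restores the sharp cutoff.

  The hypotheses are conditions of convergence and position: c + delta + kappa > 1 and kappa - c' >
  1 for the two Dirichlet series on their lines, delta + c' > 1 for the bracket one unit lower in
  xi, 0 < c < 1 and c' > 0 relative to the poles.

  The bracket is identified through a recurrence from xi - 1 to xi that the tail integral shares
  with the series for K; it carries a formula from Re xi < 1 to all xi off the positive
  integers.\<close>

lemma integrable_const_over_1_plus_square: "integrable lborel (\<lambda>t::real. C / (1 + t\<^sup>2))"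
  using integrable_mult_right[of C lborel "\<lambda>t. inverse (1 + t\<^sup>2)"] integrable_inverse_1_plus_square
  by (simp add: set_integrable_def field_simps)

lemma integrable_bound_1_plus_square:
  fixes f :: "real \<Rightarrow> complex"
  assumes "f \<in> borel_measurable borel" "\<And>t. norm (f t) \<le> C / (1 + t\<^sup>2)"
  shows "integrable lborel f"
proof (rule Bochner_Integration.integrable_bound[OF integrable_const_over_1_plus_square[of C]])
  show "f \<in> borel_measurable lborel"
    using assms(1) by simp
  show "AE t in lborel. norm (f t) \<le> norm (C / (1 + t\<^sup>2))"
    using assms(2) by (intro AE_I2) (metis abs_ge_self order_trans real_norm_def)
qed

text \<open>Trades the exponential decay of the reflection kernel for the majorant 1 / (1 + t^2).
  The quadratic Taylor polynomial of exp is enough because pi^2 / 8 > 1.\<close>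

lemma exp_neg_abs_le: "exp (- (pi * \<bar>t\<bar> / 2)) \<le> 1 / (1 + t\<^sup>2)" for t :: real
proof -
  have "1 + t\<^sup>2 \<le> 1 + pi * \<bar>t\<bar> / 2 + (pi * \<bar>t\<bar> / 2)\<^sup>2 / 2"
  proof -
    have "9 * t\<^sup>2 \<le> pi\<^sup>2 * t\<^sup>2"
      using pi_gt3 by (intro mult_right_mono) (auto simp: power2_eq_square intro: mult_mono[of 3 pi 3 pi, simplified])
    moreover have "(pi * \<bar>t\<bar> / 2)\<^sup>2 / 2 = pi\<^sup>2 * t\<^sup>2 / 8"
      by (simp add: power_mult_distrib power_divide)
    moreover have "0 \<le> pi * \<bar>t\<bar>" by simp
    ultimately show ?thesis
      using zero_le_power2[of t] by linarith
  qed
  also have "\<dots> \<le> exp (pi * \<bar>t\<bar> / 2)"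
    by (rule exp_lower_Taylor_quadratic) simp
  finally show ?thesis
    by (simp add: exp_minus field_simps inverse_eq_divide add_pos_nonneg)
qed

lemma continuous_on_Complex_line: "continuous_on A (\<lambda>t. Complex c t)"
  unfolding Complex_eq by (intro continuous_intros)

text \<open>Links the Lebesgue integral along a line to rectangles of growing height, by dominated
  convergence with |f|.\<close>

lemma set_integral_symmetric_tendsto:
  fixes f :: "real \<Rightarrow> complex"
  assumes "integrable lborel f"
  shows "((\<lambda>T. integral {-T..T} f) \<longlongrightarrow> (LINT t|lborel. f t)) at_top"
proof -
  have [measurable]: "f \<in> borel_measurable borel"
    using assms borel_measurable_integrable by fastforce
  have "((\<lambda>T. LINT t|lborel. indicator {-T..T} t *\<^sub>R f t) \<longlongrightarrow> (LINT t|lborel. f t)) at_top"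
  proof (rule integral_dominated_convergence_at_top[where w = "\<lambda>t. norm (f t)"])
    show "AE t in lborel. ((\<lambda>T. indicator {-T..T} t *\<^sub>R f t) \<longlongrightarrow> f t) at_top"
    proof (intro AE_I2 tendsto_eventually)
      fix t :: real
      show "\<forall>\<^sub>F T in at_top. indicator {-T..T} t *\<^sub>R f t = f t"
        using eventually_ge_at_top[of "\<bar>t\<bar>"] by eventually_elim (auto simp: indicator_def)
    qed
    show "\<forall>\<^sub>F T in at_top. AE t in lborel. norm (indicator {-T..T} t *\<^sub>R f t) \<le> norm (f t)"
      by (intro always_eventually allI AE_I2) (auto simp: indicator_def)
  qed (use assms in auto)
  moreover have "(LINT t|lborel. indicator {-T..T} t *\<^sub>R f t) = integral {-T..T} f" for T
  proof -
    have "set_integrable lborel {-T..T} f"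
      unfolding set_integrable_def using assms by (intro integrable_mult_indicator) auto
    from set_borel_integral_eq_integral(2)[OF this] show ?thesis
      by (simp add: set_lebesgue_integral_def)
  qed
  ultimately show ?thesis by simp
qed

text \<open>The residue theorem enters only through the value \<open>V\<close> of the rectangle
  integrals, so the same lemma covers holomorphic integrands (\<open>V = 0\<close>) and crossed
  poles. The horizontal sides have fixed length b - a and are controlled by \<open>M\<close>, so
  they die out.\<close>

lemma vline_integral_diff:
  assumes "a < b" and int: "vline_integrable a f" "vline_integrable b f"
    and rect: "\<And>T. T \<ge> T0 \<Longrightarrow> (f has_contour_integral V) (rectpath (Complex a (-T)) (Complex b T))"
    and bnd: "\<And>x t. a \<le> x \<Longrightarrow> x \<le> b \<Longrightarrow> \<bar>t\<bar> \<ge> T0 \<Longrightarrow> norm (f (Complex x t)) \<le> M \<bar>t\<bar>"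
    and M: "(M \<longlongrightarrow> 0) at_top"
  shows "vline_integral b f - vline_integral a f = V"
proof -
  have lim: "((\<lambda>T. \<i> * integral {-T..T} (\<lambda>t. f (Complex x t))) \<longlongrightarrow> vline_integral x f) at_top"
    if "vline_integrable x f" for x
    unfolding vline_integral_def using that
    by (intro tendsto_intros set_integral_symmetric_tendsto) (auto simp: vline_integrable_def)
  \<comment> \<open>This is \<open>V\<close> without the two vertical sides, hence the contribution
    of the horizontal ones. Its limit is computed twice: as 0 from \<open>M\<close>, and from the
    convergent vertical integrals.\<close>
  have "((\<lambda>T. V - \<i> * integral {-T..T} (\<lambda>t. f (Complex b t)) + \<i> * integral {-T..T} (\<lambda>t. f (Complex a t)))
          \<longlongrightarrow> 0) at_top"
  proof (rule Lim_null_comparison)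
    show "((\<lambda>T. 2 * (M T * (b - a))) \<longlongrightarrow> 0) at_top"
      using tendsto_mult_left[OF tendsto_mult_right[OF M, of "b - a"], of 2] by simp
    show "\<forall>\<^sub>F T in at_top. norm (V - \<i> * integral {-T..T} (\<lambda>t. f (Complex b t))
             + \<i> * integral {-T..T} (\<lambda>t. f (Complex a t))) \<le> 2 * (M T * (b - a))"
      using eventually_ge_at_top[of "max T0 1"]
    proof eventually_elim
      case (elim T)
      hence T: "T \<ge> T0" "T > 0" by auto
      define a1 a2 a3 a4 where "a1 = Complex a (-T)" and "a2 = Complex b (-T)"
        and "a3 = Complex b T" and "a4 = Complex a T"
      have V: "(f has_contour_integral V) (linepath a1 a2 +++ linepath a2 a3 +++ linepath a3 a4 +++ linepath a4 a1)"
        using rect[OF T(1)] by (simp add: rectpath_def Let_def a1_def a2_def a3_def a4_def)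
      hence i: "f contour_integrable_on (linepath a1 a2 +++ linepath a2 a3 +++ linepath a3 a4 +++ linepath a4 a1)"
        by (auto simp: contour_integrable_on_def)
      have i1: "f contour_integrable_on linepath a1 a2"
        using contour_integrable_joinD1[OF i] by simp
      have j1: "f contour_integrable_on (linepath a2 a3 +++ linepath a3 a4 +++ linepath a4 a1)"
        using contour_integrable_joinD2[OF i] by simp
      have i2: "f contour_integrable_on linepath a2 a3"
        using contour_integrable_joinD1[OF j1] by simp
      have j2: "f contour_integrable_on (linepath a3 a4 +++ linepath a4 a1)"
        using contour_integrable_joinD2[OF j1] by simp
      have i3: "f contour_integrable_on linepath a3 a4"
        using contour_integrable_joinD1[OF j2] by simp
      have i4: "f contour_integrable_on linepath a4 a1"
        using contour_integrable_joinD2[OF j2] by simp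
      have "V = contour_integral (linepath a1 a2 +++ linepath a2 a3 +++ linepath a3 a4 +++ linepath a4 a1) f"
        using contour_integral_unique[OF V] by simp
      also have "\<dots> = contour_integral (linepath a1 a2) f + contour_integral (linepath a2 a3) f
                     + contour_integral (linepath a3 a4) f + contour_integral (linepath a4 a1) f"
        using i1 i2 i3 i4 j1 j2 by simp
      also have "contour_integral (linepath a2 a3) f = \<i> * integral {-T..T} (\<lambda>t. f (Complex b t))"
        using T by (intro contour_integral_linepath_same_Re) (auto simp: a2_def a3_def)
      also have "contour_integral (linepath a4 a1) f = - contour_integral (linepath a1 a4) f"
        using contour_integral_reversepath[of "linepath a1 a4" f] by simp
      also have "contour_integral (linepath a1 a4) f = \<i> * integral {-T..T} (\<lambda>t. f (Complex a t))"
        using T by (intro contour_integral_linepath_same_Re) (auto simp: a1_def a4_def)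
      finally have eq: "V - \<i> * integral {-T..T} (\<lambda>t. f (Complex b t))
             + \<i> * integral {-T..T} (\<lambda>t. f (Complex a t))
           = contour_integral (linepath a1 a2) f + contour_integral (linepath a3 a4) f"
        by simp
      have M0: "0 \<le> M T"
        using bnd[of a T] T \<open>a < b\<close> norm_ge_zero[of "f (Complex a T)"] by linarith
      have "norm (contour_integral (linepath a1 a2) f) \<le> M T * norm (a2 - a1)"
      proof (rule has_contour_integral_bound_linepath[OF has_contour_integral_integral[OF i1] M0])
        fix z assume "z \<in> closed_segment a1 a2"
        hence "z = Complex (Re z) (-T)" "a \<le> Re z" "Re z \<le> b"
          using \<open>a < b\<close> by (auto simp: a1_def a2_def closed_segment_same_Im closed_segment_eq_real_ivl complex_eq_iff)
        thus "norm (f z) \<le> M T" using bnd[of "Re z" "-T"] T by simp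
      qed
      moreover have "norm (contour_integral (linepath a3 a4) f) \<le> M T * norm (a4 - a3)"
      proof (rule has_contour_integral_bound_linepath[OF has_contour_integral_integral[OF i3] M0])
        fix z assume "z \<in> closed_segment a3 a4"
        hence "z = Complex (Re z) T" "a \<le> Re z" "Re z \<le> b"
          using \<open>a < b\<close> by (auto simp: a3_def a4_def closed_segment_same_Im closed_segment_eq_real_ivl complex_eq_iff)
        thus "norm (f z) \<le> M T" using bnd[of "Re z" "T"] T by simp
      qed
      moreover have "norm (a2 - a1) = b - a" "norm (a4 - a3) = b - a"
        using \<open>a < b\<close> by (auto simp: a1_def a2_def a3_def a4_def complex_diff cmod_eq_Re)
      ultimately show ?case
        unfolding eq by (intro order.trans[OF norm_triangle_ineq]) simp
    qed
  qed
  moreover have "((\<lambda>T. V - \<i> * integral {-T..T} (\<lambda>t. f (Complex b t)) + \<i> * integral {-T..T} (\<lambda>t. f (Complex a t)))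
          \<longlongrightarrow> V - vline_integral b f + vline_integral a f) at_top"
    by (intro tendsto_intros lim int)
  ultimately have "V - vline_integral b f + vline_integral a f = 0"
    using tendsto_unique trivial_limit_at_top_linorder by blast
  thus ?thesis by (simp add: algebra_simps)
qed

section \<open>The Perron kernel\<close>

text \<open>Perron's kernel e^(wl) / w with an extra factor 1 / (w + d) that makes it absolutely
  integrable on lines avoiding both poles. The jump at l = 0 becomes the continuous weight (1 -
  e^(-dl)) / d for l >= 0.\<close>

definition perron_kernel :: "real \<Rightarrow> real \<Rightarrow> complex \<Rightarrow> complex" where
  "perron_kernel d l w = exp (w * l) / (w * (w + d))"

text \<open>After squaring, the two sides are compared coefficientwise in t^2. Two such factors, for
  the poles 0 and -d, multiply to a multiple of 1 + t^2.\<close>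

lemma norm_Complex_ge: "norm (Complex a t) \<ge> min 1 \<bar>a\<bar> * sqrt (1 + t\<^sup>2)"
proof -
  have "(min 1 \<bar>a\<bar>)\<^sup>2 * (1 + t\<^sup>2) \<le> a\<^sup>2 + t\<^sup>2"
  proof -
    have "(min 1 \<bar>a\<bar>)\<^sup>2 \<le> 1" "(min 1 \<bar>a\<bar>)\<^sup>2 \<le> a\<^sup>2"
      by (auto simp: min_def abs_square_le_1 abs_le_square_iff [symmetric])
    thus ?thesis
      using mult_right_mono[of "(min 1 \<bar>a\<bar>)\<^sup>2" 1 "t\<^sup>2"] by (simp add: algebra_simps)
  qed
  hence "sqrt ((min 1 \<bar>a\<bar>)\<^sup>2 * (1 + t\<^sup>2)) \<le> sqrt (a\<^sup>2 + t\<^sup>2)"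
    by (rule real_sqrt_le_mono)
  thus ?thesis
    by (simp add: real_sqrt_mult complex_norm)
qed

lemma norm_perron_denominator_ge:
  "norm (Complex a t * (Complex a t + of_real d)) \<ge> min 1 \<bar>a\<bar> * min 1 \<bar>a + d\<bar> * (1 + t\<^sup>2)"
proof -
  have "Complex a t + of_real d = Complex (a + d) t"
    by (simp add: complex_eq_iff)
  moreover have "(min 1 \<bar>a\<bar> * sqrt (1 + t\<^sup>2)) * (min 1 \<bar>a + d\<bar> * sqrt (1 + t\<^sup>2))
       \<le> norm (Complex a t) * norm (Complex (a + d) t)"
    by (intro mult_mono norm_Complex_ge) auto
  moreover have "sqrt (1 + t\<^sup>2) * sqrt (1 + t\<^sup>2) = 1 + t\<^sup>2"
    by (intro real_sqrt_mult_self[THEN trans]) auto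
  ultimately show ?thesis
    by (simp add: norm_mult algebra_simps)
qed

lemma norm_perron_kernel_le:
  assumes "a \<noteq> 0" "a + d \<noteq> 0"
  shows "norm (perron_kernel d l (Complex a t)) \<le> exp (a * l) / (min 1 \<bar>a\<bar> * min 1 \<bar>a + d\<bar>) / (1 + t\<^sup>2)"
proof -
  have pos: "0 < min 1 \<bar>a\<bar> * min 1 \<bar>a + d\<bar> * (1 + t\<^sup>2)"
    using assms by (intro mult_pos_pos) (auto simp: add_pos_nonneg)
  have "norm (perron_kernel d l (Complex a t)) = exp (a * l) / norm (Complex a t * (Complex a t + of_real d))"
    by (simp add: perron_kernel_def norm_divide norm_exp_eq_Re)
  also have "\<dots> \<le> exp (a * l) / (min 1 \<bar>a\<bar> * min 1 \<bar>a + d\<bar> * (1 + t\<^sup>2))"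
    using norm_perron_denominator_ge[of a d t] pos less_le_trans[OF pos norm_perron_denominator_ge]
    by (intro divide_left_mono) simp_all
  finally show ?thesis by simp
qed

lemma continuous_perron_kernel_line:
  assumes "a \<noteq> 0" "a + d \<noteq> 0"
  shows "continuous_on UNIV (\<lambda>t. perron_kernel d l (Complex a t))"
proof -
  have "Complex a t \<noteq> 0" "Complex a t + of_real d \<noteq> 0" for t
    using assms by (auto simp: complex_eq_iff)
  thus ?thesis
    unfolding perron_kernel_def by (intro continuous_intros continuous_on_Complex_line) auto
qed

lemma vline_integrable_perron_kernel:
  assumes "a \<noteq> 0" "a + d \<noteq> 0"
  shows "vline_integrable a (perron_kernel d l)"
  unfolding vline_integrable_def
  by (intro integrable_bound_1_plus_square[OF _ norm_perron_kernel_le] borel_measurable_continuous_onI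
        continuous_perron_kernel_line assms)

text \<open>Companion bound for the horizontal sides: it uses only imaginary parts in the
  denominator, so it is uniform in x and unaffected by the poles on the real axis.\<close>

lemma norm_perron_kernel_le':
  assumes "\<bar>x\<bar> \<le> A" "\<bar>t\<bar> > 0"
  shows "norm (perron_kernel d l (Complex x t)) \<le> exp (A * \<bar>l\<bar>) / \<bar>t\<bar> ^ 2"
proof -
  have "x * l \<le> A * \<bar>l\<bar>"
    using assms mult_right_mono[of "\<bar>x\<bar>" A "\<bar>l\<bar>"] abs_ge_self[of "x * l"] by (simp add: abs_mult)
  moreover have "\<bar>t\<bar> \<le> norm (Complex x t)" "\<bar>t\<bar> \<le> norm (Complex x t + of_real d)"
    using abs_Im_le_cmod[of "Complex x t"] abs_Im_le_cmod[of "Complex x t + of_real d"] by auto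
  ultimately show ?thesis
    using assms unfolding perron_kernel_def norm_divide norm_mult norm_exp_eq_Re power2_eq_square
    by (intro frac_le mult_mono mult_pos_pos) auto
qed

lemma perron_bound_tendsto_0: "((\<lambda>T. C / T ^ 2) \<longlongrightarrow> 0) at_top" for C :: real
  by (rule tendsto_divide_0[OF tendsto_const])
     (auto intro!: filterlim_at_top_imp_at_infinity filterlim_pow_at_top filterlim_ident)

text \<open>For l <= 0 the exponential stays bounded to the right of the line and there are no poles
  there, so the line can be moved to infinity, where the integral tends to 0.\<close>

lemma vline_integral_perron_kernel_nonpos:
  assumes "c > 0" "d > 0" "l \<le> 0"
  shows "vline_integral c (perron_kernel d l) = 0"
proof -
  have eq: "vline_integral b (perron_kernel d l) - vline_integral c (perron_kernel d l) = 0" if "b > c" for b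
  proof (rule vline_integral_diff[OF that])
    fix T :: real assume "T \<ge> 1"
    have "path_image (rectpath (Complex c (- T)) (Complex b T)) \<subseteq> {z. Re z > 0}"
      using path_image_rectpath_subset_cbox[of "Complex c (-T)" "Complex b T"] that \<open>T \<ge> 1\<close> \<open>c > 0\<close>
      by (force simp: in_cbox_complex_iff)
    moreover have "z \<noteq> 0 \<and> z + of_real d \<noteq> 0" if "Re z > 0" for z
      using that assms by (auto simp: complex_eq_iff)
    hence "perron_kernel d l holomorphic_on {z. Re z > 0}"
      unfolding perron_kernel_def by (intro holomorphic_intros) auto
    ultimately show "(perron_kernel d l has_contour_integral 0) (rectpath (Complex c (- T)) (Complex b T))"
      by (intro Cauchy_theorem_convex_simple[of _ "{z. Re z > 0}"]) (auto simp: convex_halfspace_Re_gt)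
  next
    fix x t :: real assume "c \<le> x" "x \<le> b" "\<bar>t\<bar> \<ge> 1"
    thus "norm (perron_kernel d l (Complex x t)) \<le> exp (b * \<bar>l\<bar>) / \<bar>t\<bar> ^ 2"
      using assms by (intro norm_perron_kernel_le') auto
  qed (use assms that in \<open>auto intro!: vline_integrable_perron_kernel perron_bound_tendsto_0\<close>)
  \<comment> \<open>Starting at c + 1 makes \<open>u n\<close> and \<open>u n + d\<close> at least
    1, so the minima in \<open>norm_perron_kernel_le\<close> are 1 and the single majorant 1 / (1 +
    t^2) serves every n.\<close>
  define u where "u n = c + 1 + real n" for n
  have "(\<lambda>n. LINT t|lborel. perron_kernel d l (Complex (u n) t)) \<longlonglongrightarrow> (LINT (t::real)|lborel. (0 :: complex))"
  proof (rule Bochner_Integration.integral_dominated_convergence[where w = "\<lambda>t. 1 / (1 + t\<^sup>2)"])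
    show "(\<lambda>t. perron_kernel d l (Complex (u n) t)) \<in> borel_measurable lborel" for n
      using continuous_perron_kernel_line[of "u n" d l] assms
      by (auto simp: u_def intro!: borel_measurable_continuous_onI)
    show "AE t in lborel. norm (perron_kernel d l (Complex (u n) t)) \<le> 1 / (1 + t\<^sup>2)" for n
    proof (rule AE_I2)
      fix t :: real
      have "u n \<ge> 1" "u n + d \<ge> 1" using assms by (auto simp: u_def)
      moreover have "exp (u n * l) \<le> 1"
        using assms \<open>u n \<ge> 1\<close> by (simp add: mult_nonneg_nonpos)
      ultimately have "norm (perron_kernel d l (Complex (u n) t)) \<le> exp (u n * l) / (1 + t\<^sup>2)"
        using norm_perron_kernel_le[of "u n" d l t] by (simp add: min_absorb1)
      also have "\<dots> \<le> 1 / (1 + t\<^sup>2)"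
        using \<open>exp (u n * l) \<le> 1\<close> by (intro divide_right_mono) auto
      finally show "norm (perron_kernel d l (Complex (u n) t)) \<le> 1 / (1 + t\<^sup>2)" .
    qed
    show "AE t in lborel. (\<lambda>n. perron_kernel d l (Complex (u n) t)) \<longlonglongrightarrow> 0"
    proof (rule AE_I2, rule Lim_null_comparison)
      fix t :: real
      show "(\<lambda>n. 1 / u n) \<longlonglongrightarrow> 0"
        unfolding u_def
        by (intro tendsto_divide_0[OF tendsto_const] filterlim_at_top_imp_at_infinity
              filterlim_tendsto_add_at_top[OF tendsto_const] filterlim_real_sequentially)
      show "\<forall>\<^sub>F n in sequentially. norm (perron_kernel d l (Complex (u n) t)) \<le> 1 / u n"
      proof (intro always_eventually allI)
        fix n
        have u: "u n \<ge> 1" using assms by (auto simp: u_def)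
        have "exp (u n * l) \<le> 1"
          using assms u by (simp add: mult_nonneg_nonpos)
        moreover have "u n \<le> norm (Complex (u n) t)"
          using complex_Re_le_cmod[of "Complex (u n) t"] by simp
        moreover have "1 \<le> norm (Complex (u n) t + of_real d)"
          using complex_Re_le_cmod[of "Complex (u n) t + of_real d"] u assms by simp
        ultimately have "norm (perron_kernel d l (Complex (u n) t)) \<le> 1 / (u n * 1)"
          unfolding perron_kernel_def norm_divide norm_mult norm_exp_eq_Re
          using u by (intro frac_le mult_mono) simp_all
        thus "norm (perron_kernel d l (Complex (u n) t)) \<le> 1 / u n" by simp
      qed
    qed
  qed (simp_all add: integrable_const_over_1_plus_square)
  hence "(\<lambda>n. vline_integral (u n) (perron_kernel d l)) \<longlonglongrightarrow> \<i> * (LINT (t::real)|lborel. (0 :: complex))"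
    unfolding vline_integral_def by (rule tendsto_mult_left)
  moreover have "vline_integral (u n) (perron_kernel d l) = vline_integral c (perron_kernel d l)" for n
    using eq[of "u n"] by (simp add: u_def)
  ultimately show ?thesis
    by (simp add: LIMSEQ_const_iff)
qed

text \<open>The line is moved left across the poles 0 and -d, whose residues are 1 / d and - e^(-dl)
  / d.\<close>

lemma vline_integral_perron_kernel_nonneg:
  assumes "c > 0" "d > 0" "l \<ge> 0"
  shows "vline_integral c (perron_kernel d l) = 2 * pi * \<i> * of_real ((1 - exp (- d * l)) / d)"
proof -
  \<comment> \<open>The abscissa - c - d is the mirror image of c under w to - d - w, which
    preserves w (w + d) and changes l to - l. Up to a constant factor, the remaining integral is
    thus an instance of the nonpositive case.\<close>
  define a where "a = - c - d"
  have "vline_integral c (perron_kernel d l) - vline_integral a (perron_kernel d l)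
          = 2 * pi * \<i> * of_real ((1 - exp (- d * l)) / d)"
  proof (rule vline_integral_diff)
    fix T :: real assume T: "T \<ge> 1"
    let ?R = "rectpath (Complex a (- T)) (Complex c T)"
    have z: "0 \<in> box (Complex a (- T)) (Complex c T)" "- of_real d \<in> box (Complex a (- T)) (Complex c T)"
      using assms T by (auto simp: in_box_complex_iff a_def)
    have "path_image ?R = cbox (Complex a (- T)) (Complex c T) - box (Complex a (- T)) (Complex c T)"
      using assms T by (intro path_image_rectpath_cbox_minus_box) (auto simp: a_def)
    hence sub: "path_image ?R \<subseteq> UNIV - {0}" "path_image ?R \<subseteq> UNIV - {- of_real d}"
      using z by blast+
    have I: "((\<lambda>w. exp (w * l) / (w - z)) has_contour_integral 2 * pi * \<i> * winding_number ?R z * exp (z * l)) ?R"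
      if "path_image ?R \<subseteq> UNIV - {z}" for z :: complex
      using that by (intro Cauchy_integral_formula_convex_simple[of UNIV "\<lambda>w. exp (w * l)"]) 
         (auto intro!: holomorphic_intros)
    \<comment> \<open>Partial fractions, 1 / (w (w + d)) = (1 / w - 1 / (w + d)) / d, let Cauchy's
      formula treat each pole separately.\<close>
    have "((\<lambda>w. (exp (w * l) / (w - 0) - exp (w * l) / (w - (- of_real d))) / d) has_contour_integral
            (2 * pi * \<i> * winding_number ?R 0 * exp (0 * of_real l)
             - 2 * pi * \<i> * winding_number ?R (- of_real d) * exp (- of_real d * of_real l)) / d) ?R"
      by (intro has_contour_integral_diff has_contour_integral_div I sub)
    also have "winding_number ?R 0 = 1"
      using z(1) by (rule winding_number_rectpath)
    also have "winding_number ?R (- of_real d) = 1"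
      using z(2) by (rule winding_number_rectpath)
    also have "(2 * pi * \<i> * 1 * exp (0 * of_real l) - 2 * pi * \<i> * 1 * exp (- of_real d * of_real l)) / d
                 = 2 * pi * \<i> * of_real ((1 - exp (- d * l)) / d)"
      using assms exp_of_real[of "- d * l", where ?'a = complex] by (simp add: right_diff_distrib diff_divide_distrib)
    finally have J: "((\<lambda>w. (exp (w * l) / (w - 0) - exp (w * l) / (w - (- of_real d))) / d) has_contour_integral
            2 * pi * \<i> * of_real ((1 - exp (- d * l)) / d)) ?R" .
    show "(perron_kernel d l has_contour_integral 2 * pi * \<i> * of_real ((1 - exp (- d * l)) / d)) ?R"
    proof (rule has_contour_integral_eq[OF J])
      fix w assume "w \<in> path_image ?R"
      hence "w \<noteq> 0" "w + of_real d \<noteq> 0"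
        using sub by (auto simp: eq_neg_iff_add_eq_0)
      thus "(exp (w * l) / (w - 0) - exp (w * l) / (w - (- of_real d))) / d = perron_kernel d l w"
        using assms by (simp add: perron_kernel_def divide_simps) (simp add: algebra_simps)
    qed
  next
    fix x t :: real assume "a \<le> x" "x \<le> c" "\<bar>t\<bar> \<ge> 1"
    thus "norm (perron_kernel d l (Complex x t)) \<le> exp ((c + d) * \<bar>l\<bar>) / \<bar>t\<bar> ^ 2"
      using assms by (intro norm_perron_kernel_le') (auto simp: a_def)
  qed (use assms in \<open>auto intro!: vline_integrable_perron_kernel perron_bound_tendsto_0 simp: a_def\<close>)
  moreover have "vline_integral a (perron_kernel d l) = 0"
  proof -
    have "perron_kernel d l (Complex a t) = exp (- d * l) * perron_kernel d (- l) (Complex c (-t))" for t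
    proof -
      define w where "w = Complex c (-t)"
      have "Complex a t = - of_real d - w"
        by (simp add: w_def a_def complex_eq_iff)
      moreover have "(- of_real d - w) * l = of_real (- d * l) + w * of_real (- l)"
        by (simp add: algebra_simps)
      hence "exp ((- of_real d - w) * l) = exp (- d * l) * exp (w * of_real (- l))"
        by (simp only: exp_add exp_of_real)
      moreover have "(- of_real d - w) * (- of_real d - w + of_real d) = w * (w + of_real d)"
        by (simp add: algebra_simps)
      ultimately show ?thesis
        by (simp add: perron_kernel_def w_def [symmetric])
    qed
    hence "(LINT t|lborel. perron_kernel d l (Complex a t))
             = exp (- d * l) * (LINT t|lborel. perron_kernel d (- l) (Complex c (-t)))"
      by simp
    also have "(LINT t|lborel. perron_kernel d (- l) (Complex c (-t))) = (LINT t|lborel. perron_kernel d (- l) (Complex c t))"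
      using lborel_integral_real_affine[of "-1" "\<lambda>t. perron_kernel d (- l) (Complex c t)" 0] by simp
    also have "\<dots> = 0"
      using vline_integral_perron_kernel_nonpos[of c d "-l"] assms by (simp add: vline_integral_def)
    finally show ?thesis by (simp add: vline_integral_def)
  qed
  ultimately show ?thesis by simp
qed

section \<open>The reflection kernel\<close>

text \<open>Both bounds come from |sin (x + iy)|^2 = sin(x)^2 + sinh(y)^2. The first gives decay of
  1 / sin along a vertical line away from the zeros; the second is uniform in x and serves the
  horizontal sides.\<close>

lemma norm_sin_ge:
  shows norm_sin_ge_vertical: "norm (sin z) \<ge> \<bar>sin (Re z)\<bar> * exp \<bar>Im z\<bar> / 2"
    and norm_sin_ge_horizontal: "\<bar>Im z\<bar> \<ge> 1 \<Longrightarrow> norm (sin z) \<ge> exp \<bar>Im z\<bar> / 4"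
proof -
  define A where "A = exp \<bar>Im z\<bar>"
  define s where "s = \<bar>sin (Re z)\<bar>"
  have A: "A \<ge> 1" "A > 0" by (auto simp: A_def)
  have s: "0 \<le> s" "s \<le> 1" "s\<^sup>2 \<le> 1" by (auto simp: s_def abs_square_le_1)
  have e: "exp (2 * Im z) + inverse (exp (2 * Im z)) = A\<^sup>2 + inverse A ^ 2"
    by (cases "Im z \<ge> 0") (auto simp: A_def power2_eq_square exp_add [symmetric] exp_minus [symmetric])
  have "norm (sin z) ^ 2 = (A\<^sup>2 + inverse A ^ 2 - 2 * cos (2 * Re z)) / 4"
    unfolding norm_sin_squared e ..
  also have "cos (2 * Re z) = 1 - 2 * s\<^sup>2"
    by (simp add: s_def cos_double_sin)
  \<comment> \<open>Here (A - 1 / A) / 2 is sinh |Im z|.\<close>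
  finally have eq: "norm (sin z) ^ 2 = ((A - inverse A) ^ 2 + 4 * s\<^sup>2) / 4"
    using A by (simp add: power2_diff field_simps power2_eq_square)
  have "(s * A / 2)\<^sup>2 \<le> s\<^sup>2 * (A + inverse A)\<^sup>2 / 4"
    using A s by (simp add: power_mult_distrib power_divide)
       (intro mult_left_mono power_mono, auto)
  also have "(A + inverse A)\<^sup>2 = (A - inverse A)\<^sup>2 + 4"
    using A by (simp add: power2_diff power2_sum)
  also have "s\<^sup>2 * ((A - inverse A)\<^sup>2 + 4) / 4 \<le> ((A - inverse A)\<^sup>2 + 4 * s\<^sup>2) / 4"
    using s mult_left_le_one_le[of "(A - inverse A)\<^sup>2" "s\<^sup>2"] by (simp add: algebra_simps)
  finally have "(s * A / 2)\<^sup>2 \<le> norm (sin z) ^ 2" by (simp add: eq)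
  thus "norm (sin z) \<ge> \<bar>sin (Re z)\<bar> * exp \<bar>Im z\<bar> / 2"
    unfolding s_def [symmetric] A_def [symmetric] by (rule power2_le_imp_le) simp
  assume "\<bar>Im z\<bar> \<ge> 1"
  hence "A \<ge> 2"
    using exp_ge_add_one_self[of "\<bar>Im z\<bar>"] unfolding A_def by linarith
  hence "inverse A \<le> A / 2" 
    using A by (simp add: field_simps) (use mult_mono[of 2 A 2 A] in simp)
  hence "(A / 4)\<^sup>2 \<le> ((A - inverse A) / 2)\<^sup>2"
    using A by (intro power_mono) auto
  also have "\<dots> \<le> norm (sin z) ^ 2"
    using s by (simp add: eq power_divide)
  finally show "norm (sin z) \<ge> exp \<bar>Im z\<bar> / 4"
    unfolding A_def [symmetric] by (rule power2_le_imp_le) simp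
qed

text \<open>With Ln (i r) = ln r + i pi / 2 this is pi / sin (pi s) times (i r)^(-s), the kernel of
  the Mellin inversion formula for 1 / (1 + z) at z = i r.\<close>

definition refl_kernel :: "real \<Rightarrow> complex \<Rightarrow> complex" where
  "refl_kernel r s = Gamma s * Gamma (1 - s) * exp (- s * (of_real (ln r) + \<i> * pi / 2))"

lemma refl_kernel_eq_sin:
  "refl_kernel r s = pi / sin (pi * s) * exp (- s * (of_real (ln r) + \<i> * pi / 2))" for s :: complex
  by (simp add: refl_kernel_def Gamma_reflection_complex)

text \<open>The factor e^(- i pi s / 2) can grow like e^(pi |Im s| / 2), which consumes half of the
  decay e^(- pi |Im s|) of 1 / sin (pi s). The parameter \<open>m\<close> stands for the constant of
  whichever lower bound on the sine is available.\<close>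

lemma refl_kernel_bound:
  fixes s :: complex
  assumes m: "m > 0" "norm (sin (pi * s)) \<ge> m * exp (pi * \<bar>Im s\<bar>)" and s: "\<bar>Re s\<bar> \<le> 1"
  shows "norm (refl_kernel r s) \<le> pi * exp \<bar>ln r\<bar> / m * exp (- (pi * \<bar>Im s\<bar> / 2))"
proof -
  have "Re (- s * (of_real (ln r) + \<i> * pi / 2)) = - Re s * ln r + pi / 2 * Im s"
    by simp
  also have "\<dots> \<le> \<bar>Re s\<bar> * \<bar>ln r\<bar> + pi / 2 * \<bar>Im s\<bar>"
    by (intro add_mono mult_left_mono) (auto simp: abs_mult [symmetric])
  also have "\<dots> \<le> 1 * \<bar>ln r\<bar> + pi / 2 * \<bar>Im s\<bar>"
    using s by (intro add_mono mult_right_mono) auto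
  finally have 1: "norm (exp (- s * (of_real (ln r) + \<i> * pi / 2))) \<le> exp (\<bar>ln r\<bar> + pi / 2 * \<bar>Im s\<bar>)"
    by (simp add: norm_exp_eq_Re)
  have pos: "0 < m * exp (pi * \<bar>Im s\<bar>)" using m by simp
  have "norm (refl_kernel r s) = pi / norm (sin (pi * s)) * norm (exp (- s * (of_real (ln r) + \<i> * pi / 2)))"
    by (simp add: refl_kernel_eq_sin norm_mult norm_divide)
  also have "\<dots> \<le> pi / (m * exp (pi * \<bar>Im s\<bar>)) * exp (\<bar>ln r\<bar> + pi / 2 * \<bar>Im s\<bar>)"
    by (intro mult_mono divide_left_mono m 1 mult_pos_pos less_le_trans[OF pos m(2)] pos) (use pos in simp_all)
  also have "\<dots> = pi * exp \<bar>ln r\<bar> / m * exp (- (pi * \<bar>Im s\<bar> / 2))"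
    using m by (simp add: field_simps exp_add [symmetric] exp_diff [symmetric] exp_minus)
  finally show ?thesis .
qed

lemma refl_kernel_minus_1:
  fixes s :: complex
  assumes "r > 0"
  shows "refl_kernel r (s - 1) = - \<i> * r * refl_kernel r s"
proof -
  have "sin (pi * (s - 1)) = - sin (pi * s)"
    by (simp add: algebra_simps sin_diff sin_of_real cos_of_real)
  moreover have "exp (- (s - 1) * L) = exp (- s * L) * exp L" for L :: complex
    by (simp add: exp_add [symmetric] algebra_simps)
  moreover have "exp (complex_of_real (ln r) + \<i> * pi / 2) = exp (of_real (ln r)) * exp (\<i> * pi / 2)"
    by (rule exp_add)
  moreover have "exp (complex_of_real (ln r)) = r"
    using assms by (simp add: exp_of_real)
  moreover have "exp (\<i> * pi / 2) = \<i>"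
    using cis_conv_exp[of "pi/2"] by (simp add: mult.commute)
  ultimately show ?thesis
    unfolding refl_kernel_eq_sin by simp
qed

text \<open>The absolute value on c admits the line c - 1 as well, to which the integral is later
  shifted.\<close>

lemma refl_kernel_bound_vertical:
  assumes "0 < \<bar>c\<bar>" "\<bar>c\<bar> < 1"
  obtains C where "\<And>t. norm (refl_kernel r (Complex c t)) \<le> C / (1 + t\<^sup>2)"
proof
  fix t :: real
  define m where "m = \<bar>sin (pi * c)\<bar> / 2"
  have "sin (pi * c) \<noteq> 0"
  proof
    assume "sin (pi * c) = 0"
    then obtain i :: int where "pi * c = of_int i * pi" by (auto simp: sin_zero_iff_int2)
    hence "c = of_int i" by simp
    with assms show False by (auto simp: of_int_abs [symmetric] simp del: of_int_abs)
  qed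
  hence m: "m > 0" by (simp add: m_def)
  have "norm (refl_kernel r (Complex c t)) \<le> pi * exp \<bar>ln r\<bar> / m * exp (- (pi * \<bar>Im (Complex c t)\<bar> / 2))"
    using assms norm_sin_ge_vertical[of "pi * Complex c t"] m
    by (intro refl_kernel_bound) (auto simp: m_def abs_mult)
  also have "\<dots> \<le> pi * exp \<bar>ln r\<bar> / m * (1 / (1 + t\<^sup>2))"
    using m exp_neg_abs_le[of t] by (intro mult_left_mono) auto
  finally show "norm (refl_kernel r (Complex c t)) \<le> (pi * exp \<bar>ln r\<bar> / (\<bar>sin (pi * c)\<bar> / 2)) / (1 + t\<^sup>2)"
    by (simp add: m_def)
qed

lemma not_Ints_Complex: "0 < \<bar>c\<bar> \<Longrightarrow> \<bar>c\<bar> < 1 \<Longrightarrow> Complex c t \<notin> \<int>"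
  by (auto elim!: Ints_cases simp: complex_eq_iff of_int_abs [symmetric] simp del: of_int_abs)

lemma continuous_refl_kernel_line:
  assumes "0 < \<bar>c\<bar>" "\<bar>c\<bar> < 1"
  shows "continuous_on UNIV (\<lambda>t. refl_kernel r (Complex c t))"
proof -
  have "Complex c t \<notin> \<int>\<^sub>\<le>\<^sub>0" "1 - Complex c t \<notin> \<int>\<^sub>\<le>\<^sub>0" for t
    using not_Ints_Complex[OF assms, of t] nonpos_Ints_Int Ints_diff[OF Ints_1, of "1 - Complex c t"] by auto
  thus ?thesis
    unfolding refl_kernel_def
    by (intro continuous_intros continuous_on_Complex_line
          continuous_on_compose2[OF continuous_on_Gamma[of "- \<int>\<^sub>\<le>\<^sub>0"]]) auto
qed

lemma vline_integrable_refl_kernel: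
  assumes "0 < \<bar>c\<bar>" "\<bar>c\<bar> < 1"
  shows "vline_integrable c (refl_kernel r)"
proof -
  from refl_kernel_bound_vertical[OF assms] obtain C
    where "\<And>t. norm (refl_kernel r (Complex c t)) \<le> C / (1 + t\<^sup>2)" by blast
  thus ?thesis unfolding vline_integrable_def
    by (intro integrable_bound_1_plus_square borel_measurable_continuous_onI continuous_refl_kernel_line assms)
qed

text \<open>
  Shifting the line from \<open>c\<close> to \<open>c - 1\<close> crosses the pole at \<open>0\<close> with residue \<open>1\<close> and multiplies
  the kernel by \<open>-i r\<close>; so the integral \<open>I\<close> satisfies \<open>I + i r I = 1\<close>.
\<close>

lemma vline_integral_refl_kernel:
  assumes "0 < c" "c < 1" "r > 0"
  shows "vline_integral c (refl_kernel r) = 2 * pi * \<i> / (1 + \<i> * r)"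
proof -
  \<comment> \<open>\<open>g\<close> is s times the kernel with the pole at 0 removed by Gamma (1 +
    s) = s Gamma s; its value 1 at 0 is the residue.\<close>
  define g where "g s = Gamma (1 + s) * Gamma (1 - s) * exp (- s * (of_real (ln r) + \<i> * pi / 2))" for s :: complex
  define S where "S = {s. Re s > -1} \<inter> {s. Re s < 1}"
  have S: "convex S" "open S" unfolding S_def
    by (intro convex_Int convex_halfspace_Re_gt convex_halfspace_Re_lt open_Int open_halfspace_Re_gt open_halfspace_Re_lt)+
  have int0: "0 \<in> interior S"
    using S by (simp add: interior_open) (simp add: S_def)
  have g: "g holomorphic_on S"
    unfolding g_def S_def by (intro holomorphic_intros) (auto elim!: nonpos_Ints_cases simp: complex_eq_iff)
  have g_eq: "g s / (s - 0) = refl_kernel r s" if "s \<noteq> 0" "s \<in> S" for s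
  proof -
    have "s \<notin> \<int>\<^sub>\<le>\<^sub>0" using that
      by (auto elim!: nonpos_Ints_cases simp: S_def complex_eq_iff)
    thus ?thesis using that
      by (simp add: g_def refl_kernel_def Gamma_plus1 add.commute[of 1 s])
  qed
  have "vline_integral c (refl_kernel r) - vline_integral (c - 1) (refl_kernel r) = 2 * pi * \<i>"
  proof (rule vline_integral_diff)
    fix T :: real assume T: "T \<ge> 1"
    let ?R = "rectpath (Complex (c - 1) (- T)) (Complex c T)"
    have z: "0 \<in> box (Complex (c - 1) (- T)) (Complex c T)"
      using assms T by (auto simp: in_box_complex_iff)
    have "path_image ?R = cbox (Complex (c - 1) (- T)) (Complex c T) - box (Complex (c - 1) (- T)) (Complex c T)"
      using assms T by (intro path_image_rectpath_cbox_minus_box) auto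
    moreover have "cbox (Complex (c - 1) (- T)) (Complex c T) \<subseteq> S"
      using assms by (auto simp: S_def in_cbox_complex_iff)
    ultimately have sub: "path_image ?R \<subseteq> S - {0}"
      using z by blast
    have "((\<lambda>w. g w / (w - 0)) has_contour_integral 2 * pi * \<i> * winding_number ?R 0 * g 0) ?R"
      using S g sub int0 by (intro Cauchy_integral_formula_convex_simple) auto
    also have "winding_number ?R 0 = 1"
      using z by (rule winding_number_rectpath)
    also have "g 0 = 1"
      by (simp add: g_def)
    finally have "((\<lambda>w. g w / (w - 0)) has_contour_integral 2 * pi * \<i>) ?R"
      by simp
    thus "(refl_kernel r has_contour_integral 2 * pi * \<i>) ?R"
      by (rule has_contour_integral_eq, intro g_eq) (use sub in auto)
  next
    fix x t :: real assume xt: "c - 1 \<le> x" "x \<le> c" "1 \<le> \<bar>t\<bar>"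
    \<comment> \<open>\<open>norm_sin_ge_horizontal\<close> asks for height at least 1, and its
      argument here is pi s.\<close>
    have "1 * 1 \<le> pi * \<bar>t\<bar>" 
      using xt pi_gt3 by (intro mult_mono) auto
    hence "norm (refl_kernel r (Complex x t)) \<le> pi * exp \<bar>ln r\<bar> / (1/4) * exp (- (pi * \<bar>Im (Complex x t)\<bar> / 2))"
      using xt norm_sin_ge_horizontal[of "pi * Complex x t"] assms
      by (intro refl_kernel_bound) (auto simp: abs_mult)
    thus "norm (refl_kernel r (Complex x t)) \<le> pi * exp \<bar>ln r\<bar> / (1/4) * exp (- (pi * \<bar>t\<bar> / 2))"
      by simp
  next
    show "((\<lambda>T. pi * exp \<bar>ln r\<bar> / (1/4) * exp (- (pi * T / 2))) \<longlongrightarrow> 0) at_top"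
      by real_asymp
  qed (use assms in \<open>auto intro!: vline_integrable_refl_kernel\<close>)
  moreover have "vline_integral (c - 1) (refl_kernel r) = - \<i> * r * vline_integral c (refl_kernel r)"
  proof -
    have "Complex (c - 1) t = Complex c t - 1" for t
      by (simp add: complex_eq_iff)
    thus ?thesis
      using assms by (simp add: vline_integral_def refl_kernel_minus_1)
  qed
  moreover have "1 + \<i> * r \<noteq> 0"
    by (auto simp: complex_eq_iff)
  ultimately show ?thesis
    by (simp add: field_simps)
qed

section \<open>Gamma integrals with complex parameter\<close>

lemma exp_eq_mult: "a = b + c \<Longrightarrow> exp a = exp b * exp c" for a b c :: complex
  by (simp add: exp_add)

text \<open>Differentiation under the integral sign for a locally dominated family. A majorant of
  the integrand itself suffices, because Cauchy's inequality bounds its derivative on a smaller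
  disc.\<close>

lemma holomorphic_on_integral:
  fixes f :: "complex \<Rightarrow> real \<Rightarrow> complex"
  assumes "open S"
    and meas: "\<And>z. z \<in> S \<Longrightarrow> f z \<in> borel_measurable lborel"
    and holo: "\<And>x. (\<lambda>z. f z x) holomorphic_on S"
    and dom: "\<And>z. z \<in> S \<Longrightarrow> \<exists>e>0. \<exists>g. cball z e \<subseteq> S \<and> integrable lborel g \<and>
                 (\<forall>w\<in>cball z e. \<forall>x. norm (f w x) \<le> g x)"
  shows "(\<lambda>z. LINT x|lborel. f z x) holomorphic_on S"
proof (rule holomorphic_onI)
  fix z assume z: "z \<in> S"
  obtain e g where e: "e > 0" "cball z e \<subseteq> S" and g: "integrable lborel g"
    and le': "\<forall>w\<in>cball z e. \<forall>x. norm (f w x) \<le> g x"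
    using dom[OF z] by (elim exE conjE) (rule that)
  have le: "norm (f w x) \<le> g x" if "w \<in> cball z e" for w x
    using le' that by auto
  define D where "D x = deriv (\<lambda>w. f w x) z" for x
  have der: "((\<lambda>w. f w x) has_field_derivative deriv (\<lambda>w. f w x) w) (at w)" if "w \<in> S" for w x
    using holomorphic_derivI[OF holo \<open>open S\<close> that] by simp
  \<comment> \<open>Discs of radius e / 2 around points of \<open>cball z (e/2)\<close> stay in
    \<open>cball z e\<close>, so the derivative is at most 2 g / e there, and the same function
    dominates the difference quotients at z.\<close>
  have quot: "norm (f w x - f z x) \<le> 2 * g x / e * norm (w - z)" if w: "w \<in> cball z (e/2)" for w x
  proof (rule field_differentiable_bound[of "cball z (e/2)"])
    fix u assume u: "u \<in> cball z (e/2)"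
    hence uS: "u \<in> S" using e by auto
    show "((\<lambda>w. f w x) has_field_derivative deriv (\<lambda>w. f w x) u) (at u within cball z (e/2))"
      using der[OF uS] by (rule has_field_derivative_at_within)
    have sub: "cball u (e/2) \<subseteq> cball z e"
    proof
      fix v assume "v \<in> cball u (e/2)"
      thus "v \<in> cball z e" using u dist_triangle[of z v u] by simp
    qed
    have h: "(\<lambda>w. f w x) holomorphic_on cball u (e/2)"
      using sub e by (intro holomorphic_on_subset[OF holo]) auto
    have "norm ((deriv ^^ 1) (\<lambda>w. f w x) u) \<le> fact 1 * g x / (e/2) ^ 1"
    proof (rule Cauchy_inequality)
      show "(\<lambda>w. f w x) holomorphic_on ball u (e/2)"
        using h by (rule holomorphic_on_subset) auto
      show "continuous_on (cball u (e/2)) (\<lambda>w. f w x)"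
        using h by (rule holomorphic_on_imp_continuous_on)
      fix v assume "norm (u - v) = e / 2"
      hence "v \<in> cball u (e/2)" by (simp add: dist_norm)
      thus "norm (f v x) \<le> g x" using sub le by blast
    qed (use e in auto)
    thus "norm (deriv (\<lambda>w. f w x) u) \<le> 2 * g x / e" by (simp add: field_simps)
  qed (use w e in auto)
  have "((\<lambda>w. ((LINT x|lborel. f w x) - (LINT x|lborel. f z x)) / (w - z)) \<longlongrightarrow> (LINT x|lborel. D x)) (at z)"
    unfolding tendsto_at_iff_sequentially o_def
  proof (intro allI impI)
    fix X :: "nat \<Rightarrow> complex" assume X: "\<forall>i. X i \<in> UNIV - {z}" "X \<longlonglongrightarrow> z"
    \<comment> \<open>Only a tail of the sequence is sure to lie in the disc where the domination
      holds; hence the index shift by \<open>N\<close>.\<close>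
    from X(2) e obtain N where "\<And>n. n \<ge> N \<Longrightarrow> dist (X n) z < e/2"
      by (metis half_gt_zero metric_LIMSEQ_D)
    hence N: "X (n + N) \<in> cball z (e/2)" for n
      by (metis dist_commute le_add2 less_imp_le mem_cball)
    hence N': "X (n + N) \<in> S" "X (n + N) \<in> cball z e" for n
    proof -
      have "dist z (X (n + N)) \<le> e" using N[of n] e by simp
      thus "X (n + N) \<in> cball z e" by simp
      thus "X (n + N) \<in> S" using e by blast
    qed
    have int: "integrable lborel (f w)" if "w \<in> cball z e" for w
    proof (rule Bochner_Integration.integrable_bound[OF g])
      show "f w \<in> borel_measurable lborel" using that e by (intro meas) auto
      show "AE x in lborel. norm (f w x) \<le> norm (g x)"
        using le[OF that] by (intro AE_I2) (metis abs_ge_self order_trans real_norm_def)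
    qed
    have "(\<lambda>n. LINT x|lborel. (f (X (n + N)) x - f z x) / (X (n + N) - z)) \<longlonglongrightarrow> (LINT x|lborel. D x)"
    proof (rule Bochner_Integration.integral_dominated_convergence[where w = "\<lambda>x. 2 * g x / e"])
      have lim: "(\<lambda>n. (f (X (n + N)) x - f z x) / (X (n + N) - z)) \<longlonglongrightarrow> D x" for x
      proof -
        have "((\<lambda>w. (f w x - f z x) / (w - z)) \<longlongrightarrow> D x) (at z)"
          using der[OF z, of x] by (simp add: D_def has_field_derivative_iff)
        hence "(\<lambda>n. (f (X n) x - f z x) / (X n - z)) \<longlonglongrightarrow> D x"
          using X unfolding tendsto_at_iff_sequentially o_def by blast
        thus ?thesis by (rule LIMSEQ_ignore_initial_segment)
      qed
      thus "AE x in lborel. (\<lambda>n. (f (X (n + N)) x - f z x) / (X (n + N) - z)) \<longlonglongrightarrow> D x" by simp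
      show m: "(\<lambda>x. (f (X (n + N)) x - f z x) / (X (n + N) - z)) \<in> borel_measurable lborel" for n
        using meas[OF z] meas[OF N'(1)[of n]] by measurable
      show "D \<in> borel_measurable lborel"
        by (rule borel_measurable_LIMSEQ_metric[OF m lim])
      show "integrable lborel (\<lambda>x. 2 * g x / e)" using g by simp
      show "AE x in lborel. norm ((f (X (n + N)) x - f z x) / (X (n + N) - z)) \<le> 2 * g x / e" for n
        using quot[OF N[of n]] X(1) by (intro AE_I2) (auto simp: norm_divide divide_le_eq)
    qed
    moreover have "(LINT x|lborel. (f (X (n + N)) x - f z x) / (X (n + N) - z))
        = ((LINT x|lborel. f (X (n + N)) x) - (LINT x|lborel. f z x)) / (X (n + N) - z)" for n
      using int[of z] int[OF N'(2)[of n]] e by simp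
    ultimately have "(\<lambda>n. ((LINT x|lborel. f (X (n + N)) x) - (LINT x|lborel. f z x)) / (X (n + N) - z)) \<longlonglongrightarrow> (LINT x|lborel. D x)"
      by (simp only:)
    thus "(\<lambda>n. ((LINT x|lborel. f (X n) x) - (LINT x|lborel. f z x)) / (X n - z)) \<longlonglongrightarrow> (LINT x|lborel. D x)"
      by (rule LIMSEQ_offset)
  qed
  hence "((\<lambda>z. LINT x|lborel. f z x) has_field_derivative (LINT x|lborel. D x)) (at z)"
    by (simp add: has_field_derivative_iff)
  hence "(\<lambda>z. LINT x|lborel. f z x) field_differentiable at z"
    unfolding field_differentiable_def by (rule exI)
  thus "(\<lambda>z. LINT x|lborel. f z x) field_differentiable at z within S"
    by (rule field_differentiable_at_within)
qed

text \<open>Euler's integrand x^(z-1) e^(-ax). The exponential form is entire in a and z and needs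
  no branch conditions; the indicator removes the meaningless values of \<open>ln\<close> at x <=
  0.\<close>

definition gamma_integrand :: "complex \<Rightarrow> complex \<Rightarrow> real \<Rightarrow> complex" where
  "gamma_integrand a z x = indicator {0<..} x *\<^sub>R exp ((z - 1) * of_real (ln x) - a * of_real x)"

lemma measurable_gamma_integrand [measurable]: "gamma_integrand a z \<in> borel_measurable borel"
  unfolding gamma_integrand_def by measurable

lemma norm_gamma_integrand:
  "norm (gamma_integrand a z x) = indicator {0<..} x * exp ((Re z - 1) * ln x - Re a * x)"
  by (simp add: gamma_integrand_def norm_exp_eq_Re)

lemma
  assumes "Re z > 0"
  shows integrable_gamma_integrand_1: "integrable lborel (gamma_integrand 1 z)"
    and integral_gamma_integrand_1: "(LINT x|lborel. gamma_integrand 1 z x) = Gamma z"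
proof -
  have eq: "indicator {0<..} x *\<^sub>R (complex_of_real x powr (z - 1) / of_real (exp x)) = gamma_integrand 1 z x" for x
    by (auto simp: gamma_integrand_def indicator_def powr_def exp_diff Ln_of_real exp_of_real)
  have "integrable lebesgue (gamma_integrand 1 z)"
    using absolutely_integrable_Gamma_integral'[OF assms] by (simp add: set_integrable_def eq)
  thus i: "integrable lborel (gamma_integrand 1 z)"
    by (subst (asm) integrable_completion) simp_all
  have "set_integrable lborel {0<..} (\<lambda>x. complex_of_real x powr (z - 1) / of_real (exp x))"
    using i by (simp add: set_integrable_def eq)
  from set_borel_integral_eq_integral(2)[OF this] 
  show "(LINT x|lborel. gamma_integrand 1 z x) = Gamma z"
    using Gamma_integral_complex'[OF assms] by (simp add: set_lebesgue_integral_def eq integral_unique)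
qed

lemma
  fixes b :: real
  assumes "Re z > 0" "b > 0"
  shows integrable_gamma_integrand_real: "integrable lborel (gamma_integrand b z)"
    and integral_gamma_integrand_real: "(LINT x|lborel. gamma_integrand b z x) = Gamma z * exp (- z * of_real (ln b))"
proof -
  have eq: "gamma_integrand b z x = exp (- (z - 1) * of_real (ln b)) * gamma_integrand 1 z (0 + b * x)" for x
  proof (cases "x > 0")
    case True
    have "exp ((z - 1) * of_real (ln x) - of_real b * of_real x)
        = exp (- (z - 1) * of_real (ln b)) * exp ((z - 1) * of_real (ln (b * x)) - 1 * of_real (b * x))"
      using True assms by (intro exp_eq_mult) (simp add: ln_mult algebra_simps)
    thus ?thesis
      using True assms by (simp add: gamma_integrand_def)
  qed (use assms in \<open>simp add: gamma_integrand_def zero_less_mult_iff\<close>)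
  have "integrable lborel (\<lambda>x. gamma_integrand 1 z (0 + b * x))"
    using assms by (intro lborel_integrable_real_affine integrable_gamma_integrand_1) auto
  thus "integrable lborel (gamma_integrand b z)"
    unfolding eq[abs_def] by simp
  have "(LINT x|lborel. gamma_integrand b z x) = exp (- (z - 1) * of_real (ln b)) * (LINT x|lborel. gamma_integrand 1 z (0 + b * x))"
    unfolding eq by simp
  also have "(LINT x|lborel. gamma_integrand 1 z (0 + b * x)) = Gamma z / b"
    using assms integral_gamma_integrand_1[OF assms(1)] lborel_integral_real_affine[of b "gamma_integrand 1 z" 0]
    by (simp add: scaleR_conv_of_real field_simps)
  also have "exp (- (z - 1) * of_real (ln b)) * (Gamma z / b) = Gamma z * exp (- z * of_real (ln b))"
  proof -
    have "exp (- (z - 1) * of_real (ln b)) = exp (- z * of_real (ln b)) * exp (of_real (ln b))"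
      by (rule exp_eq_mult) (simp add: algebra_simps)
    thus ?thesis using assms by (simp add: exp_of_real)
  qed
  finally show "(LINT x|lborel. gamma_integrand b z x) = Gamma z * exp (- z * of_real (ln b))" .
qed

lemma integrable_gamma_integrand:
  assumes "Re z > 0" "Re a > 0"
  shows "integrable lborel (gamma_integrand a z)"
proof (rule Bochner_Integration.integrable_bound)
  show "integrable lborel (gamma_integrand (of_real (Re a)) (of_real (Re z)))"
    using assms by (intro integrable_gamma_integrand_real) auto
qed (simp_all add: norm_gamma_integrand)

text \<open>The identity theorem takes the place of a rotated contour: both sides are holomorphic in
  a on Re a > 0 and agree on the positive reals, where scaling x proves the formula.\<close>

lemma integral_gamma_integrand:
  assumes z: "Re z > 0" and a: "Re a > 0"
  shows "(LINT x|lborel. gamma_integrand a z x) = Gamma z * exp (- z * Ln a)"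
proof -
  define S where "S = {w. Re w > 0}"
  have S: "open S" "connected S"
    unfolding S_def by (auto intro: open_halfspace_Re_gt convex_connected convex_halfspace_Re_gt)
  have "(\<lambda>a. LINT x|lborel. gamma_integrand a z x) holomorphic_on S"
  proof (rule holomorphic_on_integral[OF S(1)])
    show "(\<lambda>a. gamma_integrand a z x) holomorphic_on S" for x
      unfolding gamma_integrand_def scaleR_conv_of_real by (intro holomorphic_intros)
    fix b assume "b \<in> S"
    hence b: "Re b > 0" by (simp add: S_def)
    \<comment> \<open>On the disc of radius Re b / 2 the real part stays at least Re b / 2, and the
      integrand at this real parameter is the majorant.\<close>
    have Re: "Re b / 2 \<le> Re w" if "w \<in> cball b (Re b / 2)" for w
      using that abs_Re_le_cmod[of "b - w"] by (simp add: dist_norm) 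
    have "norm (gamma_integrand w z x) \<le> norm (gamma_integrand (of_real (Re b / 2)) z x)"
      if "w \<in> cball b (Re b / 2)" for w x
      using Re[OF that] by (auto simp: norm_gamma_integrand indicator_def)
    moreover have "integrable lborel (\<lambda>x. norm (gamma_integrand (of_real (Re b / 2)) z x))"
      using b z by (intro integrable_norm integrable_gamma_integrand) auto
    moreover have "cball b (Re b / 2) \<subseteq> S"
      using Re b by (fastforce simp: S_def)
    ultimately show "\<exists>e>0. \<exists>g. cball b e \<subseteq> S \<and> integrable lborel g \<and> (\<forall>w\<in>cball b e. \<forall>x. norm (gamma_integrand w z x) \<le> g x)"
      using b by (intro exI[of _ "Re b / 2"]) auto
  qed simp
  hence holo: "(\<lambda>a. (LINT x|lborel. gamma_integrand a z x) - Gamma z * exp (- z * Ln a)) holomorphic_on S"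
    by (intro holomorphic_intros) (auto simp: S_def complex_nonpos_Reals_iff)
  have "(LINT x|lborel. gamma_integrand a z x) - Gamma z * exp (- z * Ln a) = 0"
  proof (rule analytic_continuation[OF holo S, of "complex_of_real ` {0<..}" 1])
    show "1 islimpt complex_of_real ` {0<..}"
    proof -
      have "(\<lambda>n. complex_of_real (1 + inverse (real (Suc n)))) \<longlonglongrightarrow> of_real (1 + 0)"
        by (intro tendsto_intros LIMSEQ_inverse_real_of_nat)
      thus ?thesis
        unfolding islimpt_sequential by (intro exI[of _ "\<lambda>n. complex_of_real (1 + inverse (real (Suc n)))"]) (auto simp: add_pos_pos complex_eq_iff)
    qed
    fix w assume "w \<in> complex_of_real ` {0<..}"
    thus "(LINT x|lborel. gamma_integrand w z x) - Gamma z * exp (- z * Ln w) = 0"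
      using integral_gamma_integrand_real[OF z] by (auto simp: Ln_of_real)
  qed (use a in \<open>auto simp: S_def\<close>)
  thus ?thesis by simp
qed

text \<open>Product majorants settle integrability for the Fubini exchanges between a vertical line
  and a real integral.\<close>

lemma integrable_pair_bound:
  fixes f :: "real \<Rightarrow> real \<Rightarrow> complex"
  assumes [measurable]: "case_prod f \<in> borel_measurable (lborel \<Otimes>\<^sub>M lborel)"
    and g: "integrable lborel g" and h: "integrable lborel h"
    and le: "\<And>x y. norm (f x y) \<le> g x * h y"
  shows "integrable (lborel \<Otimes>\<^sub>M lborel) (case_prod f)"
proof (rule Bochner_Integration.integrable_bound)
  show "integrable (lborel \<Otimes>\<^sub>M lborel) (\<lambda>(x, y). g x * h y)"
  proof (rule lborel_pair.Fubini_integrable)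
    show "integrable lborel (\<lambda>x. LINT y|lborel. norm (case (x, y) of (x, y) \<Rightarrow> g x * h y))"
      using g h by (simp add: abs_mult)
    show "AE x in lborel. integrable lborel (\<lambda>y. case (x, y) of (x, y) \<Rightarrow> g x * h y)"
      using h by simp
    have [measurable]: "g \<in> borel_measurable borel" "h \<in> borel_measurable borel"
      using g h borel_measurable_integrable by fastforce+
    show "(\<lambda>(x, y). g x * h y) \<in> borel_measurable (lborel \<Otimes>\<^sub>M lborel)" by measurable
  qed
  show "AE z in lborel \<Otimes>\<^sub>M lborel. norm (case_prod f z) \<le> norm (case z of (x, y) \<Rightarrow> g x * h y)"
    using le by (intro AE_I2) (auto intro: order_trans[OF _ abs_ge_self])
qed fact

lemma exp_times_ln_ratio:

  \<comment> \<open>The left-hand line integral\<close>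
  "exp (- s * (of_real (ln r) + z)) * exp (s * of_real (ln x)) = exp (- s * (of_real (ln (r / x)) + z))"
  if "r > 0" "x > 0" for s z :: complex
  using that by (intro exp_eq_mult[symmetric]) (simp add: ln_div algebra_simps)

text \<open>Absorbs a power x^s into the parameter of the kernel; used for the Euler variable x and,
  with x = 1 / n, for the Dirichlet terms.\<close>

lemma refl_kernel_scale:
  "r > 0 \<Longrightarrow> x > 0 \<Longrightarrow> refl_kernel r s * exp (s * of_real (ln x)) = refl_kernel (r / x) s"
  unfolding refl_kernel_def using exp_times_ln_ratio[of r x s "\<i> * pi / 2"] by simp

text \<open>Inserting Euler's integral for Gamma (s + d) and exchanging leaves x^s inside the line
  integral; absorbed into the kernel, it yields 1 / (1 + i r / x).\<close>

lemma vline_integral_refl_kernel_Gamma: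
  assumes c: "0 < c" "c < 1" and r: "r > 0" and d: "d > 0"
  shows "vline_integral c (\<lambda>s. refl_kernel r s * Gamma (s + of_real d))
       = 2 * pi * \<i> * (LINT x|lborel. gamma_integrand 1 (of_real (1 + d)) x / (of_real x + \<i> * r))"
proof -
  from c have c': "0 < \<bar>c\<bar>" "\<bar>c\<bar> < 1" by auto
  define f where "f t x = refl_kernel r (Complex c t) * gamma_integrand 1 (Complex c t + of_real d) x" for t x
  obtain C where C: "\<And>t. norm (refl_kernel r (Complex c t)) \<le> C / (1 + t\<^sup>2)"
    using refl_kernel_bound_vertical[OF c'] by blast
  have [measurable]: "(\<lambda>t. refl_kernel r (Complex c t)) \<in> borel_measurable borel"
    by (intro borel_measurable_continuous_onI continuous_refl_kernel_line c')
  have [measurable]: "Complex c \<in> borel_measurable borel"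
    by (intro borel_measurable_continuous_onI continuous_on_Complex_line)
  have int: "integrable (lborel \<Otimes>\<^sub>M lborel) (case_prod f)"
  proof (rule integrable_pair_bound)
    show "integrable lborel (\<lambda>t. C / (1 + t\<^sup>2))"
      by (rule integrable_const_over_1_plus_square)
    show "integrable lborel (\<lambda>x. norm (gamma_integrand 1 (of_real (c + d)) x))"
      using c d by (intro integrable_norm integrable_gamma_integrand_1) auto
    show "case_prod f \<in> borel_measurable (lborel \<Otimes>\<^sub>M lborel)"
      unfolding f_def gamma_integrand_def by measurable
    \<comment> \<open>On Re s = c the modulus of the Gamma integrand depends only on c + d and x, so
      the majorant splits into a factor in t and a factor in x.\<close>
    show "norm (f t x) \<le> C / (1 + t\<^sup>2) * norm (gamma_integrand 1 (of_real (c + d)) x)" for t x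
      unfolding f_def norm_mult using C by (intro mult_mono) (auto simp: norm_gamma_integrand intro: order_trans[OF norm_ge_zero])
  qed
  have "(LINT t|lborel. refl_kernel r (Complex c t) * Gamma (Complex c t + of_real d))
      = (LINT t|lborel. LINT x|lborel. f t x)"
    using c d by (simp add: f_def integral_gamma_integrand_1)
  also have "\<dots> = (LINT x|lborel. LINT t|lborel. f t x)"
    by (rule lborel_pair.Fubini_integral[OF int, symmetric])
  also have "\<dots> = (LINT x|lborel. 2 * pi * (gamma_integrand 1 (of_real (1 + d)) x / (of_real x + \<i> * r)))"
  proof (intro Bochner_Integration.integral_cong refl)
    fix x :: real
    show "(LINT t|lborel. f t x) = 2 * pi * (gamma_integrand 1 (of_real (1 + d)) x / (of_real x + \<i> * r))"
    proof (cases "x > 0")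
      case x: True
      have "f t x = refl_kernel (r / x) (Complex c t) * exp (of_real (d - 1) * of_real (ln x) - of_real x)" for t
      proof -
        have "gamma_integrand 1 (Complex c t + of_real d) x
                = exp (Complex c t * of_real (ln x)) * exp (of_real (d - 1) * of_real (ln x) - of_real x)"
          using x by (simp add: gamma_integrand_def) (rule exp_eq_mult, simp add: algebra_simps)
        thus ?thesis
          using refl_kernel_scale[OF r x, of "Complex c t"] by (simp add: f_def)
      qed
      hence "(LINT t|lborel. f t x) = (LINT t|lborel. refl_kernel (r / x) (Complex c t)) * exp (of_real (d - 1) * of_real (ln x) - of_real x)"
        by simp
      also have "(LINT t|lborel. refl_kernel (r / x) (Complex c t)) = 2 * pi / (1 + \<i> * of_real (r / x))"
      proof -
        have "\<i> * (LINT t|lborel. refl_kernel (r / x) (Complex c t)) = \<i> * (2 * pi / (1 + \<i> * of_real (r / x)))"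
          using vline_integral_refl_kernel[of c "r / x"] c r x by (simp add: vline_integral_def)
        thus ?thesis unfolding mult_cancel_left by simp
      qed
      \<comment> \<open>The numerator x raises the power from d - 1 to d, which is why the index
        becomes 1 + d.\<close>
      also have "\<dots> = 2 * pi * of_real x / (of_real x + \<i> * r)"
        using x by (simp add: field_simps)
      also have "\<dots> * exp (of_real (d - 1) * of_real (ln x) - of_real x)
          = 2 * pi * ((exp (of_real (ln x)) * exp (of_real (d - 1) * of_real (ln x) - of_real x)) / (of_real x + \<i> * r))"
        using x by (simp add: exp_of_real)
      also have "exp (of_real (ln x)) * exp (of_real (d - 1) * of_real (ln x) - of_real x) = gamma_integrand 1 (of_real (1 + d)) x"
        using x by (simp add: gamma_integrand_def) (rule exp_eq_mult[symmetric], simp add: algebra_simps)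
      finally show ?thesis .
    qed (simp add: f_def gamma_integrand_def)
  qed
  also have "\<dots> = 2 * pi * (LINT x|lborel. gamma_integrand 1 (of_real (1 + d)) x / (of_real x + \<i> * r))"
    by (rule integral_mult_right_zero)
  finally show ?thesis
    by (simp add: vline_integral_def mult_ac)
qed

lemma integrable_powr_1_plus:
  fixes d :: real
  assumes "d > 0"
  shows "integrable lborel (\<lambda>v. indicator {0<..} v * exp (- (1 + d) * ln (1 + v)))"
proof -
  have "set_integrable lborel (einterval 0 \<infinity>) (\<lambda>v. exp (- (1 + d) * ln (1 + v)))"
  proof (rule interval_integral_FTC_nonneg(1)[where F = "\<lambda>v. - exp (- d * ln (1 + v)) / d" and A = "- 1 / d" and B = 0])
    fix v :: real assume "0 < ereal v"
    hence v: "v > 0" by simp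
    show "DERIV (\<lambda>v. - exp (- d * ln (1 + v)) / d) v :> exp (- (1 + d) * ln (1 + v))"
    proof -
      have "exp (- (1 + d) * ln (1 + v)) = exp (- d * ln (1 + v)) * exp (- ln (1 + v))"
        by (subst exp_add [symmetric]) (simp add: algebra_simps)
      also have "exp (- ln (1 + v)) = 1 / (1 + v)"
        using v by (simp add: exp_minus inverse_eq_divide)
      finally have "exp (- (1 + d) * ln (1 + v)) = exp (- d * ln (1 + v)) * (1 / (1 + v))" .
      thus ?thesis
        using assms v by (auto intro!: derivative_eq_intros)
    qed
    show "isCont (\<lambda>v. exp (- (1 + d) * ln (1 + v))) v"
      using v by (intro continuous_intros) auto
  next
    have "((\<lambda>v. - exp (- d * ln (1 + v)) / d) \<longlongrightarrow> - exp (- d * ln (1 + 0)) / d) (at_right 0)"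
      using assms by (intro tendsto_intros) auto
    thus "(((\<lambda>v. - exp (- d * ln (1 + v)) / d) \<circ> real_of_ereal) \<longlongrightarrow> - 1 / d) (at_right 0)"
      unfolding zero_ereal_def by (simp add: ereal_tendsto_simps)
  next
    have "((\<lambda>v. - exp (- d * ln (1 + v)) / d) \<longlongrightarrow> 0) at_top"
      using assms by real_asymp
    thus "(((\<lambda>v. - exp (- d * ln (1 + v)) / d) \<circ> real_of_ereal) \<longlongrightarrow> 0) (at_left \<infinity>)"
      by (simp add: ereal_tendsto_simps)
  qed auto
  moreover have "einterval 0 \<infinity> = {0<..}"
    by (auto simp: einterval_def)
  ultimately show ?thesis
    by (simp add: set_integrable_def)
qed

text \<open>With 1 / (x + i r) written as the integral of e^(-(x + i r) v) over v > 0, the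
  x-integral is Euler's with parameter 1 + v and contributes Gamma (1 + d) (1 + v)^(-1-d).\<close>

lemma integral_gamma_over_linear:
  fixes d r :: real
  assumes "d > 0" "r > 0"
  shows "(LINT x|lborel. gamma_integrand 1 (of_real (1 + d)) x / (of_real x + \<i> * r))
       = Gamma (of_real (1 + d)) * (LINT v|lborel. indicator {0<..} v *\<^sub>R
            exp (- (1 + of_real d) * of_real (ln (1 + v)) - \<i> * r * v))"
proof -
  define g where "g x v = indicator {0<..} v *\<^sub>R (exp (- \<i> * r * v) * gamma_integrand (1 + of_real v) (of_real (1 + d)) x)"
    for x v :: real
  have Re: "Re (1 + complex_of_real v) > 0" if "v > 0" for v using that by simp
  have lnv: "exp (- complex_of_real (1 + d) * Ln (1 + of_real v)) = exp (- (1 + of_real d) * of_real (ln (1 + v)))" if "v > 0" for v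
    using that Ln_of_real[of "1 + v"] by simp
  have nrm: "norm (g x v) = indicator {0<..} v * Re (gamma_integrand (of_real (1 + v)) (of_real (1 + d)) x)" for x v
    by (auto simp: g_def norm_gamma_integrand norm_mult indicator_def gamma_integrand_def Re_exp)
  \<comment> \<open>Integrating the norm over x first gives an exact value, a multiple of (1 +
    v)^(-1-d), which is integrable at infinity because d > 0.\<close>
  have int: "integrable (lborel \<Otimes>\<^sub>M lborel) (\<lambda>(v, x). g x v)"
  proof (rule lborel_pair.Fubini_integrable)
    show "(\<lambda>(v, x). g x v) \<in> borel_measurable (lborel \<Otimes>\<^sub>M lborel)"
      unfolding g_def gamma_integrand_def by measurable
    have "(LINT x|lborel. norm (case (v, x) of (v, x) \<Rightarrow> g x v))
        = Gamma (1 + d) * (indicator {0<..} v * exp (- (1 + d) * ln (1 + v)))" for v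
    proof (cases "v > 0")
      case True
      have "(LINT x|lborel. norm (case (v, x) of (v, x) \<Rightarrow> g x v))
          = (LINT x|lborel. Re (gamma_integrand (of_real (1 + v)) (of_real (1 + d)) x))"
        using True by (simp add: nrm)
      also have "\<dots> = Re (LINT x|lborel. gamma_integrand (of_real (1 + v)) (of_real (1 + d)) x)"
        using True assms by (intro integral_Re integrable_gamma_integrand) auto
      also have "\<dots> = Re (of_real (Gamma (1 + d) * exp (- (1 + d) * ln (1 + v))))"
        using True assms
        by (subst integral_gamma_integrand_real)
           (auto simp only: Re_complex_of_real Gamma_complex_of_real of_real_mult of_real_minus exp_of_real [symmetric])
      finally show ?thesis using True by simp
    qed (simp add: nrm)
    thus "integrable lborel (\<lambda>v. LINT x|lborel. norm (case (v, x) of (v, x) \<Rightarrow> g x v))"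
      using integrable_powr_1_plus[OF assms(1)] by simp
    show "AE v in lborel. integrable lborel (\<lambda>x. case (v, x) of (v, x) \<Rightarrow> g x v)"
      using assms by (intro AE_I2) (auto simp: g_def indicator_def intro!: integrable_gamma_integrand)
  qed
  have "(LINT x|lborel. LINT v|lborel. g x v) = (LINT v|lborel. LINT x|lborel. g x v)"
    using lborel_pair.Fubini_integral[OF int] by simp
  also have "(LINT v|lborel. LINT x|lborel. g x v) = (LINT v|lborel. Gamma (of_real (1 + d)) * (indicator {0<..} v *\<^sub>R
            exp (- (1 + of_real d) * of_real (ln (1 + v)) - \<i> * r * v)))"
  proof (intro Bochner_Integration.integral_cong refl)
    fix v :: real
    show "(LINT x|lborel. g x v) = Gamma (of_real (1 + d)) * (indicator {0<..} v *\<^sub>R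
            exp (- (1 + of_real d) * of_real (ln (1 + v)) - \<i> * r * v))"
    proof (cases "v > 0")
      case True
      have "(LINT x|lborel. g x v) = exp (- \<i> * r * v) * (LINT x|lborel. gamma_integrand (1 + of_real v) (of_real (1 + d)) x)"
        using True by (simp add: g_def)
      also have "(LINT x|lborel. gamma_integrand (1 + of_real v) (of_real (1 + d)) x)
                   = Gamma (of_real (1 + d)) * exp (- (1 + of_real d) * of_real (ln (1 + v)))"
        using True assms lnv[OF True] by (subst integral_gamma_integrand) auto
      also have "exp (- \<i> * r * v) * \<dots> = Gamma (of_real (1 + d)) * exp (- (1 + of_real d) * of_real (ln (1 + v)) - \<i> * r * v)"
        by (simp add: exp_diff exp_minus divide_inverse mult_ac)
      finally show ?thesis using True by simp
    qed (simp add: g_def)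
  qed
  also have "(LINT x|lborel. LINT v|lborel. g x v) = (LINT x|lborel. gamma_integrand 1 (of_real (1 + d)) x / (of_real x + \<i> * r))"
  proof (intro Bochner_Integration.integral_cong refl)
    fix x :: real
    show "(LINT v|lborel. g x v) = gamma_integrand 1 (of_real (1 + d)) x / (of_real x + \<i> * r)"
    proof (cases "x > 0")
      case True
      \<comment> \<open>As a function of v this is a multiple of e^(-(x + i r) v), that is, of
        Euler's integrand with exponent z = 1.\<close>
      have "g x v = gamma_integrand 1 (of_real (1 + d)) x * gamma_integrand (of_real x + \<i> * r) 1 v" for v
      proof (cases "v > 0")
        case v: True
        have "exp (- \<i> * r * v) * exp ((of_real (1 + d) - 1) * of_real (ln x) - (1 + of_real v) * of_real x)
            = exp ((of_real (1 + d) - 1) * of_real (ln x) - 1 * of_real x) * exp ((1 - 1) * of_real (ln v) - (of_real x + \<i> * r) * of_real v)"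
          unfolding exp_add [symmetric] by (rule arg_cong[of _ _ exp]) (simp add: algebra_simps)
        thus ?thesis
          using True v by (simp add: g_def gamma_integrand_def)
      qed (simp add: g_def gamma_integrand_def)
      hence "(LINT v|lborel. g x v) = gamma_integrand 1 (of_real (1 + d)) x * (LINT v|lborel. gamma_integrand (of_real x + \<i> * r) 1 v)"
        by simp
      also have "(LINT v|lborel. gamma_integrand (of_real x + \<i> * r) 1 v) = exp (- Ln (of_real x + \<i> * r))"
        using True by (subst integral_gamma_integrand) auto
      also have "\<dots> = 1 / (of_real x + \<i> * r)"
        using True by (subst exp_minus, subst exp_Ln) (auto simp: complex_eq_iff inverse_eq_divide)
      finally show ?thesis by simp
    qed (simp add: g_def gamma_integrand_def)
  qed
  finally show ?thesis
    unfolding integral_mult_right_zero .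
qed

section \<open>The bracket as an integral\<close>

lemma integral_FTC_greaterThan:
  fixes f F :: "real \<Rightarrow> complex"
  assumes "\<And>x. x > a \<Longrightarrow> (F has_vector_derivative f x) (at x)" "\<And>x. x > a \<Longrightarrow> isCont f x"
    and "integrable lborel (\<lambda>x. indicator {a<..} x *\<^sub>R f x)"
    and "(F \<longlongrightarrow> A) (at_right a)" "(F \<longlongrightarrow> B) at_top"
  shows "(LINT x|lborel. indicator {a<..} x *\<^sub>R f x) = B - A"
proof -
  have "einterval (ereal a) \<infinity> = {a<..}" by (auto simp: einterval_def)
  moreover have "(LBINT x=ereal a..\<infinity>. f x) = B - A"
    using assms calculation by (intro interval_integral_FTC_integrable[where F = F])
       (auto simp: set_integrable_def ereal_tendsto_simps)
  ultimately show ?thesis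
    by (simp add: interval_lebesgue_integral_def set_lebesgue_integral_def)
qed

lemma integral_FTC_greaterThanLessThan:
  fixes f F :: "real \<Rightarrow> complex"
  assumes "a < b" "\<And>x. a < x \<Longrightarrow> x < b \<Longrightarrow> (F has_vector_derivative f x) (at x)"
    and "\<And>x. a < x \<Longrightarrow> x < b \<Longrightarrow> isCont f x"
    and "integrable lborel (\<lambda>x. indicator {a<..<b} x *\<^sub>R f x)"
    and "(F \<longlongrightarrow> A) (at_right a)" "(F \<longlongrightarrow> B) (at_left b)"
  shows "(LINT x|lborel. indicator {a<..<b} x *\<^sub>R f x) = B - A"
proof -
  have "einterval (ereal a) (ereal b) = {a<..<b}" by (auto simp: einterval_def)
  moreover have "(LBINT x=ereal a..ereal b. f x) = B - A"
    using assms calculation by (intro interval_integral_FTC_integrable[where F = F])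
       (auto simp: set_integrable_def ereal_tendsto_simps)
  ultimately show ?thesis
    using \<open>a < b\<close> by (simp add: interval_lebesgue_integral_def set_lebesgue_integral_def)
qed

text \<open>The function y^z e^(-ay) without an indicator, so that it can be differentiated and
  restricted to each of (0, 1), (1, n) and y > 1.\<close>

definition expow :: "complex \<Rightarrow> complex \<Rightarrow> real \<Rightarrow> complex" where
  "expow a z y = exp (z * of_real (ln y) - a * of_real y)"

lemma measurable_expow [measurable]: "expow a z \<in> borel_measurable borel"
  unfolding expow_def by measurable

lemma norm_expow: "norm (expow a z y) = exp (Re z * ln y - Re a * y)"
  by (simp add: expow_def norm_exp_eq_Re)

lemma gamma_integrand_expow: "gamma_integrand a z x = indicator {0<..} x *\<^sub>R expow a (z - 1) x"
  by (simp add: gamma_integrand_def expow_def)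

lemma expow_diff_1: "y > 0 \<Longrightarrow> expow a (z - 1) y = expow a z y / of_real y"
  by (simp add: expow_def left_diff_distrib exp_diff exp_of_real)

lemma has_vector_derivative_expow:
  assumes "y > 0"
  shows "(expow a z has_vector_derivative z * expow a (z - 1) y - a * expow a z y) (at y)"
proof -
  have "((\<lambda>y. z * of_real (ln y) - a * of_real y) has_vector_derivative (z * of_real (1 / y) - a * of_real 1)) (at y)"
    using assms by (intro has_vector_derivative_diff has_vector_derivative_mult_right has_vector_derivative_of_real)
       (auto intro!: derivative_eq_intros simp: has_real_derivative_iff_has_vector_derivative [symmetric])
  from field_vector_diff_chain_at[OF this DERIV_exp]
  have "((exp \<circ> (\<lambda>y. z * of_real (ln y) - a * of_real y)) has_vector_derivative
          (z * of_real (1 / y) - a * of_real 1) * expow a z y) (at y)"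
    by (simp add: expow_def)
  moreover have "exp \<circ> (\<lambda>y. z * of_real (ln y) - a * of_real y) = expow a z"
    by (simp add: fun_eq_iff expow_def)
  ultimately show ?thesis
    using assms by (simp add: expow_diff_1 algebra_simps)
qed

lemma isCont_expow: "y > 0 \<Longrightarrow> isCont (expow a z) y"
  using has_vector_derivative_continuous[OF has_vector_derivative_expow] by blast

lemma integrable_powr_greaterThan_1:
  fixes s :: real
  assumes "s > 1"
  shows "integrable lborel (\<lambda>y. indicator {1<..} y * exp (- s * ln y))"
proof -
  have "integrable lborel (\<lambda>y. indicator {0<..} (-1 + 1 * y) * exp (- (1 + (s - 1)) * ln (1 + (-1 + 1 * y))) :: real)"
    using assms by (intro lborel_integrable_real_affine[OF integrable_powr_1_plus]) auto
  moreover have "indicator {0<..} (-1 + 1 * y) = (indicator {1<..} y :: real)" for y :: real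
    by (auto simp: indicator_def)
  ultimately show ?thesis by simp
qed

text \<open>Inside Re a > 0 exponential decay beats every power; on the boundary Re a = 0 the power
  alone must be integrable at infinity.\<close>

lemma integrable_expow:
  assumes "Re a > 0 \<or> Re a \<ge> 0 \<and> Re z < -1"
  shows "integrable lborel (\<lambda>y. indicator {1<..} y *\<^sub>R expow a z y)"
  using assms
proof
  assume a: "Re a > 0"
  \<comment> \<open>m > 0 keeps Euler's integrand integrable, and m - 1 >= Re z makes it a majorant
    for y > 1.\<close>
  define m where "m = max 1 (1 + Re z)"
  show ?thesis
  proof (rule Bochner_Integration.integrable_bound)
    show "integrable lborel (gamma_integrand a (of_real m))"
      using a by (intro integrable_gamma_integrand) (auto simp: m_def)
    show "AE y in lborel. norm (indicator {1<..} y *\<^sub>R expow a z y) \<le> norm (gamma_integrand a (of_real m) y)"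
      by (intro AE_I2) (auto simp: norm_gamma_integrand norm_expow indicator_def m_def intro!: mult_right_mono)
  qed simp
next
  assume a: "Re a \<ge> 0 \<and> Re z < -1"
  show ?thesis
  proof (rule Bochner_Integration.integrable_bound)
    show "integrable lborel (\<lambda>y. indicator {1<..} y * exp (- (- Re z) * ln y))"
      using a by (intro integrable_powr_greaterThan_1) auto
    show "AE y in lborel. norm (indicator {1<..} y *\<^sub>R expow a z y) \<le> norm (indicator {1<..} y * exp (- (- Re z) * ln y))"
      using a by (intro AE_I2) (auto simp: norm_expow indicator_def)
  qed simp
qed

text \<open>The generalised exponential integral E_xi(a), taken for complex a so that the imaginary
  axis is a boundary case.\<close>

definition expint :: "complex \<Rightarrow> complex \<Rightarrow> complex" where
  "expint a \<xi> = (LINT y|lborel. indicator {1<..} y *\<^sub>R expow a (- \<xi>) y)"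

text \<open>Integrates the derivative of y^(1-xi) e^(-ay). For Re a = 0 the bound Re xi > 2 is what
  makes the integral at xi - 1 converge absolutely.\<close>

lemma expint_rec:
  assumes "Re a > 0 \<or> Re a \<ge> 0 \<and> Re \<xi> > 2"
  shows "(1 - \<xi>) * expint a \<xi> = a * expint a (\<xi> - 1) - exp (- a)"
proof -
  have int: "integrable lborel (\<lambda>y. indicator {1<..} y *\<^sub>R expow a (- \<xi>) y)"
       "integrable lborel (\<lambda>y. indicator {1<..} y *\<^sub>R expow a (1 - \<xi>) y)"
    using assms by (auto intro!: integrable_expow)
  have eq: "indicator {1<..} y *\<^sub>R ((1 - \<xi>) * expow a (1 - \<xi> - 1) y - a * expow a (1 - \<xi>) y)
        = (1 - \<xi>) * (indicator {1<..} y *\<^sub>R expow a (- \<xi>) y) - a * (indicator {1<..} y *\<^sub>R expow a (1 - \<xi>) y)" for y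
    by (simp add: indicator_def)
  have "(LINT y|lborel. indicator {1<..} y *\<^sub>R ((1 - \<xi>) * expow a (1 - \<xi> - 1) y - a * expow a (1 - \<xi>) y)) = 0 - exp (- a)"
  proof (rule integral_FTC_greaterThan)
    show "(expow a (1 - \<xi>) has_vector_derivative (1 - \<xi>) * expow a (1 - \<xi> - 1) y - a * expow a (1 - \<xi>) y) (at y)"
      if "y > 1" for y
      using that by (intro has_vector_derivative_expow) auto
    show "isCont (\<lambda>y. (1 - \<xi>) * expow a (1 - \<xi> - 1) y - a * expow a (1 - \<xi>) y) y" if "y > 1" for y
      using that by (intro continuous_intros isCont_expow) auto
    show "integrable lborel (\<lambda>y. indicator {1<..} y *\<^sub>R ((1 - \<xi>) * expow a (1 - \<xi> - 1) y - a * expow a (1 - \<xi>) y))"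
      unfolding eq using int by (intro Bochner_Integration.integrable_diff integrable_mult_right)
    have "isCont (expow a (1 - \<xi>)) 1" by (rule isCont_expow) simp
    hence "(expow a (1 - \<xi>) \<longlongrightarrow> expow a (1 - \<xi>) 1) (at 1)" by (simp add: isCont_def)
    thus "(expow a (1 - \<xi>) \<longlongrightarrow> exp (- a)) (at_right 1)"
      by (simp add: expow_def filterlim_at_split)
    have "((\<lambda>y. norm (expow a (1 - \<xi>) y)) \<longlongrightarrow> 0) at_top"
    proof (cases "Re a > 0")
      case True
      thus ?thesis unfolding norm_expow by real_asymp
    next
      case False
      hence a: "Re a = 0" "Re (1 - \<xi>) < 0" using assms by auto
      define s where "s = Re (1 - \<xi>)"
      have "((\<lambda>y. exp (s * ln y - 0 * y)) \<longlongrightarrow> 0) at_top"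
        using a(2) unfolding s_def [symmetric] by real_asymp
      thus ?thesis unfolding norm_expow s_def a(1) .
    qed
    thus "(expow a (1 - \<xi>) \<longlongrightarrow> 0) at_top"
      by (rule tendsto_norm_zero_cancel)
  qed
  also have "(LINT y|lborel. indicator {1<..} y *\<^sub>R ((1 - \<xi>) * expow a (1 - \<xi> - 1) y - a * expow a (1 - \<xi>) y))
               = (1 - \<xi>) * expint a \<xi> - a * expint a (\<xi> - 1)"
    unfolding eq expint_def using int
    by (subst Bochner_Integration.integral_diff) (simp_all only: integral_mult_right_zero integrable_mult_right minus_diff_eq)
  finally show ?thesis by (simp add: algebra_simps)
qed

section \<open>The integral over (0, 1) and its series\<close>

lemma
  assumes s: "Re s > 0"
  shows integrable_power_01: "integrable lborel (\<lambda>r. indicator {0<..<1} r *\<^sub>R expow 0 (s - 1) r)"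
    and integral_power_01: "(LINT r|lborel. indicator {0<..<1} r *\<^sub>R expow 0 (s - 1) r) = 1 / s"
proof -
  have s0: "s \<noteq> 0" using s by auto
  show i: "integrable lborel (\<lambda>r. indicator {0<..<1} r *\<^sub>R expow 0 (s - 1) r)"
  proof (rule Bochner_Integration.integrable_bound)
    show "integrable lborel (\<lambda>x. exp 1 * norm (gamma_integrand 1 s x))"
      using s by (intro integrable_mult_right integrable_norm integrable_gamma_integrand_1)
    show "AE r in lborel. norm (indicator {0<..<1} r *\<^sub>R expow 0 (s - 1) r) \<le> norm (exp 1 * norm (gamma_integrand 1 s r))"
      by (intro AE_I2) (auto simp: norm_gamma_integrand norm_expow indicator_def abs_mult exp_add [symmetric])
  qed simp
  have lim: "(expow 0 s \<longlongrightarrow> 0) (at_right 0)"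
  proof (rule tendsto_norm_zero_cancel)
    show "((\<lambda>r. norm (expow 0 s r)) \<longlongrightarrow> 0) (at_right 0)"
      unfolding norm_expow using s by simp real_asymp
  qed
  have "isCont (expow 0 s) 1" by (rule isCont_expow) simp
  hence "(expow 0 s \<longlongrightarrow> expow 0 s 1) (at 1)" by (simp add: isCont_def)
  hence lim': "(expow 0 s \<longlongrightarrow> 1) (at_left 1)"
    by (simp add: expow_def filterlim_at_split)
  have "(LINT r|lborel. indicator {0<..<1} r *\<^sub>R (s * expow 0 (s - 1) r)) = 1 - 0"
  proof (rule integral_FTC_greaterThanLessThan[OF _ _ _ _ lim lim'])
    show "(expow 0 s has_vector_derivative s * expow 0 (s - 1) r) (at r)" if "0 < r" for r
      using has_vector_derivative_expow[of r 0 s] that by simp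
    show "isCont (\<lambda>r. s * expow 0 (s - 1) r) r" if "0 < r" for r
      using that by (intro continuous_intros isCont_expow)
    show "integrable lborel (\<lambda>r. indicator {0<..<1} r *\<^sub>R (s * expow 0 (s - 1) r))"
      using integrable_mult_right[OF i, of s] by simp
  qed simp
  thus "(LINT r|lborel. indicator {0<..<1} r *\<^sub>R expow 0 (s - 1) r) = 1 / s"
    using s0 unfolding mult_scaleR_right [symmetric] integral_mult_right_zero by (simp add: field_simps)
qed

text \<open>Expanding e^(-ar) and integrating r^(k - xi) over (0, 1) gives 1 / (k + 1 - xi)
  termwise; the minus sign is the one in \<open>K\<close>. At a positive integer xi the singular
  term takes the default value 0, so the series converges for every xi.\<close>

definition K_series :: "complex \<Rightarrow> complex \<Rightarrow> complex" where
  "K_series a \<xi> = - (\<Sum>k. (- a) ^ k / (fact k * (of_nat (Suc k) - \<xi>)))"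

lemma norm_of_nat_diff_ge:
  assumes "real k \<ge> Re \<xi>"
  shows "norm (of_nat (Suc k) - \<xi>) \<ge> 1"
  using complex_Re_le_cmod[of "of_nat (Suc k) - \<xi>"] assms by simp

lemma norm_K_series_term_le:
  assumes "real k \<ge> Re \<xi>"
  shows "norm ((- a) ^ k / (fact k * (of_nat (Suc k) - \<xi>))) \<le> norm a ^ k / fact k"
proof -
  have "norm ((- a) ^ k / (fact k * (of_nat (Suc k) - \<xi>))) = norm a ^ k / (fact k * norm (of_nat (Suc k) - \<xi>))"
    by (simp add: norm_divide norm_mult norm_power)
  also have "\<dots> \<le> norm a ^ k / (fact k * 1)"
    using norm_of_nat_diff_ge[OF assms] by (intro divide_left_mono mult_left_mono mult_pos_pos) auto
  finally show ?thesis by simp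
qed

lemma summable_norm_exp_series: "summable (\<lambda>k. norm a ^ k / fact k)" for a :: complex
  using summable_exp_generic[of "norm a"] by (simp add: scaleR_conv_of_real field_simps)

lemma summable_K_series: "summable (\<lambda>k. (- a) ^ k / (fact k * (of_nat (Suc k) - \<xi>)))" for a \<xi> :: complex
proof (rule summable_comparison_test_ev[OF _ summable_norm_exp_series])
  show "\<forall>\<^sub>F k in sequentially. norm ((- a) ^ k / (fact k * (of_nat (Suc k) - \<xi>))) \<le> norm a ^ k / fact k"
    using eventually_ge_at_top[of "nat \<lceil>Re \<xi>\<rceil>"]
    by eventually_elim (intro norm_K_series_term_le, linarith)
qed

text \<open>The same recurrence as \<open>expint_rec\<close>, so that a formula linking the two
  functions can be carried from xi - 1 to xi.\<close>

lemma K_series_rec: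
  assumes "\<And>k. \<xi> \<noteq> of_nat (Suc k)"
  shows "(1 - \<xi>) * K_series a \<xi> = a * K_series a (\<xi> - 1) - exp (- a)"
proof -
  define t where "t k = (- a) ^ k / (fact k * (of_nat (Suc k) - \<xi>))" for k
  define u where "u k = (- a) ^ k / (fact k * (of_nat (Suc k) - (\<xi> - 1)))" for k
  have nz: "1 + of_nat k - \<xi> \<noteq> 0" for k
    using assms[of k] by auto
  have t: "t sums (- K_series a \<xi>)" and u: "u sums (- K_series a (\<xi> - 1))"
    unfolding t_def u_def K_series_def using summable_K_series by (simp_all only: minus_minus summable_sums)
  have exp: "(\<lambda>k. (- a) ^ k / fact k) sums exp (- a)"
    using exp_converges[of "- a"] by (simp add: scaleR_conv_of_real field_simps)
  have "(\<lambda>k. (- a) ^ k / fact k - (1 - \<xi>) * t k) sums (exp (- a) - (1 - \<xi>) * (- K_series a \<xi>))"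
    by (intro sums_diff exp sums_mult t)
  moreover have "(\<lambda>k. (- a) ^ k / fact k - (1 - \<xi>) * t k) sums (- a * (- K_series a (\<xi> - 1)))"
  proof -
    \<comment> \<open>Because (k + 1 - xi) - (1 - xi) = k. The term at k = 0 drops out, and
      reindexing produces the factor - a.\<close>
    have eq: "(- a) ^ k / fact k - (1 - \<xi>) * t k = of_nat k * t k" for k
      using nz[of k] by (simp add: t_def divide_simps) (simp add: algebra_simps)
    have "(\<lambda>k. of_nat (Suc k) * t (Suc k)) sums (- a * (- K_series a (\<xi> - 1)))"
    proof -
      have "of_nat (Suc k) * t (Suc k) = - a * u k" for k
      proof -
        have "complex_of_nat (Suc (Suc k)) - \<xi> = of_nat (Suc k) - (\<xi> - 1)" by simp
        thus ?thesis
          using of_nat_neq_0[of k, where ?'a = complex] unfolding t_def u_def fact_Suc power_Suc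
          by (simp add: mult.assoc del: of_nat_Suc)
      qed
      thus ?thesis using sums_mult[OF u, of "- a"] by simp
    qed
    thus ?thesis unfolding eq by (subst (asm) sums_Suc_iff) simp
  qed
  ultimately have "exp (- a) - (1 - \<xi>) * (- K_series a \<xi>) = - a * (- K_series a (\<xi> - 1))"
    by (rule sums_unique2)
  thus ?thesis by (simp add: algebra_simps)
qed

lemma
  assumes xi: "Re \<xi> < 1"
  shows integrable_K_series: "integrable lborel (\<lambda>r. indicator {0<..<1} r *\<^sub>R expow a (- \<xi>) r)"
    and integral_K_series: "(LINT r|lborel. indicator {0<..<1} r *\<^sub>R expow a (- \<xi>) r) = - K_series a \<xi>"
proof -
  define f where "f k r = (- a) ^ k / fact k * (indicator {0<..<1} r *\<^sub>R expow 0 ((of_nat (Suc k) - \<xi>) - 1) r)" for k r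
  have Re: "Re (of_nat (Suc k) - \<xi>) > 0" for k
    using xi by simp
  have f_eq: "f k r = indicator {0<..<1} r *\<^sub>R expow 0 (- \<xi>) r * ((- a * of_real r) ^ k / fact k)" for k r
  proof (cases "0 < r \<and> r < 1")
    case True
    have "expow 0 ((of_nat (Suc k) - \<xi>) - 1) r = exp (of_nat k * of_real (ln r)) * expow 0 (- \<xi>) r"
      unfolding expow_def by (rule exp_eq_mult) (simp add: algebra_simps)
    also have "exp (of_nat k * complex_of_real (ln r)) = of_real r ^ k"
      using True by (simp add: exp_of_nat_mult exp_of_real)
    finally have "f k r = (- a) ^ k / fact k * (indicator {0<..<1} r *\<^sub>R (of_real r ^ k * expow 0 (- \<xi>) r))"
      by (simp add: f_def)
    thus ?thesis
      unfolding power_mult_distrib[of "- a" "of_real r"] by (simp add: mult_ac scaleR_conv_of_real)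
  qed (auto simp: f_def indicator_def)
  have sums: "(\<lambda>k. f k r) sums (indicator {0<..<1} r *\<^sub>R expow a (- \<xi>) r)" for r
  proof -
    have "(\<lambda>k. (- a * of_real r) ^ k / fact k) sums exp (- a * of_real r)"
      using exp_converges[of "- a * of_real r"] by (simp add: scaleR_conv_of_real field_simps)
    from sums_mult[OF this, of "indicator {0<..<1} r *\<^sub>R expow 0 (- \<xi>) r"]
    have "(\<lambda>k. f k r) sums (indicator {0<..<1} r *\<^sub>R (expow 0 (- \<xi>) r * exp (- a * of_real r)))"
      unfolding f_eq by simp
    also have "expow 0 (- \<xi>) r * exp (- a * of_real r) = expow a (- \<xi>) r"
      unfolding expow_def by (rule exp_eq_mult[symmetric]) (simp add: algebra_simps)
    finally show ?thesis .
  qed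
  have int: "integrable lborel (f k)" for k
    unfolding f_def by (intro integrable_mult_right integrable_power_01 Re)
  have summ: "AE r in lborel. summable (\<lambda>k. norm (f k r))"
  proof (intro AE_I2)
    fix r :: real
    have "summable (\<lambda>k. norm (indicator {0<..<1} r *\<^sub>R expow 0 (- \<xi>) r) * (norm (- a * of_real r) ^ k / fact k))"
      by (intro summable_mult summable_norm_exp_series)
    thus "summable (\<lambda>k. norm (f k r))"
      unfolding f_eq norm_mult norm_divide norm_power norm_fact .
  qed
  have summ': "summable (\<lambda>k. LINT r|lborel. norm (f k r))"
  proof (rule summable_comparison_test')
    \<comment> \<open>On (0, 1) the extra factor r^k is at most 1, so the integral at k = 0 controls
      all terms up to |a|^k / k!.\<close>
    define C where "C = (LINT r|lborel. norm (indicator {0<..<1} r *\<^sub>R expow 0 (- \<xi>) r))"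
    show "summable (\<lambda>k. norm a ^ k / fact k * C)"
      by (intro summable_mult2 summable_norm_exp_series)
    have int0: "integrable lborel (\<lambda>r. indicator {0<..<1} r *\<^sub>R expow 0 (- \<xi>) r)"
      using integrable_power_01[of "1 - \<xi>"] xi by simp
    fix k :: nat assume "k \<ge> 0"
    have "(LINT r|lborel. norm (f k r)) \<le> (LINT r|lborel. norm a ^ k / fact k * norm (indicator {0<..<1} r *\<^sub>R expow 0 (- \<xi>) r))"
    proof (rule integral_mono)
      fix r :: real
      have "norm (f k r) = norm (indicator {0<..<1} r *\<^sub>R expow 0 (- \<xi>) r) * (norm a ^ k / fact k) * \<bar>r\<bar> ^ k"
        unfolding f_eq by (simp add: norm_mult norm_divide norm_power power_mult_distrib)
      also have "\<dots> \<le> norm a ^ k / fact k * norm (indicator {0<..<1} r *\<^sub>R expow 0 (- \<xi>) r)"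
      proof (cases "0 < r \<and> r < 1")
        case True
        hence "\<bar>r\<bar> ^ k \<le> 1" by (intro power_le_one) auto
        thus ?thesis
          using mult_left_mono[of "\<bar>r\<bar> ^ k" 1 "norm (indicator {0<..<1} r *\<^sub>R expow 0 (- \<xi>) r) * (norm a ^ k / fact k)"]
          by (simp add: mult_ac)
      qed (auto simp: indicator_def)
      finally show "norm (f k r) \<le> norm a ^ k / fact k * norm (indicator {0<..<1} r *\<^sub>R expow 0 (- \<xi>) r)" .
    qed (intro integrable_mult_right integrable_norm int int0)+
    also have "\<dots> = norm a ^ k / fact k * C"
      unfolding C_def by (rule integral_mult_right_zero)
    finally show "norm (LINT r|lborel. norm (f k r)) \<le> norm a ^ k / fact k * C"
      by (simp add: integral_nonneg_AE)
  qed
  have suminf: "(\<Sum>k. f k r) = indicator {0<..<1} r *\<^sub>R expow a (- \<xi>) r" for r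
    using sums by (rule sums_unique[symmetric])
  show "integrable lborel (\<lambda>r. indicator {0<..<1} r *\<^sub>R expow a (- \<xi>) r)"
    using integrable_suminf[OF int summ summ'] unfolding suminf .
  have "(LINT r|lborel. indicator {0<..<1} r *\<^sub>R expow a (- \<xi>) r) = (\<Sum>k. LINT r|lborel. f k r)"
    using integral_suminf[OF int summ summ'] unfolding suminf .
  also have "\<dots> = (\<Sum>k. (- a) ^ k / (fact k * (of_nat (Suc k) - \<xi>)))"
    unfolding f_def integral_mult_right_zero integral_power_01[OF Re] by simp
  finally show "(LINT r|lborel. indicator {0<..<1} r *\<^sub>R expow a (- \<xi>) r) = - K_series a \<xi>"
    by (simp add: K_series_def)
qed

section \<open>Evaluation of the integral over y > 1\<close>

lemma expint_eq_Re_less_1: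
  assumes a: "Re a > 0" and xi: "Re \<xi> < 1"
  shows "expint a \<xi> = exp ((\<xi> - 1) * Ln a) * Gamma (1 - \<xi>) + K_series a \<xi>"
proof -
  have "AE x in lborel. gamma_integrand a (1 - \<xi>) x
          = indicator {0<..<1} x *\<^sub>R expow a (- \<xi>) x + indicator {1<..} x *\<^sub>R expow a (- \<xi>) x"
    using AE_lborel_singleton[of 1] by eventually_elim (auto simp: gamma_integrand_expow indicator_def)
  hence "(LINT x|lborel. gamma_integrand a (1 - \<xi>) x)
       = (LINT x|lborel. indicator {0<..<1} x *\<^sub>R expow a (- \<xi>) x + indicator {1<..} x *\<^sub>R expow a (- \<xi>) x)"
    by (intro integral_cong_AE) auto
  also have "\<dots> = - K_series a \<xi> + expint a \<xi>"
    using a xi unfolding expint_def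
    by (subst Bochner_Integration.integral_add) (auto simp: integral_K_series intro: integrable_K_series integrable_expow)
  also have "(LINT x|lborel. gamma_integrand a (1 - \<xi>) x) = Gamma (1 - \<xi>) * exp (- (1 - \<xi>) * Ln a)"
    using a xi by (intro integral_gamma_integrand) auto
  finally show ?thesis by (simp add: algebra_simps)
qed

text \<open>Induction on the right edge of the half-plane. Both sides obey the same recurrence,
  Gamma contributing Gamma (2 - xi) = (1 - xi) Gamma (1 - xi), and 1 - xi can be cancelled off the
  positive integers.\<close>

lemma expint_eq_Re_less_nat:
  assumes a: "Re a > 0"
  shows "Re \<xi> < of_nat (Suc n) \<Longrightarrow> (\<And>k. \<xi> \<noteq> of_nat (Suc k)) \<Longrightarrow>
         expint a \<xi> = exp ((\<xi> - 1) * Ln a) * Gamma (1 - \<xi>) + K_series a \<xi>"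
proof (induction n arbitrary: \<xi>)
  case 0
  thus ?case using a by (intro expint_eq_Re_less_1) auto
next
  case (Suc n)
  have nz: "1 - \<xi> \<noteq> 0" using Suc.prems(2)[of 0] by auto
  have "\<xi> - 1 \<noteq> of_nat (Suc k)" for k
    using Suc.prems(2)[of "Suc k"] by (auto simp: algebra_simps)
  hence IH: "expint a (\<xi> - 1) = exp ((\<xi> - 1 - 1) * Ln a) * Gamma (1 - (\<xi> - 1)) + K_series a (\<xi> - 1)"
    using Suc.prems(1) by (intro Suc.IH) auto
  have "1 - \<xi> \<notin> \<int>\<^sub>\<le>\<^sub>0"
  proof
    assume "1 - \<xi> \<in> \<int>\<^sub>\<le>\<^sub>0"
    then obtain m where "1 - \<xi> = - of_nat m" by (elim nonpos_Ints_cases')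
    hence "\<xi> = of_nat (Suc m)" by (simp add: algebra_simps)
    thus False using Suc.prems(2) by blast
  qed
  hence Gamma: "Gamma (1 - (\<xi> - 1)) = (1 - \<xi>) * Gamma (1 - \<xi>)"
    using Gamma_plus1[of "1 - \<xi>"] by (simp add: algebra_simps)
  have "exp ((\<xi> - 1) * Ln a) = exp ((\<xi> - 1 - 1) * Ln a) * exp (Ln a)"
    by (rule exp_eq_mult) (simp add: algebra_simps)
  hence pow: "exp ((\<xi> - 1) * Ln a) = exp ((\<xi> - 1 - 1) * Ln a) * a"
    using a by (subst (asm) exp_Ln) auto
  have "(1 - \<xi>) * expint a \<xi> = a * (exp ((\<xi> - 1 - 1) * Ln a) * Gamma (1 - (\<xi> - 1)) + K_series a (\<xi> - 1)) - exp (- a)"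
    using a by (subst expint_rec) (simp_all add: IH)
  also have "\<dots> = (1 - \<xi>) * (exp ((\<xi> - 1) * Ln a) * Gamma (1 - \<xi>)) + (a * K_series a (\<xi> - 1) - exp (- a))"
    unfolding Gamma pow by (simp add: algebra_simps)
  also have "a * K_series a (\<xi> - 1) - exp (- a) = (1 - \<xi>) * K_series a \<xi>"
    using Suc.prems(2) by (rule K_series_rec[symmetric])
  also have "(1 - \<xi>) * (exp ((\<xi> - 1) * Ln a) * Gamma (1 - \<xi>)) + (1 - \<xi>) * K_series a \<xi>
      = (1 - \<xi>) * (exp ((\<xi> - 1) * Ln a) * Gamma (1 - \<xi>) + K_series a \<xi>)"
    by (simp add: algebra_simps)
  finally show ?case using nz by simp
qed

lemma expint_eq:
  assumes a: "Re a > 0" and "\<And>k. \<xi> \<noteq> of_nat (Suc k)"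
  shows "expint a \<xi> = exp ((\<xi> - 1) * Ln a) * Gamma (1 - \<xi>) + K_series a \<xi>"
proof -
  obtain n where "Re \<xi> < real n" using reals_Archimedean2 by blast
  hence "Re \<xi> < of_nat (Suc n)" by simp
  thus ?thesis using assms by (intro expint_eq_Re_less_nat) auto
qed

text \<open>For fixed xi the series is an everywhere convergent power series in - a; its continuity
  allows the limit onto the imaginary axis.\<close>

lemma isCont_K_series: "isCont (\<lambda>a. K_series a \<xi>) a"
proof -
  define c where "c k = 1 / (fact k * (of_nat (Suc k) - \<xi>))" for k
  have "summable (\<lambda>k. c k * y ^ k)" for y
    using summable_K_series[of "- y" \<xi>] by (simp add: c_def)
  hence "isCont (\<lambda>x. \<Sum>k. c k * x ^ k) (- a)"
    by (rule isCont_powser_converges_everywhere)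
  hence "isCont (\<lambda>a. - (\<Sum>k. c k * (- a) ^ k)) a"
    by (intro continuous_intros isCont_o2[of a uminus "\<lambda>x. \<Sum>k. c k * x ^ k"])
  thus ?thesis by (simp add: K_series_def c_def)
qed

lemma Ln_imag_pos: "q > 0 \<Longrightarrow> Ln (\<i> * of_real q) = of_real (ln q) + \<i> * pi / 2"
  by (rule Ln_unique) (auto simp: exp_add exp_of_real exp_Euler algebra_simps cis_conv_exp [symmetric] complex_eq_iff Re_exp Im_exp)

text \<open>
  On the imaginary axis \<open>\<integral>\<^sub>0\<^sup>\<infinity> exp (- i q y) y powr -\<xi> dy\<close> is never absolutely convergent, so the
  evaluation is obtained as a limit from \<open>Re a > 0\<close>, where only the integral over \<open>y > 1\<close> is taken
  to the boundary.
\<close>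

lemma expint_imag_eq:
  assumes q: "q > 0" and xi: "Re \<xi> > 1" "\<And>k. \<xi> \<noteq> of_nat (Suc k)"
  shows "expint (\<i> * of_real q) \<xi>
       = exp ((\<xi> - 1) * (of_real (ln q) + \<i> * pi / 2)) * Gamma (1 - \<xi>) + K_series (\<i> * of_real q) \<xi>"
proof -
  define a where "a n = \<i> * of_real q + of_real (inverse (real (Suc n)))" for n
  have "a \<longlonglongrightarrow> \<i> * of_real q + of_real 0"
    unfolding a_def by (intro tendsto_intros LIMSEQ_inverse_real_of_nat)
  hence a: "a \<longlonglongrightarrow> \<i> * of_real q" by simp
  have Re_a: "Re (a n) > 0" for n by (simp add: a_def)
  have "(\<lambda>n. exp ((\<xi> - 1) * Ln (a n)) * Gamma (1 - \<xi>) + K_series (a n) \<xi>)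
      \<longlonglongrightarrow> exp ((\<xi> - 1) * Ln (\<i> * of_real q)) * Gamma (1 - \<xi>) + K_series (\<i> * of_real q) \<xi>"
    using q by (intro tendsto_intros a isCont_tendsto_compose[OF isCont_K_series] tendsto_Ln)
       (auto simp: complex_nonpos_Reals_iff)
  moreover have "(\<lambda>n. expint (a n) \<xi>) \<longlonglongrightarrow> expint (\<i> * of_real q) \<xi>"
    unfolding expint_def
  \<comment> \<open>Dropping e^(-ay) leaves the majorant y^(-Re xi), integrable over y > 1 because
    Re xi > 1.\<close>
  proof (rule Bochner_Integration.integral_dominated_convergence[where w = "\<lambda>y. norm (indicator {1<..} y *\<^sub>R expow 0 (- \<xi>) y)"])
    show "integrable lborel (\<lambda>y. norm (indicator {1<..} y *\<^sub>R expow 0 (- \<xi>) y))"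
      using xi by (intro integrable_norm integrable_expow) auto
    show "AE y in lborel. (\<lambda>n. indicator {1<..} y *\<^sub>R expow (a n) (- \<xi>) y) \<longlonglongrightarrow> indicator {1<..} y *\<^sub>R expow (\<i> * of_real q) (- \<xi>) y"
      unfolding expow_def by (intro AE_I2 tendsto_intros a)
    show "AE y in lborel. norm (indicator {1<..} y *\<^sub>R expow (a n) (- \<xi>) y) \<le> norm (indicator {1<..} y *\<^sub>R expow 0 (- \<xi>) y)" for n
      using Re_a[of n] by (intro AE_I2) (auto simp: norm_expow indicator_def)
  qed auto
  ultimately have "expint (\<i> * of_real q) \<xi> = exp ((\<xi> - 1) * Ln (\<i> * of_real q)) * Gamma (1 - \<xi>) + K_series (\<i> * of_real q) \<xi>"
    using expint_eq[OF Re_a xi(2)] LIMSEQ_unique by simp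
  thus ?thesis by (simp only: Ln_imag_pos[OF q])
qed

section \<open>Meromorphic continuation and uniqueness of K\<close>

lemma K_series_split:
  obtains g where "g holomorphic_on {\<xi>. Re \<xi> < real N}"
    "\<And>\<xi>. Re \<xi> < real N \<Longrightarrow> K_series a \<xi> = g \<xi> - (\<Sum>k<N. (- a) ^ k / (fact k * (of_nat (Suc k) - \<xi>)))"
proof -
  \<comment> \<open>Only the first N terms can have a pole in Re xi < N. In the others |k + 1 - xi|
    >= 1, so they are dominated by the exponential series and sum to a holomorphic function.\<close>
  define t where "t k \<xi> = (- a) ^ k / (fact k * (of_nat (Suc k) - \<xi>))" for k \<xi>
  define S where "S = {\<xi>. Re \<xi> < real N}"
  have S: "open S" unfolding S_def by (rule open_halfspace_Re_lt)
  have der: "(t (k + N) has_field_derivative deriv (t (k + N)) \<xi>) (at \<xi>)" if "\<xi> \<in> S" for k \<xi>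
  proof -
    have "of_nat (Suc (k + N)) - z \<noteq> 0" if "z \<in> S" for z
      using norm_of_nat_diff_ge[of z "k + N"] that by (auto simp: S_def simp del: of_nat_Suc)
    hence "t (k + N) holomorphic_on S"
      unfolding t_def by (intro holomorphic_intros) (auto simp del: of_nat_Suc)
    thus ?thesis using S that by (rule holomorphic_derivI)
  qed
  have "\<exists>g g'. \<forall>x\<in>S. ((\<lambda>k. t (k + N) x) sums g x) \<and> ((\<lambda>k. deriv (t (k + N)) x) sums g' x)
           \<and> (g has_field_derivative g' x) (at x)"
  proof (rule series_and_derivative_comparison_complex[OF S der])
    fix x assume "x \<in> S"
    define h where "h k = complex_of_real (norm a ^ (k + N) / fact (k + N))" for k
    have "summable h"
      using summable_norm_exp_series[of a] unfolding h_def summable_of_real_iff by (subst summable_iff_shift)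
    moreover have "norm (t (k + N) y) \<le> norm (h k)" if "y \<in> S" for k y
    proof -
      have "norm (h k) = norm a ^ (k + N) / fact (k + N)"
        unfolding h_def by (simp add: norm_divide norm_power del: of_real_divide of_real_power)
      thus ?thesis using norm_K_series_term_le[of y "k + N" a] that by (auto simp: t_def S_def)
    qed
    moreover have "range h \<subseteq> \<real>\<^sub>\<ge>\<^sub>0"
      by (auto simp: h_def simp del: of_real_divide of_real_power)
    ultimately show "\<exists>d (h :: nat \<Rightarrow> complex). 0 < d \<and> summable h \<and> range h \<subseteq> \<real>\<^sub>\<ge>\<^sub>0 \<and> (\<forall>\<^sub>F k in sequentially. \<forall>y\<in>ball x d \<inter> S. norm (t (k + N) y) \<le> norm (h k))"
      by (intro exI[of _ 1] exI[of _ h]) auto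
  qed
  then obtain g g' where g: "\<And>x. x \<in> S \<Longrightarrow> (\<lambda>k. t (k + N) x) sums g x" "\<And>x. x \<in> S \<Longrightarrow> (g has_field_derivative g' x) (at x)"
    by blast
  show thesis
  proof
    show "(\<lambda>\<xi>. - g \<xi>) holomorphic_on {\<xi>. Re \<xi> < real N}"
      using g(2) S unfolding S_def[symmetric] by (intro holomorphic_intros) (auto simp: holomorphic_on_open)
    fix \<xi> assume "Re \<xi> < real N"
    hence "\<xi> \<in> S" by (simp add: S_def)
    have "(\<Sum>k. t k \<xi>) = (\<Sum>k. t (k + N) \<xi>) + (\<Sum>k<N. t k \<xi>)"
      unfolding t_def by (rule suminf_split_initial_segment[OF summable_K_series])
    also have "(\<Sum>k. t (k + N) \<xi>) = g \<xi>"
      using g(1)[OF \<open>\<xi> \<in> S\<close>] by (rule sums_unique[symmetric])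
    finally show "K_series a \<xi> = - g \<xi> - (\<Sum>k<N. (- a) ^ k / (fact k * (of_nat (Suc k) - \<xi>)))"
      by (simp add: K_series_def t_def)
  qed
qed

lemma K_series_analytic:
  assumes "\<And>k. \<xi> \<noteq> of_nat (Suc k)"
  shows "K_series a analytic_on {\<xi>}"
proof -
  obtain N where N: "Re \<xi> < real N" using reals_Archimedean2 by blast
  obtain g where g: "g holomorphic_on {\<xi>. Re \<xi> < real N}"
    "\<And>\<xi>. Re \<xi> < real N \<Longrightarrow> K_series a \<xi> = g \<xi> - (\<Sum>k<N. (- a) ^ k / (fact k * (of_nat (Suc k) - \<xi>)))"
    using K_series_split[of N a] by blast
  define S where "S = {\<xi>. Re \<xi> < real N} - (\<lambda>k. of_nat (Suc k)) ` {..<N}"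
  have "open S"
    unfolding S_def by (intro open_Diff open_halfspace_Re_lt finite_imp_closed) auto
  moreover have "\<xi> \<in> S" using N assms by (auto simp: S_def)
  moreover have "K_series a holomorphic_on S"
  proof -
    have "(\<lambda>\<xi>. g \<xi> - (\<Sum>k<N. (- a) ^ k / (fact k * (of_nat (Suc k) - \<xi>)))) holomorphic_on S"
      by (intro holomorphic_intros holomorphic_on_subset[OF g(1)]) (auto simp: S_def simp del: of_nat_Suc)
    thus ?thesis by (rule holomorphic_transform) (auto simp: S_def g(2))
  qed
  ultimately show ?thesis
    unfolding analytic_at by blast
qed

lemma K_series_meromorphic: "K_series a meromorphic_on UNIV"
  unfolding meromorphic_on_meromorphic_at[of _ UNIV]
proof
  fix \<xi> :: complex
  obtain N where N: "Re \<xi> < real N" using reals_Archimedean2 by blast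
  obtain g where g: "g holomorphic_on {\<xi>. Re \<xi> < real N}"
    "\<And>\<xi>. Re \<xi> < real N \<Longrightarrow> K_series a \<xi> = g \<xi> - (\<Sum>k<N. (- a) ^ k / (fact k * (of_nat (Suc k) - \<xi>)))"
    using K_series_split[of N a] by blast
  have "g analytic_on {\<xi>}"
    using g(1) N open_halfspace_Re_lt by (auto simp: analytic_at)
  hence m: "(\<lambda>\<xi>. g \<xi> - (\<Sum>k<N. (- a) ^ k / (fact k * (of_nat (Suc k) - \<xi>)))) meromorphic_on {\<xi>}"
    by (intro meromorphic_intros analytic_on_imp_meromorphic_on)
  have "eventually (\<lambda>z. z \<in> {\<xi>. Re \<xi> < real N}) (at \<xi>)"
    using N by (intro eventually_at_in_open' open_halfspace_Re_lt) auto
  hence ev: "eventually (\<lambda>z. K_series a z = g z - (\<Sum>k<N. (- a) ^ k / (fact k * (of_nat (Suc k) - z)))) (at \<xi>)"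
    by eventually_elim (simp add: g(2))
  show "K_series a meromorphic_on {\<xi>}"
    using m by (subst meromorphic_on_cong) (use ev in auto)
qed

text \<open>The identity theorem that makes the definite description in \<open>K\<close>
  unambiguous: agreement on a small open set propagates to punctured neighbourhoods of every point,
  and the values at the points themselves are then forced.\<close>

lemma nicely_meromorphic_eqI:
  assumes f: "f nicely_meromorphic_on UNIV" and g: "g nicely_meromorphic_on UNIV"
    and S: "open S" "z0 \<in> S" "\<And>z. z \<in> S \<Longrightarrow> f z = g z"
  shows "f = g"
proof
  fix z
  \<comment> \<open>At each point a nicely meromorphic function is either continuous or has a pole
    and the value 0. \<open>remove_sings\<close> changes neither, so equality near z gives equality
    at z.\<close>
  have rem: "remove_sings h z = h z" if "h nicely_meromorphic_on UNIV" for h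
    using that unfolding nicely_meromorphic_on_def by (metis UNIV_I remove_sings_at_pole remove_sings_eqI)
  have mero: "(\<lambda>z. f z - g z) meromorphic_on UNIV"
    using f g by (auto simp: nicely_meromorphic_on_def intro!: meromorphic_intros)
  define h where "h = remove_sings (\<lambda>z. f z - g z)"
  have h: "h nicely_meromorphic_on UNIV"
    unfolding h_def by (rule remove_sings_nicely_meromorphic[OF mero])
  have iso: "isolated_singularity_at (\<lambda>z. f z - g z) w" for w
    using mero by (intro meromorphic_on_isolated_singularity) (auto intro: meromorphic_on_subset)
  have ev: "eventually (\<lambda>w. h w = f w - g w) (at z')" for z'
    unfolding h_def using iso by (rule eventually_remove_sings_eq_at)
  have "eventually (\<lambda>w. w \<in> S) (at z0)"
    using S by (intro eventually_at_in_open') auto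
  with ev[of z0] have "eventually (\<lambda>w. h w = 0) (at z0)"
    by eventually_elim (simp add: S(3))
  hence "frequently (\<lambda>w. h w = 0) (at z0)"
    by (rule eventually_frequently[rotated]) simp
  hence h0: "h w = 0" for w
    by (rule frequently_eq_meromorphic_imp_constant[OF _ h]) auto
  have "eventually (\<lambda>w. f w = g w) (at z)"
    using ev[of z] by eventually_elim (simp add: h0)
  hence "remove_sings f z = remove_sings g z"
    by (intro remove_sings_cong) auto
  thus "f z = g z" using rem f g by simp
qed

text \<open>On the strip the series is the integral that describes \<open>K\<close>; its normalised
  meromorphic extension is therefore \<open>K\<close> by uniqueness.\<close>

lemma K_eq:
  assumes "\<And>k. \<xi> \<noteq> of_nat (Suc k)"
  shows "K p \<xi> = K_series (\<i> * of_real (2 * pi * p)) \<xi>"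
proof -
  \<comment> \<open>At a pole the raw series has a finite default value; \<open>remove_sings\<close>
    resets it to the 0 that a nicely meromorphic function must have there.\<close>
  define f where "f = remove_sings (K_series (\<i> * of_real (2 * pi * p)))"
  have f: "f nicely_meromorphic_on UNIV"
    unfolding f_def by (intro remove_sings_nicely_meromorphic K_series_meromorphic)
  have f_eq: "f \<xi> = K_series (\<i> * of_real (2 * pi * p)) \<xi>" if "\<And>k. \<xi> \<noteq> of_nat (Suc k)" for \<xi>
    unfolding f_def by (intro remove_sings_at_analytic K_series_analytic that)
  have strip: "f \<xi> = - (LBINT r:{0..1}. exp (- 2 * pi * \<i> * p * r) * of_real r powr (- \<xi>))"
    if "0 < Re \<xi>" "Re \<xi> < 1" for \<xi>
  proof -
    have "f \<xi> = K_series (\<i> * of_real (2 * pi * p)) \<xi>"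
      using that by (intro f_eq) auto
    also have "\<dots> = - (LINT r|lborel. indicator {0<..<1} r *\<^sub>R expow (\<i> * of_real (2 * pi * p)) (- \<xi>) r)"
      using that by (subst integral_K_series) auto
    also have "(LINT r|lborel. indicator {0<..<1} r *\<^sub>R expow (\<i> * of_real (2 * pi * p)) (- \<xi>) r)
       = (LBINT r:{0..1}. exp (- 2 * pi * \<i> * p * r) * of_real r powr (- \<xi>))"
      unfolding set_lebesgue_integral_def
    proof (rule integral_cong_AE)
      show "AE r in lborel. indicator {0<..<1} r *\<^sub>R expow (\<i> * of_real (2 * pi * p)) (- \<xi>) r
          = indicator {0..1} r *\<^sub>R (exp (- 2 * pi * \<i> * p * r) * of_real r powr (- \<xi>))"
        using AE_lborel_singleton[of 0] AE_lborel_singleton[of 1]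
      proof eventually_elim
        case (elim r)
        have "expow (\<i> * of_real (2 * pi * p)) (- \<xi>) r = exp (- 2 * pi * \<i> * p * r) * exp (- \<xi> * of_real (ln r))"
          unfolding expow_def by (rule exp_eq_mult) simp
        thus ?case using elim by (auto simp: indicator_def powr_def Ln_of_real)
      qed
    qed auto
    finally show ?thesis .
  qed
  have "K p = f"
    unfolding K_def
  proof (rule the_equality)
    fix g assume g: "g nicely_meromorphic_on UNIV \<and> (\<forall>\<xi>. 0 < Re \<xi> \<and> Re \<xi> < 1 \<longrightarrow>
               g \<xi> = - (LBINT r:{0..1}. exp (- 2 * pi * \<i> * p * r) * of_real r powr (- \<xi>)))"
    show "g = f"
    proof (rule nicely_meromorphic_eqI[of _ _ "{z. Re z > 0} \<inter> {z. Re z < 1}" "1/2"])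
      show "open ({z. Re z > 0} \<inter> {z. Re z < 1})"
        by (intro open_Int open_halfspace_Re_gt open_halfspace_Re_lt)
    qed (use f g strip in auto)
  qed (use f strip in auto)
  thus ?thesis using f_eq[OF assms] by simp
qed

section \<open>Identification of the bracket\<close>

lemma expint_holomorphic:
  assumes "Re a \<ge> 0"
  shows "expint a holomorphic_on {\<xi>. Re \<xi> > 1}"
  unfolding expint_def
proof (rule holomorphic_on_integral)
  show "open {\<xi>. Re \<xi> > 1}" by (rule open_halfspace_Re_gt)
  show "(\<lambda>\<xi>. indicator {1<..} y *\<^sub>R expow a (- \<xi>) y) holomorphic_on {\<xi>. Re \<xi> > 1}" for y
    unfolding expow_def scaleR_conv_of_real by (intro holomorphic_intros)
  fix z :: complex assume "z \<in> {\<xi>. Re \<xi> > 1}"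
  define e where "e = (Re z - 1) / 2"
  have e: "e > 0" "Re z = 1 + 2 * e" using \<open>z \<in> _\<close> by (simp_all add: e_def field_simps)
  have Re: "Re w \<ge> 1 + e" if "w \<in> cball z e" for w
    using that abs_Re_le_cmod[of "z - w"] e by (simp add: dist_norm)
  have "norm (indicator {1<..} y *\<^sub>R expow a (- w) y) \<le> norm (indicator {1<..} y *\<^sub>R expow 0 (- of_real (1 + e)) y)"
    if "w \<in> cball z e" for w y
  proof (cases "y > 1")
    case True
    have "(1 + e) * ln y \<le> Re w * ln y" using Re[OF that] True by (intro mult_right_mono) auto
    moreover have "0 \<le> Re a * y" using assms True by simp
    ultimately show ?thesis using True by (simp add: norm_expow algebra_simps)
  qed simp
  moreover have "integrable lborel (\<lambda>y. norm (indicator {1<..} y *\<^sub>R expow 0 (- of_real (1 + e)) y))"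
    using e by (intro integrable_norm integrable_expow) auto
  moreover have "cball z e \<subseteq> {\<xi>. Re \<xi> > 1}" using Re e by fastforce
  ultimately show "\<exists>e>0. \<exists>g. cball z e \<subseteq> {\<xi>. 1 < Re \<xi>} \<and> integrable lborel g \<and>
      (\<forall>w\<in>cball z e. \<forall>y. norm (indicator {1<..} y *\<^sub>R expow a (- w) y) \<le> g y)"
    using e by blast
qed simp

text \<open>The cancellation of poles at xi = 2, 3, ... is obtained without computing residues: off
  these points the bracket coincides with \<open>expint\<close>, which is continuous on Re xi > 1,
  so the limit taken by \<open>remove_sings\<close> is the value of \<open>expint\<close>.\<close>

lemma bracket_eq_expint:
  assumes p: "p > 0" and xi: "Re \<xi> > 1"
  shows "bracket p \<xi> = expint (\<i> * of_real (2 * pi * p)) \<xi>"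
  unfolding bracket_def
proof (rule remove_sings_eqI)
  let ?a = "\<i> * of_real (2 * pi * p)"
  define B where "B z = of_real (2 * pi * p) powr (z - 1) * exp ((z - 1) * pi * \<i> / 2) * Gamma (1 - z) + K p z" for z :: complex
  obtain N where N: "Re \<xi> < real N" using reals_Archimedean2 by blast
  \<comment> \<open>Below the abscissa N only finitely many positive integers have to be avoided, so
    a punctured neighbourhood of xi misses all of them.\<close>
  define X where "X = {z :: complex. Re z > 1} \<inter> {z. Re z < real N}"
  have X: "open X" "\<xi> \<in> X"
    using xi N unfolding X_def by (auto intro: open_Int open_halfspace_Re_gt open_halfspace_Re_lt)
  have "eventually (\<lambda>z. z \<in> X) (at \<xi>)" using X by (intro eventually_at_in_open')
  moreover have "eventually (\<lambda>z. z \<notin> (\<lambda>k. of_nat (Suc k)) ` {..<N}) (at \<xi>)"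
    using islimpt_finite[of "(\<lambda>k. of_nat (Suc k)) ` {..<N}" \<xi>] by (simp only: islimpt_iff_eventually finite_imageI finite_lessThan simp_thms)
  ultimately have "eventually (\<lambda>z. expint ?a z = B z) (at \<xi>)"
  proof eventually_elim
    case (elim z)
    have nz: "z \<noteq> of_nat (Suc k)" for k
      using elim by (cases "k < N") (auto simp: X_def)
    have "of_real (2 * pi * p) powr (z - 1) * exp ((z - 1) * pi * \<i> / 2)
        = exp ((z - 1) * (of_real (ln (2 * pi * p)) + \<i> * pi / 2))"
      using p by (simp add: powr_def exp_add [symmetric] Ln_of_real[symmetric] algebra_simps del: Ln_of_real)
    thus ?case
      using expint_imag_eq[of "2 * pi * p" z] p elim nz K_eq[of z p] by (simp add: B_def X_def)
  qed
  moreover have "(expint ?a \<longlongrightarrow> expint ?a \<xi>) (at \<xi>)"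
  proof -
    have "continuous_on {\<xi>. Re \<xi> > 1} (expint ?a)"
      by (intro holomorphic_on_imp_continuous_on expint_holomorphic) simp
    hence "isCont (expint ?a) \<xi>"
      using xi by (simp add: continuous_on_eq_continuous_at open_halfspace_Re_gt)
    thus ?thesis by (simp add: isCont_def)
  qed
  ultimately show "((\<lambda>z :: complex. of_real (2 * pi * p) powr (z - 1) * exp ((z - 1) * pi * \<i> / 2) * Gamma (1 - z) + K p z) \<longlongrightarrow> expint ?a \<xi>) (at \<xi>)"
    unfolding B_def by (rule Lim_transform_eventually[rotated])
qed

section \<open>The logarithmic derivative of zeta\<close>

text \<open>Absolute convergence permits summing f(d) g(e) over all pairs and regrouping by n = d
  e.\<close>

lemma has_sum_dirichlet_prod:
  fixes f g :: "nat \<Rightarrow> complex"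
  assumes f: "summable (\<lambda>n. norm (f n))" "f sums F" "f 0 = 0"
    and g: "summable (\<lambda>n. norm (g n))" "g sums G" "g 0 = 0"
  shows "((\<lambda>n. \<Sum>d | d dvd n. f d * g (n div d)) has_sum (F * G)) {1..}"
proof -
  \<comment> \<open>For n = 0 every d is a divisor, so regrouping is done over n >= 1; the index 0
    is shed because the terms there vanish.\<close>
  have restrict: "(h has_sum H) {1..}" if "summable (\<lambda>n. norm (h n))" "h sums H" "h 0 = 0"
    for h :: "nat \<Rightarrow> 'a :: banach" and H
  proof -
    have "(h has_sum H) UNIV" using that by (intro norm_summable_imp_has_sum)
    thus ?thesis
      by (rule has_sum_cong_neutral[THEN iffD1, rotated -1]) (use that(3) in \<open>auto simp: not_le less_Suc_eq\<close>)
  qed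
  have f': "(f has_sum F) {1..}" and g': "(g has_sum G) {1..}"
    by (rule restrict[OF f], rule restrict[OF g])
  have nf: "((\<lambda>n. norm (f n)) has_sum (\<Sum>n. norm (f n))) {1..}"
    and ng: "((\<lambda>n. norm (g n)) has_sum (\<Sum>n. norm (g n))) {1..}"
    by (rule restrict; use f g in \<open>simp add: summable_sums\<close>)+
  have "(\<lambda>(d, e). norm (f d) * norm (g e)) summable_on ({1..} \<times> {1..})"
  proof (rule summable_on_SigmaI)
    show "((\<lambda>e. case (d, e) of (d, e) \<Rightarrow> norm (f d) * norm (g e)) has_sum (norm (f d) * (\<Sum>n. norm (g n)))) {1..}" for d
      using has_sum_cmult_right[OF ng, of "norm (f d)"] by simp
    show "(\<lambda>d. norm (f d) * (\<Sum>n. norm (g n))) summable_on {1..}"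
      using has_sum_cmult_left[OF nf] by (auto simp: summable_on_def)
  qed auto
  hence "(\<lambda>x. norm (case x of (d, e) \<Rightarrow> f d * g e)) summable_on ({1..} \<times> {1..})"
    by (rule summable_on_cong[THEN iffD1, rotated]) (auto simp: norm_mult)
  hence summ: "(\<lambda>(d, e). f d * g e) summable_on ({1..} \<times> {1..})"
    by (rule abs_summable_summable)
  have "((\<lambda>(d, e). f d * g e) has_sum (F * G)) ({1..} \<times> {1..})"
  proof (rule has_sum_SigmaI[OF _ _ summ])
    show "((\<lambda>e. case (d, e) of (d, e) \<Rightarrow> f d * g e) has_sum (f d * G)) {1..}" for d
      using has_sum_cmult_right[OF g', of "f d"] by simp
    show "((\<lambda>d. f d * G) has_sum (F * G)) {1..}"
      by (rule has_sum_cmult_left[OF f'])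
  qed
  also have "?this \<longleftrightarrow> ((\<lambda>(n, d). f d * g (n div d)) has_sum (F * G)) (SIGMA n:{1..}. {d. d dvd n})"
    by (rule has_sum_reindex_bij_witness[of _ "\<lambda>(n, d). (d, n div d)" "\<lambda>(d, e). (d * e, d)"])
       (auto simp: Suc_le_eq dvd_div_eq_0_iff intro: Nat.gr0I)
  finally have "((\<lambda>(n, d). f d * g (n div d)) has_sum (F * G)) (SIGMA n:{1..}. {d. d dvd n})" .
  thus ?thesis
    by (rule has_sum_SigmaD) (auto intro!: has_sum_finite simp: Suc_le_eq)
qed

lemma norm_nat_powr: "norm (complex_of_nat n powr s) = real n powr Re s"
  using norm_powr_real_powr[of "of_nat n" s] by simp

text \<open>A locally uniformly convergent series of holomorphic functions may be differentiated
  termwise, so a bound on the series without logarithms already yields the series with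
  \<open>ln\<close>.\<close>

lemma dirichlet_series_has_derivative:
  fixes f :: "nat \<Rightarrow> complex"
  assumes "\<And>\<sigma>. \<sigma> > 1 \<Longrightarrow> summable (\<lambda>n. norm (f n) * real n powr (- \<sigma>))"
  obtains g g' where
    "\<And>s. Re s > 1 \<Longrightarrow> (\<lambda>n. f n * of_nat n powr (- s)) sums g s"
    "\<And>s. Re s > 1 \<Longrightarrow> (\<lambda>n. - (of_real (ln (real n)) * f n * of_nat n powr (- s))) sums g' s"
    "\<And>s. Re s > 1 \<Longrightarrow> (g has_field_derivative g' s) (at s)"
proof -
  have "\<exists>g g'. \<forall>s\<in>{s. Re s > 1}. ((\<lambda>n. f n * of_nat n powr (- s)) sums g s) \<and>
      ((\<lambda>n. - (of_real (ln (real n)) * f n * of_nat n powr (- s))) sums g' s) \<and> (g has_field_derivative g' s) (at s)"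
  proof (rule series_and_derivative_comparison_complex)
    show "open {s. Re s > 1}" by (rule open_halfspace_Re_gt)
    show "((\<lambda>s. f n * of_nat n powr (- s)) has_field_derivative
            - (of_real (ln (real n)) * f n * of_nat n powr (- s))) (at s)" for n s
    proof (cases "n = 0")
      case False
      thus ?thesis
        using DERIV_cmult[OF DERIV_chain2[OF has_field_derivative_powr_right[of "of_nat n" "- s"] DERIV_minus[OF DERIV_ident]], of "f n"]
        by (simp add: Ln_of_nat mult_ac)
    qed simp
    fix s :: complex assume "s \<in> {s. Re s > 1}"
    \<comment> \<open>Within distance \<open>d\<close> of s, half its distance to the line Re = 1,
      real parts stay above 1 + d.\<close>
    define d where "d = (Re s - 1) / 2"
    have d: "d > 0" "Re s = 1 + 2 * d" using \<open>s \<in> _\<close> by (simp_all add: d_def field_simps)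
    define h where "h n = complex_of_real (norm (f n) * real n powr (- (1 + d)))" for n
    have "summable h"
      unfolding h_def summable_of_real_iff using d by (intro assms) auto
    moreover have "norm (f n * of_nat n powr (- z)) \<le> norm (h n)" if "z \<in> ball s d" for n z
    proof (cases "n = 0")
      case False
      have "\<bar>Re s - Re z\<bar> \<le> norm (s - z)" using abs_Re_le_cmod[of "s - z"] by simp
      hence "Re z \<ge> 1 + d" using that d by (simp add: dist_norm)
      hence "real n powr (- Re z) \<le> real n powr (- (1 + d))"
        using False by (intro powr_mono) auto
      thus ?thesis by (simp add: h_def norm_mult norm_nat_powr mult_left_mono)
    qed simp
    moreover have "range h \<subseteq> \<real>\<^sub>\<ge>\<^sub>0" by (auto simp: h_def simp del: of_real_mult)
    ultimately show "\<exists>d (h :: nat \<Rightarrow> complex). 0 < d \<and> summable h \<and> range h \<subseteq> \<real>\<^sub>\<ge>\<^sub>0 \<and>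
        (\<forall>\<^sub>F n in sequentially. \<forall>z\<in>ball s d \<inter> {s. 1 < Re s}. norm (f n * of_nat n powr (- z)) \<le> norm (h n))"
      using d by (intro exI[of _ d] exI[of _ h]) auto
  qed
  then obtain g g' where "\<forall>s\<in>{s. Re s > 1}. ((\<lambda>n. f n * of_nat n powr (- s)) sums g s) \<and>
      ((\<lambda>n. - (of_real (ln (real n)) * f n * of_nat n powr (- s))) sums g' s) \<and> (g has_field_derivative g' s) (at s)"
    by (elim exE)
  thus thesis by (intro that[of g g']) simp_all
qed

lemma summable_ln_powr: "\<sigma> > 1 \<Longrightarrow> summable (\<lambda>n. ln (real n) * real n powr (- \<sigma>))"
proof (rule summable_comparison_test')
  assume s: "\<sigma> > 1"
  \<comment> \<open>The logarithm is at most n^d / d, and with this \<open>d\<close> the remaining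
    exponent d - \<sigma> is still below -1.\<close>
  define d where "d = (\<sigma> - 1) / 2"
  show "summable (\<lambda>n. (1 / d) * real n powr (d - \<sigma>))"
    using s by (intro summable_mult) (simp add: summable_real_powr_iff d_def field_simps)
  fix n :: nat assume "n \<ge> 1"
  hence "ln (real n) \<le> real n powr d / d"
    using s by (intro ln_powr_bound) (auto simp: d_def)
  hence "ln (real n) * real n powr (- \<sigma>) \<le> real n powr d / d * real n powr (- \<sigma>)"
    by (intro mult_right_mono) auto
  also have "\<dots> = (1 / d) * real n powr (d - \<sigma>)"
    by (simp add: powr_diff powr_minus divide_simps)
  finally show "norm (ln (real n) * real n powr (- \<sigma>)) \<le> (1 / d) * real n powr (d - \<sigma>)"
    using \<open>n \<ge> 1\<close> by simp
qed

lemma summable_mangoldt_powr: "\<sigma> > 1 \<Longrightarrow> summable (\<lambda>n. mangoldt n * real n powr (- \<sigma>))"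
proof (rule summable_comparison_test'[OF summable_ln_powr, where N = 1])
  fix n :: nat assume "1 \<le> n"
  thus "norm (mangoldt n * real n powr (- \<sigma>)) \<le> ln (real n) * real n powr (- \<sigma>)"
    using mangoldt_nonneg[of n] mangoldt_le[of n] by (simp add: abs_mult mult_right_mono)
qed

lemma zeta_sums:
  assumes "Re s > 1"
  shows "summable (\<lambda>n. norm (complex_of_nat n powr (- s)))" "(\<lambda>n. of_nat n powr (- s)) sums zeta s"
proof -
  show *: "summable (\<lambda>n. norm (complex_of_nat n powr (- s)))"
    using assms by (simp add: norm_nat_powr summable_real_powr_iff)
  hence "summable (\<lambda>n. complex_of_nat n powr (- s))" by (rule summable_norm_cancel)
  hence "summable (\<lambda>n. complex_of_nat (Suc n) powr (- s))" by (subst summable_Suc_iff)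
  hence "(\<lambda>n. complex_of_nat (Suc n) powr (- s)) sums zeta s"
    unfolding zeta_def powr_minus inverse_eq_divide by (rule summable_sums)
  \<comment> \<open>\<open>zeta\<close> sums from 1 and this series from 0; the extra term is 0
    because \<open>0 powr z = 0\<close>.\<close>
  thus "(\<lambda>n. of_nat n powr (- s)) sums zeta s"
    by (subst (asm) sums_Suc_iff) simp
qed

text \<open>
  Writing \<open>D\<close> for the Dirichlet series of \<open>\<Lambda>\<close>, the identity \<open>\<zeta>' = -D \<zeta>\<close> makes \<open>\<zeta>\<close> a constant
  multiple of \<open>exp (-\<integral>D)\<close>, hence zero-free for \<open>Re s > 1\<close>; no Euler product is needed.
\<close>

lemma zeta_nonzero_and_logderiv:
  assumes s: "Re s > 1"
  shows "zeta s \<noteq> 0" and "(\<lambda>n. mangoldt n * of_nat n powr (- s)) sums (- (deriv zeta s / zeta s))"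
proof -
  define S where "S = {s :: complex. Re s > 1}"
  have S: "open S" "convex S"
    unfolding S_def by (rule open_halfspace_Re_gt, rule convex_halfspace_Re_gt)
  obtain z z' where z: "\<And>s. Re s > 1 \<Longrightarrow> (\<lambda>n. 1 * of_nat n powr (- s)) sums z s"
    and z': "\<And>s. Re s > 1 \<Longrightarrow> (\<lambda>n. - (of_real (ln (real n)) * 1 * of_nat n powr (- s))) sums z' s"
    and zd: "\<And>s. Re s > 1 \<Longrightarrow> (z has_field_derivative z' s) (at s)"
  proof -
    have "summable (\<lambda>n. norm (1 :: complex) * real n powr (- \<sigma>))" if "\<sigma> > 1" for \<sigma>
      using that by (simp add: summable_real_powr_iff)
    from dirichlet_series_has_derivative[of "\<lambda>_. 1", OF this] show thesis using that by blast
  qed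
  have z_eq: "z s = zeta s" if "Re s > 1" for s
    using z[OF that] zeta_sums(2)[OF that] by (simp add: sums_unique2)
  have zeta_deriv: "(zeta has_field_derivative z' s) (at s)" if "Re s > 1" for s
    using zd[OF that] S(1) by (rule has_field_derivative_transform_within_open) (use that z_eq in \<open>auto simp: S_def\<close>)
  obtain D D' where D: "\<And>s. Re s > 1 \<Longrightarrow> (\<lambda>n. mangoldt n * of_nat n powr (- s)) sums D s"
    and "\<And>s. Re s > 1 \<Longrightarrow> (\<lambda>n. - (of_real (ln (real n)) * mangoldt n * of_nat n powr (- s))) sums D' s"
    and Dd: "\<And>s. Re s > 1 \<Longrightarrow> (D has_field_derivative D' s) (at s)"
  proof -
    have "summable (\<lambda>n. norm (mangoldt n :: complex) * real n powr (- \<sigma>))" if "\<sigma> > 1" for \<sigma>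
      using that by (simp add: summable_mangoldt_powr)
    from dirichlet_series_has_derivative[of mangoldt, OF this] show thesis using that by blast
  qed
  \<comment> \<open>The Dirichlet convolution of \<open>mangoldt\<close> with the constant 1 is the
    logarithm (\<open>mangoldt_sum\<close>), whose series is minus the derivative of zeta.\<close>
  have prod: "D s * zeta s = - z' s" if s: "Re s > 1" for s
  proof -
    have "((\<lambda>n. \<Sum>d | d dvd n. mangoldt d * of_nat d powr (- s) * of_nat (n div d) powr (- s)) has_sum (D s * zeta s)) {1..}"
      using zeta_sums[OF s] D[OF s] summable_mangoldt_powr[OF s]
      by (intro has_sum_dirichlet_prod) (simp_all add: norm_mult norm_nat_powr)
    moreover have "(\<Sum>d | d dvd n. mangoldt d * of_nat d powr (- s) * of_nat (n div d) powr (- s))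
           = of_real (ln (real n)) * of_nat n powr (- s)" if "n \<in> {1..}" for n
    proof -
      have "(\<Sum>d | d dvd n. mangoldt d * of_nat d powr (- s) * of_nat (n div d) powr (- s))
          = (\<Sum>d | d dvd n. mangoldt d * of_nat n powr (- s))"
      proof (intro sum.cong refl)
        fix d assume "d \<in> {d. d dvd n}"
        then obtain e where e: "n = d * e" by auto
        hence de: "d > 0" "e > 0" using that by (auto intro!: Nat.gr0I)
        have "complex_of_nat n powr (- s) = of_nat d powr (- s) * of_nat e powr (- s)"
          using powr_times_real[of "of_nat d" "of_nat e" "- s"] by (simp add: e)
        thus "mangoldt d * of_nat d powr (- s) * of_nat (n div d) powr (- s) = mangoldt d * complex_of_nat n powr (- s)"
          using e de by simp
      qed
      also have "\<dots> = of_real (ln (real n)) * of_nat n powr (- s)"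
        using that by (simp add: sum_distrib_right [symmetric] mangoldt_sum)
      finally show ?thesis .
    qed
    ultimately have "((\<lambda>n. of_real (ln (real n)) * of_nat n powr (- s)) has_sum (D s * zeta s)) {1..}"
      by (rule has_sum_cong[THEN iffD1, rotated])
    moreover have "((\<lambda>n. of_real (ln (real n)) * of_nat n powr (- s)) has_sum (- z' s)) UNIV"
    proof (rule norm_summable_imp_has_sum)
      have "norm (of_real (ln (real n)) * complex_of_nat n powr (- s)) = ln (real n) * real n powr (- Re s)" for n
        by (cases "n = 0") (simp_all add: norm_mult norm_nat_powr)
      thus "summable (\<lambda>n. norm (of_real (ln (real n)) * complex_of_nat n powr (- s)))"
        using summable_ln_powr[OF s] by simp
      show "(\<lambda>n. of_real (ln (real n)) * of_nat n powr (- s)) sums (- z' s)"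
        using sums_minus[OF z'[OF s]] by simp
    qed
    hence "((\<lambda>n. of_real (ln (real n)) * of_nat n powr (- s)) has_sum (- z' s)) {1..}"
      by (rule has_sum_cong_neutral[THEN iffD1, rotated -1]) (auto simp: not_le less_Suc_eq)
    ultimately show ?thesis by (rule has_sum_unique)
  qed
  have "D holomorphic_on S"
    using Dd S by (auto simp: holomorphic_on_open S_def)
  then obtain P where P: "\<And>x. x \<in> S \<Longrightarrow> (P has_field_derivative D x) (at x within S)"
    using holomorphic_convex_primitive'[OF S(2) S(1)] by blast
  have "\<exists>c. \<forall>x\<in>S. zeta x * exp (P x) = c"
  proof (rule has_field_derivative_zero_constant[OF S(2)])
    fix x assume x: "x \<in> S"
    have "(zeta has_field_derivative z' x) (at x within S)"
      by (rule has_field_derivative_at_within, rule zeta_deriv) (use x in \<open>simp add: S_def\<close>)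
    from DERIV_mult[OF this DERIV_chain2[OF DERIV_exp P[OF x]]]
    have "((\<lambda>x. zeta x * exp (P x)) has_field_derivative z' x * exp (P x) + exp (P x) * D x * zeta x) (at x within S)" .
    also have "z' x * exp (P x) + exp (P x) * D x * zeta x = (z' x + D x * zeta x) * exp (P x)"
      by (simp add: algebra_simps)
    also have "\<dots> = 0" using prod[of x] x by (simp add: S_def)
    finally show "((\<lambda>x. zeta x * exp (P x)) has_field_derivative 0) (at x within S)" .
  qed
  then obtain C where C: "\<And>x. x \<in> S \<Longrightarrow> zeta x * exp (P x) = C" by blast
  \<comment> \<open>The constant is nonzero once zeta is nonzero at a single point; at 2 the series
    has nonnegative terms, one of them positive.\<close>
  have "zeta 2 \<noteq> 0"
  proof -
    have "(\<lambda>n. Re (complex_of_nat n powr (- 2))) sums Re (zeta 2)"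
      using zeta_sums(2)[of 2] by (intro sums_Re) simp
    moreover have "Re (complex_of_nat n powr (- 2)) = real n powr (- 2)" for n
      using powr_of_real[of "real n" "-2"] by simp
    ultimately have *: "(\<lambda>n. real n powr (- 2)) sums Re (zeta 2)" by simp
    have "0 < (\<Sum>n. real n powr (- 2))"
      using sums_summable[OF *] by (rule suminf_pos2[where i = 1]) auto
    thus ?thesis using sums_unique[OF *] by auto
  qed
  hence "C \<noteq> 0" using C[of 2] by (auto simp: S_def)
  thus nz: "zeta s \<noteq> 0" using C[of s] s by (auto simp: S_def)
  have "deriv zeta s = z' s" using zeta_deriv[OF s] by (rule DERIV_imp_deriv)
  hence "D s = - (deriv zeta s / zeta s)"
    using prod[OF s] nz by (simp add: field_simps)
  thus "(\<lambda>n. mangoldt n * of_nat n powr (- s)) sums (- (deriv zeta s / zeta s))"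
    using D[OF s] by simp
qed

section \<open>The termwise identities\<close>

lemma expint_bound:
  assumes "Re a \<ge> 0" "Re \<xi> > 1"
  shows "norm (expint a \<xi>) \<le> (LINT y|lborel. norm (indicator {1<..} y *\<^sub>R expow 0 (- of_real (Re \<xi>)) y))"
proof -
  have "norm (expint a \<xi>) \<le> (LINT y|lborel. norm (indicator {1<..} y *\<^sub>R expow a (- \<xi>) y))"
    unfolding expint_def by (rule integral_norm_bound)
  also have "\<dots> \<le> (LINT y|lborel. norm (indicator {1<..} y *\<^sub>R expow 0 (- of_real (Re \<xi>)) y))"
    using assms by (intro integral_mono integrable_norm integrable_expow) (auto simp: norm_expow indicator_def)
  finally show ?thesis .
qed

lemma continuous_expint_line:
  assumes "Re a \<ge> 0" "b + Re z > 1"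
  shows "continuous_on UNIV (\<lambda>t. expint a (z + Complex b t))"
  using assms
  by (intro continuous_on_compose2[OF holomorphic_on_imp_continuous_on[OF expint_holomorphic]]
        continuous_intros continuous_on_Complex_line) auto

lemma perron_kernel_mult_exp: "perron_kernel d l w * exp (- w * of_real x) = perron_kernel d (l - x) w"
proof -
  have "exp (w * of_real (l - x)) = exp (w * of_real l) * exp (- w * of_real x)"
    by (rule exp_eq_mult) (simp add: algebra_simps)
  thus ?thesis by (simp add: perron_kernel_def)
qed

text \<open>Exchanging the integrals moves y^(-w) into the kernel, whose parameter becomes l - ln y.
  The condition d + c > 1 makes y^(-d-c) an integrable majorant.\<close>

lemma vline_integral_perron_expint:
  assumes a: "Re a \<ge> 0" and c: "c > 0" and d: "d > 0" "d + c > 1"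
  shows "vline_integral c (\<lambda>w. perron_kernel d l w * expint a (of_real d + w))
       = (LINT y|lborel. indicator {1<..} y *\<^sub>R (expow a (- of_real d) y * vline_integral c (perron_kernel d (l - ln y))))"
proof -
  define f where "f t y = perron_kernel d l (Complex c t) * (indicator {1<..} y *\<^sub>R expow a (- (of_real d + Complex c t)) y)" for t y
  define C where "C = exp (c * l) / (min 1 \<bar>c\<bar> * min 1 \<bar>c + d\<bar>)"
  have [measurable]: "(\<lambda>t. perron_kernel d l (Complex c t)) \<in> borel_measurable borel"
    using c d by (intro borel_measurable_continuous_onI continuous_perron_kernel_line) auto
  have [measurable]: "Complex c \<in> borel_measurable borel"
    by (intro borel_measurable_continuous_onI continuous_on_Complex_line)
  have int: "integrable (lborel \<Otimes>\<^sub>M lborel) (case_prod f)"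
  proof (rule integrable_pair_bound)
    show "integrable lborel (\<lambda>t. C / (1 + t\<^sup>2))"
      by (rule integrable_const_over_1_plus_square)
    show "integrable lborel (\<lambda>y. norm (indicator {1<..} y *\<^sub>R expow a (- of_real (d + c)) y))"
      using a d by (intro integrable_norm integrable_expow) auto
    show "case_prod f \<in> borel_measurable (lborel \<Otimes>\<^sub>M lborel)"
      unfolding f_def expow_def by measurable
    show "norm (f t y) \<le> C / (1 + t\<^sup>2) * norm (indicator {1<..} y *\<^sub>R expow a (- of_real (d + c)) y)" for t y
      using norm_perron_kernel_le[of c d l t] c d unfolding f_def norm_mult
      by (intro mult_mono) (auto simp: norm_expow indicator_def C_def intro: order_trans[OF norm_ge_zero])
  qed
  have "(LINT t|lborel. perron_kernel d l (Complex c t) * expint a (of_real d + Complex c t)) = (LINT t|lborel. LINT y|lborel. f t y)"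
    unfolding f_def expint_def integral_mult_right_zero ..
  also have "\<dots> = (LINT y|lborel. LINT t|lborel. f t y)"
    by (rule lborel_pair.Fubini_integral[OF int, symmetric])
  also have "(\<lambda>y. LINT t|lborel. f t y) = (\<lambda>y. indicator {1<..} y *\<^sub>R (expow a (- of_real d) y * (LINT t|lborel. perron_kernel d (l - ln y) (Complex c t))))"
  proof
    fix y :: real
    have "f t y = (indicator {1<..} y *\<^sub>R expow a (- of_real d) y) * perron_kernel d (l - ln y) (Complex c t)" for t
    proof -
      have "expow a (- (of_real d + Complex c t)) y = expow a (- of_real d) y * exp (- Complex c t * of_real (ln y))"
        unfolding expow_def by (rule exp_eq_mult) (simp add: algebra_simps)
      thus ?thesis
        by (simp add: f_def perron_kernel_mult_exp [symmetric])
    qed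
    hence "(LINT t|lborel. f t y) = (LINT t|lborel. (indicator {1<..} y *\<^sub>R expow a (- of_real d) y) * perron_kernel d (l - ln y) (Complex c t))"
      by (simp only:)
    also have "\<dots> = (indicator {1<..} y *\<^sub>R expow a (- of_real d) y) * (LINT t|lborel. perron_kernel d (l - ln y) (Complex c t))"
      by (rule integral_mult_right_zero)
    finally show "(LINT t|lborel. f t y) = indicator {1<..} y *\<^sub>R (expow a (- of_real d) y * (LINT t|lborel. perron_kernel d (l - ln y) (Complex c t)))"
      by simp
  qed
  finally have eq: "(LINT t|lborel. perron_kernel d l (Complex c t) * expint a (of_real d + Complex c t))
      = (LINT y|lborel. indicator {1<..} y *\<^sub>R (expow a (- of_real d) y * (LINT t|lborel. perron_kernel d (l - ln y) (Complex c t))))" .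
  have "\<i> * (LINT y|lborel. indicator {1<..} y *\<^sub>R (expow a (- of_real d) y * (LINT t|lborel. perron_kernel d (l - ln y) (Complex c t))))
     = (LINT y|lborel. \<i> * (indicator {1<..} y *\<^sub>R (expow a (- of_real d) y * (LINT t|lborel. perron_kernel d (l - ln y) (Complex c t)))))"
    by (rule integral_mult_right_zero[symmetric])
  thus ?thesis unfolding vline_integral_def eq by (simp add: mult_ac)
qed

text \<open>The kernel cuts off at y = n with weight 1 - (y / n)^d, up to the factor 2 pi i / d. The
  power is kept as a product of exponentials so that its product with y^(-d) can be read
  off.\<close>

lemma vline_integral_perron_cutoff:
  assumes "c > 0" "d > 0" "n > 1" "y > 1"
  shows "vline_integral c (perron_kernel d (ln n - ln y))
       = indicator {1<..<n} y *\<^sub>R (2 * pi * \<i> * (1 - exp (- of_real d * of_real (ln n)) * exp (of_real d * of_real (ln y))) / d)"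
proof -
  have e: "complex_of_real (1 - exp (- d * (ln n - ln y))) = 1 - exp (- of_real d * of_real (ln n)) * exp (complex_of_real d * of_real (ln y))"
  proof -
    have "complex_of_real (exp (- d * (ln n - ln y))) = exp (of_real (- d * (ln n - ln y)))"
      by (rule exp_of_real [symmetric])
    also have "\<dots> = exp (- of_real d * of_real (ln n)) * exp (of_real d * of_real (ln y))"
      by (rule exp_eq_mult) (simp add: algebra_simps)
    finally show ?thesis by simp
  qed
  show ?thesis
  proof (cases "y < n")
    case True
    hence "vline_integral c (perron_kernel d (ln n - ln y)) = 2 * pi * \<i> * (complex_of_real (1 - exp (- d * (ln n - ln y))) / d)"
      using assms by (subst vline_integral_perron_kernel_nonneg) auto
    from this[unfolded e] show ?thesis
      using True assms by simp
  next
    case False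
    thus ?thesis using assms by (subst vline_integral_perron_kernel_nonpos) auto
  qed
qed

text \<open>
  One integration by parts in \<open>expint\<close> gains the factor \<open>1 / (w + d)\<close> that makes the Perron integral
  absolutely convergent.
\<close>

lemma exp_times_expint_over_eq:
  assumes a: "Re a \<ge> 0" and w: "Re w > 0 \<and> d + Re w > 1" and d: "d > 0"
  shows "exp (w * of_real l) * (expint a (1 + of_real d + w) / w)
      = exp (- a) * perron_kernel d l w - a * (perron_kernel d l w * expint a (of_real d + w))"
proof -
  have nz: "w \<noteq> 0" "w + of_real d \<noteq> 0" using w d by (auto simp: complex_eq_iff)
  \<comment> \<open>On the boundary Re a = 0 the recurrence needs Re (1 + d + w) > 2; this is the
    role of d + Re w > 1.\<close>
  have "(1 - (1 + of_real d + w)) * expint a (1 + of_real d + w) = a * expint a (1 + of_real d + w - 1) - exp (- a)"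
    using w a by (intro expint_rec) auto
  hence "(w + of_real d) * expint a (1 + of_real d + w) = exp (- a) - a * expint a (of_real d + w)"
    by (simp add: algebra_simps)
  hence "expint a (1 + of_real d + w) = (exp (- a) - a * expint a (of_real d + w)) / (w + of_real d)"
    using nz by (simp add: field_simps)
  hence eq: "expint a (1 + of_real d + w) / w = (exp (- a) - a * expint a (of_real d + w)) / (w * (w + of_real d))"
    by simp
  have "x * ((e - a * X) / D) = e * (x / D) - a * (x / D * X)" for x e X D :: complex
    by (simp add: diff_divide_distrib right_diff_distrib mult_ac)
  thus ?thesis unfolding eq perron_kernel_def .
qed

lemma vline_integrable_perron_expint:
  assumes a: "Re a \<ge> 0" and c: "c > 0" and d: "d > 0" "d + c > 1"
  shows "vline_integrable c (\<lambda>w. perron_kernel d l w * expint a (of_real d + w))"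
proof -
  have int1: "integrable lborel (\<lambda>t. perron_kernel d l (Complex c t))"
    using vline_integrable_perron_kernel[of c d l] c d by (simp add: vline_integrable_def)
  show ?thesis
    unfolding vline_integrable_def
  proof (rule Bochner_Integration.integrable_bound)
    define B where "B = (LINT y|lborel. norm (indicator {1<..} y *\<^sub>R expow 0 (- of_real (d + c)) y))"
    show "integrable lborel (\<lambda>t. B * norm (perron_kernel d l (Complex c t)))"
      using int1 by (intro integrable_mult_right integrable_norm)
    have "(\<lambda>t. perron_kernel d l (Complex c t) * expint a (of_real d + Complex c t)) \<in> borel_measurable borel"
      using c d a
      by (intro borel_measurable_continuous_onI continuous_on_mult continuous_perron_kernel_line continuous_expint_line) auto
    thus "(\<lambda>t. perron_kernel d l (Complex c t) * expint a (of_real d + Complex c t)) \<in> borel_measurable lborel"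
      by simp
    show "AE t in lborel. norm (perron_kernel d l (Complex c t) * expint a (of_real d + Complex c t)) \<le> norm (B * norm (perron_kernel d l (Complex c t)))"
    proof (rule AE_I2)
      fix t :: real
      have "norm (expint a (of_real d + Complex c t)) \<le> B"
        using expint_bound[of a "of_real d + Complex c t"] a d by (simp add: B_def)
      hence "norm (perron_kernel d l (Complex c t)) * norm (expint a (of_real d + Complex c t)) \<le> norm (perron_kernel d l (Complex c t)) * B"
        by (rule mult_left_mono) simp
      also have "\<dots> \<le> norm (B * norm (perron_kernel d l (Complex c t)))"
        by (simp add: abs_mult mult.commute mult_right_mono)
      finally show "norm (perron_kernel d l (Complex c t) * expint a (of_real d + Complex c t)) \<le> norm (B * norm (perron_kernel d l (Complex c t)))"
        by (simp add: norm_mult)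
    qed
  qed
qed

text \<open>The integration by parts that secured convergence is reversed here. Up to 2 pi i, the
  two Perron integrals give (1 - n^(-d)) / d and the integral of a weight F; integrating F' over (1,
  n) recombines them into the sharply cut off integral.\<close>

lemma vline_integral_expint_term:
  assumes a: "Re a \<ge> 0" and c: "c > 0" and d: "d > 0" "d + c > 1" and n: "n > 1"
  shows "vline_integral c (\<lambda>w. exp (w * of_real (ln n)) * (expint a (1 + of_real d + w) / w))
       = 2 * pi * \<i> * (LINT y|lborel. indicator {1<..<n} y *\<^sub>R expow a (- (1 + of_real d)) y)"
proof -
  define m where "m = exp (- of_real d * complex_of_real (ln n))"
  \<comment> \<open>F(y) = e^(-ay) (y^(-d) - n^(-d)) / d is the integrand under the smoothed cutoff.
    It vanishes at y = n, so only y = 1 contributes a boundary term.\<close>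
  define F where "F y = (expow a (- of_real d) y - m * expow a 0 y) / d" for y
  define J where "J = (LINT y|lborel. indicator {1<..<n} y *\<^sub>R expow a (- (1 + of_real d)) y)"
  have d0: "complex_of_real d \<noteq> 0" using d by simp
  have cont: "continuous_on {1..n} (expow a z)" for z
    by (intro continuous_at_imp_continuous_on ballI isCont_expow) auto
  have int: "integrable lborel (\<lambda>y. indicator {1<..<n} y *\<^sub>R g y)" if "continuous_on {1..n} g" for g :: "real \<Rightarrow> complex"
    by (rule set_integrable_subset[OF borel_integrable_atLeastAtMost'[OF that], unfolded set_integrable_def]) auto
  have contF: "continuous_on {1..n} F"
    unfolding F_def using d0 by (intro continuous_intros cont) auto
  have F_deriv: "(F has_vector_derivative - expow a (- (1 + of_real d)) y - a * F y) (at y)" if "y > 0" for y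
  proof -
    have "(F has_vector_derivative ((- of_real d * expow a (- of_real d - 1) y - a * expow a (- of_real d) y)
              - m * (0 * expow a (0 - 1) y - a * expow a 0 y)) / d) (at y)"
      unfolding F_def divide_inverse
      by (intro has_vector_derivative_mult_left has_vector_derivative_diff has_vector_derivative_mult_right has_vector_derivative_expow that)
    also have "((- of_real d * expow a (- of_real d - 1) y - a * expow a (- of_real d) y)
              - m * (0 * expow a (0 - 1) y - a * expow a 0 y)) / d = - expow a (- (1 + of_real d)) y - a * F y"
    proof -
      have e: "- complex_of_real d - 1 = - (1 + of_real d)" by simp
      show ?thesis unfolding e F_def using d0 by (simp add: field_simps)
    qed
    finally show ?thesis .
  qed
  have F1: "F 1 = exp (- a) * (1 - m) / d"
    by (simp add: F_def expow_def field_simps)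
  have Fn: "F n = 0"
  proof -
    have "expow a (- of_real d) n = m * expow a 0 n"
      unfolding expow_def m_def by (rule exp_eq_mult) simp
    thus ?thesis by (simp add: F_def)
  qed
  have "(LINT y|lborel. indicator {1<..<n} y *\<^sub>R (- expow a (- (1 + of_real d)) y - a * F y)) = F n - F 1"
  proof (rule integral_FTC_greaterThanLessThan[where F = F])
    show "(F has_vector_derivative - expow a (- (1 + of_real d)) y - a * F y) (at y)" if "1 < y" for y
      using that by (intro F_deriv) auto
    have isF: "isCont F y" if "y > 0" for y
      using has_vector_derivative_continuous[OF F_deriv[OF that]] .
    show "isCont (\<lambda>y. - expow a (- (1 + of_real d)) y - a * F y) y" if "1 < y" for y
      using that by (intro continuous_intros isCont_expow isF) auto
    show "integrable lborel (\<lambda>y. indicator {1<..<n} y *\<^sub>R (- expow a (- (1 + of_real d)) y - a * F y))"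
      by (intro int continuous_intros cont contF)
    have "(F \<longlongrightarrow> F y) (at y)" if "y > 0" for y
      using isF[OF that] by (simp add: isCont_def)
    thus "(F \<longlongrightarrow> F 1) (at_right 1)" "(F \<longlongrightarrow> F n) (at_left n)"
      using n by (auto simp: filterlim_at_split)
  qed (use n in auto)
  also have "(LINT y|lborel. indicator {1<..<n} y *\<^sub>R (- expow a (- (1 + of_real d)) y - a * F y))
      = (LINT y|lborel. - (indicator {1<..<n} y *\<^sub>R expow a (- (1 + of_real d)) y) - a * (indicator {1<..<n} y *\<^sub>R F y))"
    by (intro Bochner_Integration.integral_cong refl) (simp add: scaleR_diff_right)
  also have "\<dots> = - J - a * (LINT y|lborel. indicator {1<..<n} y *\<^sub>R F y)"
    unfolding J_def
    by (subst Bochner_Integration.integral_diff)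
       (auto simp only: integral_mult_right_zero integral_minus intro!: integrable_mult_right Bochner_Integration.integrable_minus int cont contF)
  finally have parts: "exp (- a) * (1 - m) / d - a * (LINT y|lborel. indicator {1<..<n} y *\<^sub>R F y) = J"
    by (simp add: Fn F1 algebra_simps)

  have second: "vline_integral c (\<lambda>w. perron_kernel d (ln n) w * expint a (of_real d + w)) = 2 * pi * \<i> * (LINT y|lborel. indicator {1<..<n} y *\<^sub>R F y)"
  proof -
    have "vline_integral c (\<lambda>w. perron_kernel d (ln n) w * expint a (of_real d + w))
        = (LINT y|lborel. indicator {1<..} y *\<^sub>R (expow a (- of_real d) y * vline_integral c (perron_kernel d (ln n - ln y))))"
      by (rule vline_integral_perron_expint[OF a c d])
    also have "\<dots> = (LINT y|lborel. 2 * pi * \<i> * (indicator {1<..<n} y *\<^sub>R F y))"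
    proof (intro Bochner_Integration.integral_cong refl)
      fix y :: real
      have "expow a (- of_real d) y * exp (of_real d * of_real (ln y)) = expow a 0 y"
        unfolding expow_def by (rule exp_eq_mult[symmetric]) simp
      hence F': "expow a (- of_real d) y * (1 - m * exp (of_real d * of_real (ln y))) / d = F y"
        by (simp add: F_def algebra_simps)
      show "indicator {1<..} y *\<^sub>R (expow a (- of_real d) y * vline_integral c (perron_kernel d (ln n - ln y)))
          = 2 * pi * \<i> * (indicator {1<..<n} y *\<^sub>R F y)"
      proof (cases "y > 1")
        case True
        have "expow a (- of_real d) y * vline_integral c (perron_kernel d (ln n - ln y))
            = indicator {1<..<n} y *\<^sub>R (2 * pi * \<i> * (expow a (- of_real d) y * (1 - m * exp (of_real d * of_real (ln y))) / d))"
          unfolding vline_integral_perron_cutoff[OF c d(1) n True, folded m_def] by simp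
        thus ?thesis
          unfolding F' using True by simp
      qed auto
    qed
    finally show ?thesis unfolding integral_mult_right_zero .
  qed
  have first: "vline_integral c (perron_kernel d (ln n)) = 2 * pi * \<i> * ((1 - m) / d)"
    using c d n exp_of_real[of "- d * ln n", where ?'a = complex]
    by (subst vline_integral_perron_kernel_nonneg) (auto simp: m_def)
  note split = exp_times_expint_over_eq[OF a _ d(1), where l = "ln n"]
  have int1: "integrable lborel (\<lambda>t. perron_kernel d (ln n) (Complex c t))"
    using vline_integrable_perron_kernel[of c d "ln n"] c d by (simp add: vline_integrable_def)
  have int2: "integrable lborel (\<lambda>t. perron_kernel d (ln n) (Complex c t) * expint a (of_real d + Complex c t))"
    using vline_integrable_perron_expint[OF a c d] by (simp add: vline_integrable_def)
  have "vline_integral c (\<lambda>w. exp (w * of_real (ln n)) * (expint a (1 + of_real d + w) / w))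
     = \<i> * (LINT t|lborel. exp (- a) * perron_kernel d (ln n) (Complex c t) - a * (perron_kernel d (ln n) (Complex c t) * expint a (of_real d + Complex c t)))"
    unfolding vline_integral_def using c d by (subst split) auto
  also have "(LINT t|lborel. exp (- a) * perron_kernel d (ln n) (Complex c t) - a * (perron_kernel d (ln n) (Complex c t) * expint a (of_real d + Complex c t)))
    = exp (- a) * (LINT t|lborel. perron_kernel d (ln n) (Complex c t)) - a * (LINT t|lborel. perron_kernel d (ln n) (Complex c t) * expint a (of_real d + Complex c t))"
    using int1 int2
    by (subst Bochner_Integration.integral_diff) (simp_all only: integral_mult_right_zero integrable_mult_right)
  also have "\<i> * \<dots> = exp (- a) * vline_integral c (perron_kernel d (ln n)) - a * vline_integral c (\<lambda>w. perron_kernel d (ln n) w * expint a (of_real d + w))"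
    unfolding vline_integral_def by (simp add: algebra_simps)
  also have "\<dots> = 2 * pi * \<i> * (exp (- a) * (1 - m) / d - a * (LINT y|lborel. indicator {1<..<n} y *\<^sub>R F y))"
    unfolding first second by (simp add: algebra_simps)
  also have "\<dots> = 2 * pi * \<i> * J" unfolding parts ..
  finally show ?thesis unfolding J_def .
qed

text \<open>The tail over y > n under y = n (1 + v), which brings it to the integral that
  \<open>integral_gamma_over_linear\<close> produces at r = q n.\<close>

lemma expint_cutoff:
  assumes q: "q > 0" and d: "d > 0" and n: "n \<ge> 1"
  shows "expint (\<i> * of_real q) (1 + of_real d) - (LINT y|lborel. indicator {1<..<n} y *\<^sub>R expow (\<i> * of_real q) (- (1 + of_real d)) y)
       = exp (- of_real d * of_real (ln n)) * exp (- \<i> * of_real (q * n))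
         * (LINT v|lborel. indicator {0<..} v *\<^sub>R exp (- (1 + of_real d) * of_real (ln (1 + v)) - \<i> * of_real (q * n) * v))"
proof -
  define g where "g y = expow (\<i> * of_real q) (- (1 + of_real d)) y" for y
  have int: "integrable lborel (\<lambda>y. indicator {1<..} y *\<^sub>R g y)"
    unfolding g_def using d by (intro integrable_expow) auto
  have int1: "integrable lborel (\<lambda>y. indicator A y *\<^sub>R g y)" if "A \<subseteq> {1<..}" "A \<in> sets borel" for A
  proof -
    have "integrable lborel (\<lambda>y. indicator A y *\<^sub>R (indicator {1<..} y *\<^sub>R g y))"
      by (rule integrable_mult_indicator[OF _ int]) (use that in simp)
    also have "(\<lambda>y. indicator A y *\<^sub>R (indicator {1<..} y *\<^sub>R g y)) = (\<lambda>y. indicator A y *\<^sub>R g y)"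
      using that by (force simp: indicator_def)
    finally show ?thesis .
  qed
  have "AE y in lborel. indicator {1<..} y *\<^sub>R g y = indicator {1<..<n} y *\<^sub>R g y + indicator {n<..} y *\<^sub>R g y"
    using AE_lborel_singleton[of n] by eventually_elim (use n in \<open>auto simp: indicator_def\<close>)
  hence "(LINT y|lborel. indicator {1<..} y *\<^sub>R g y) = (LINT y|lborel. indicator {1<..<n} y *\<^sub>R g y + indicator {n<..} y *\<^sub>R g y)"
    by (intro integral_cong_AE) (auto simp: g_def)
  also have "\<dots> = (LINT y|lborel. indicator {1<..<n} y *\<^sub>R g y) + (LINT y|lborel. indicator {n<..} y *\<^sub>R g y)"
    using n by (intro Bochner_Integration.integral_add int1) auto
  also have "(LINT y|lborel. indicator {n<..} y *\<^sub>R g y) = n *\<^sub>R (LINT v|lborel. indicator {n<..} (n + n * v) *\<^sub>R g (n + n * v))"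
    using n lborel_integral_real_affine[of n "\<lambda>y. indicator {n<..} y *\<^sub>R g y" n] by simp
  also have "(LINT v|lborel. indicator {n<..} (n + n * v) *\<^sub>R g (n + n * v))
     = (LINT v|lborel. (exp (- (1 + of_real d) * of_real (ln n)) * exp (- \<i> * of_real (q * n))) * (indicator {0<..} v *\<^sub>R exp (- (1 + of_real d) * of_real (ln (1 + v)) - \<i> * of_real (q * n) * v)))"
  proof (intro Bochner_Integration.integral_cong refl)
    fix v :: real
    show "indicator {n<..} (n + n * v) *\<^sub>R g (n + n * v) = (exp (- (1 + of_real d) * of_real (ln n)) * exp (- \<i> * of_real (q * n))) * (indicator {0<..} v *\<^sub>R exp (- (1 + of_real d) * of_real (ln (1 + v)) - \<i> * of_real (q * n) * v))"
    proof (cases "v > 0")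
      case True
      have "ln (n + n * v) = ln n + ln (1 + v)"
        using n True ln_mult[of n "1 + v"] by (simp add: algebra_simps)
      hence "g (n + n * v) = exp (- (1 + of_real d) * of_real (ln n)) * exp (- \<i> * of_real (q * n)) * exp (- (1 + of_real d) * of_real (ln (1 + v)) - \<i> * of_real (q * n) * v)"
        unfolding g_def expow_def exp_add [symmetric] by (intro arg_cong[of _ _ exp]) (simp add: algebra_simps)
      thus ?thesis using True n by simp
    qed (use n in \<open>auto simp: zero_less_mult_iff\<close>)
  qed
  \<comment> \<open>The Jacobian n turns n^(-1-d) into n^(-d).\<close>
  also have "n *\<^sub>R \<dots> = exp (- of_real d * of_real (ln n)) * exp (- \<i> * of_real (q * n))
         * (LINT v|lborel. indicator {0<..} v *\<^sub>R exp (- (1 + of_real d) * of_real (ln (1 + v)) - \<i> * of_real (q * n) * v))"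
  proof -
    have "exp (- of_real d * of_real (ln n)) = exp (of_real (ln n)) * exp (- (1 + complex_of_real d) * of_real (ln n))"
      by (rule exp_eq_mult) (simp add: algebra_simps)
    hence "exp (- of_real d * of_real (ln n)) = of_real n * exp (- (1 + complex_of_real d) * of_real (ln n))"
      using n by (simp add: exp_of_real)
    thus ?thesis unfolding integral_mult_right_zero by (simp add: scaleR_conv_of_real mult_ac)
  qed
  finally show ?thesis by (simp add: expint_def g_def)
qed

section \<open>Termwise integration of Dirichlet series\<close>

lemma vline_cong:
  assumes "\<And>s. Re s = c \<Longrightarrow> f s = g s"
  shows "vline_integrable c f \<longleftrightarrow> vline_integrable c g" and "vline_integral c f = vline_integral c g"
  by (simp_all add: vline_integrable_def vline_integral_def assms)

text \<open>A Weierstrass bound on the terms, uniform along the line, combined with a fixed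
  integrable factor \<open>R\<close> that carries the decay. It serves both sides of the
  theorem.\<close>

lemma
  fixes u :: "nat \<Rightarrow> complex \<Rightarrow> complex"
  assumes R: "vline_integrable c R" and cont: "\<And>n. continuous_on UNIV (\<lambda>t. u n (Complex c t))"
    and le: "\<And>n s. Re s = c \<Longrightarrow> norm (u n s) \<le> M n" and M: "summable M"
  shows vline_integrable_suminf: "vline_integrable c (\<lambda>s. (\<Sum>n. u n s) * R s)"
    and vline_integral_sums: "(\<lambda>n. vline_integral c (\<lambda>s. u n s * R s)) sums vline_integral c (\<lambda>s. (\<Sum>n. u n s) * R s)"
proof -
  define f where "f n t = u n (Complex c t) * R (Complex c t)" for n t
  have R': "integrable lborel (\<lambda>t. R (Complex c t))"
    using R by (simp add: vline_integrable_def)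
  have le': "norm (f n t) \<le> M n * norm (R (Complex c t))" for n t
    unfolding f_def norm_mult by (intro mult_right_mono le) auto
  have [measurable]: "(\<lambda>t. R (Complex c t)) \<in> borel_measurable borel"
    using R' borel_measurable_integrable by fastforce
  have [measurable]: "(\<lambda>t. u n (Complex c t)) \<in> borel_measurable borel" for n
    by (intro borel_measurable_continuous_onI cont)
  have int: "integrable lborel (f n)" for n
  proof (rule Bochner_Integration.integrable_bound)
    show "integrable lborel (\<lambda>t. M n * norm (R (Complex c t)))"
      using R' by (intro integrable_mult_right integrable_norm)
    show "AE t in lborel. norm (f n t) \<le> norm (M n * norm (R (Complex c t)))"
      using le' by (intro AE_I2) (metis abs_ge_self order_trans real_norm_def)
  qed (simp add: f_def[abs_def])
  have summ_u: "summable (\<lambda>n. norm (u n s))" if "Re s = c" for s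
    using M le[OF that] by (intro summable_comparison_test'[OF M, where N = 0]) auto
  have summ: "AE t in lborel. summable (\<lambda>n. norm (f n t))"
    unfolding f_def norm_mult by (intro AE_I2 summable_mult2 summ_u) simp
  have summ': "summable (\<lambda>n. LINT t|lborel. norm (f n t))"
  proof (rule summable_comparison_test'[where N = 0])
    show "summable (\<lambda>n. M n * (LINT t|lborel. norm (R (Complex c t))))"
      using M by (rule summable_mult2)
    fix n :: nat assume "n \<ge> 0"
    have "(LINT t|lborel. norm (f n t)) \<le> (LINT t|lborel. M n * norm (R (Complex c t)))"
      by (intro integral_mono le' integrable_norm int integrable_mult_right R')
    thus "norm (LINT t|lborel. norm (f n t)) \<le> M n * (LINT t|lborel. norm (R (Complex c t)))"
      by (simp add: integral_nonneg_AE)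
  qed
  have suminf: "(\<Sum>n. f n t) = (\<Sum>n. u n (Complex c t)) * R (Complex c t)" for t
    unfolding f_def by (rule suminf_mult2[symmetric], rule summable_norm_cancel, rule summ_u) simp
  show "vline_integrable c (\<lambda>s. (\<Sum>n. u n s) * R s)"
    unfolding vline_integrable_def using integrable_suminf[OF int summ summ'] unfolding suminf .
  show "(\<lambda>n. vline_integral c (\<lambda>s. u n s * R s)) sums vline_integral c (\<lambda>s. (\<Sum>n. u n s) * R s)"
    unfolding vline_integral_def
    using sums_mult[OF sums_integral[OF int summ summ'], of \<i>] unfolding suminf unfolding f_def .
qed

text \<open>Along a vertical line the bound is constant, namely Gamma (Re z) in integral form; the
  decay is left to the reflection kernel.\<close>

lemma norm_Gamma_le:
  assumes "Re z > 0"
  shows "norm (Gamma z) \<le> (LINT x|lborel. norm (gamma_integrand 1 (of_real (Re z)) x))"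
proof -
  have "norm (Gamma z) \<le> (LINT x|lborel. norm (gamma_integrand 1 z x))"
    unfolding integral_gamma_integrand_1[OF assms, symmetric] by (rule integral_norm_bound)
  thus ?thesis by (simp add: norm_gamma_integrand)
qed

lemma vline_integrable_refl_kernel_Gamma:
  assumes c: "0 < c" "c < 1" and d: "d > 0"
  shows "vline_integrable c (\<lambda>s. refl_kernel r s * Gamma (s + of_real d))"
proof -
  from c have c': "0 < \<bar>c\<bar>" "\<bar>c\<bar> < 1" by auto
  define B where "B = (LINT x|lborel. norm (gamma_integrand 1 (of_real (c + d)) x))"
  obtain C where C: "\<And>t. norm (refl_kernel r (Complex c t)) \<le> C / (1 + t\<^sup>2)"
    using refl_kernel_bound_vertical[OF c'] by blast
  show ?thesis
    unfolding vline_integrable_def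
  proof (rule integrable_bound_1_plus_square)
    have "Complex c t + of_real d \<notin> \<int>\<^sub>\<le>\<^sub>0" for t
      using c d by (auto elim!: nonpos_Ints_cases simp: complex_eq_iff)
    thus "(\<lambda>t. refl_kernel r (Complex c t) * Gamma (Complex c t + of_real d)) \<in> borel_measurable borel"
      by (intro borel_measurable_continuous_onI continuous_intros continuous_refl_kernel_line c' continuous_on_Complex_line
            continuous_on_compose2[OF continuous_on_Gamma[of "- \<int>\<^sub>\<le>\<^sub>0"]]) auto
    fix t :: real
    have "norm (Gamma (Complex c t + of_real d)) \<le> B"
      using norm_Gamma_le[of "Complex c t + of_real d"] c d by (simp add: B_def)
    hence "norm (refl_kernel r (Complex c t)) * norm (Gamma (Complex c t + of_real d)) \<le> (C / (1 + t\<^sup>2)) * B"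
      using C by (intro mult_mono) (auto intro: order_trans[OF norm_ge_zero])
    thus "norm (refl_kernel r (Complex c t) * Gamma (Complex c t + of_real d)) \<le> C * B / (1 + t\<^sup>2)"
      by (simp add: norm_mult)
  qed
qed

lemma of_nat_powr_eq_exp: "n > 0 \<Longrightarrow> of_nat n powr z = exp (z * of_real (ln (real n)))" for z :: complex
  by (simp add: powr_def Ln_of_nat)

lemma continuous_of_nat_powr_line: "continuous_on UNIV (\<lambda>t. complex_of_nat n powr (z + Complex c t))"
proof (cases "n = 0")
  case False
  thus ?thesis
    by (simp add: of_nat_powr_eq_exp) (intro continuous_intros continuous_on_Complex_line)
qed simp

lemma refl_kernel_eq_powr:
  "q > 0 \<Longrightarrow> refl_kernel q s = Gamma s * Gamma (1 - s) * (of_real q powr (- s) * exp (- pi * \<i> * s / 2))"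
  unfolding refl_kernel_def by (simp add: powr_def Ln_of_real exp_add [symmetric] algebra_simps)

theorem theorem1p2:
  fixes c \<delta> \<kappa> c' p :: real
  assumes "0 < c" and "c < 1" and "\<delta> > 0" and "c + \<delta> + \<kappa> > 1"
    and "c' > 0" and "\<kappa> - c' > 1" and "\<delta> + c' > 1" and "0 < p" and "p < 1"
  defines "F \<equiv> (\<lambda>s::complex.
      (\<Sum>\<^sub>\<infinity>n\<in>{2::nat..}. mangoldt n * exp (- 2 * pi * \<i> * p * of_nat n)
                           / of_nat n powr (s + \<delta> + \<kappa>))
      * Gamma s * Gamma (s + \<delta>) * Gamma (1 - s)
      * of_real (2 * p * pi) powr (- s) * exp (- pi * \<i> * s / 2))"
    and "G \<equiv> (\<lambda>w::complex.
      - (deriv zeta (\<kappa> - w) / zeta (\<kappa> - w)) * bracket p (1 + \<delta> + w) / w)"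
  shows "vline_integrable c F \<and> vline_integrable c' G \<and>
    1 / (2 * pi * \<i>) * vline_integral c F
      = Gamma (1 + \<delta>) * (- (deriv zeta \<kappa> / zeta \<kappa>)) * bracket p (1 + \<delta>)
        - Gamma (1 + \<delta>) / (2 * pi * \<i>) * vline_integral c' G"
proof -
  define q where "q = 2 * pi * p"
  define a where "a = \<i> * complex_of_real q"
  \<comment> \<open>\<open>E\<close> is the integral over y > 1 and \<open>J n\<close> its part over
    1 < y < n, so \<open>E - J n\<close> is the tail beyond n of which both sides consist.\<close>
  define E where "E = expint a (1 + of_real \<delta>)"
  define J where "J n = (LINT y|lborel. indicator {1<..<real n} y *\<^sub>R expow a (- (1 + of_real \<delta>)) y)" for n
  define Z where "Z n = mangoldt n * complex_of_nat n powr (- of_real \<kappa>)" for n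
  have q: "q > 0" using assms by (simp add: q_def)
  have Re_a: "Re a = 0" by (simp add: a_def)
  have bracket: "bracket p \<xi> = expint a \<xi>" if "Re \<xi> > 1" for \<xi>
    using bracket_eq_expint[of p \<xi>] that assms by (simp add: a_def q_def)

  \<comment> \<open>Left side. On Re s = c the modulus of the n-th term is independent of Im s,
    while \<open>R\<close> holds the Gamma factors and the exponentials.\<close>
  define u where "u n s = mangoldt n * exp (- 2 * pi * \<i> * p * of_nat n) / of_nat n powr (s + \<delta> + \<kappa>)" for n and s :: complex
  define R where "R s = refl_kernel q s * Gamma (s + of_real \<delta>)" for s
  have R: "vline_integrable c R"
    unfolding R_def using assms by (intro vline_integrable_refl_kernel_Gamma) auto
  have norm_u: "norm (u n s) = mangoldt n * real n powr (- (c + \<delta> + \<kappa>))" if "Re s = c" for n s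
    unfolding powr_minus_divide using that by (simp add: u_def norm_mult norm_divide norm_exp_eq_Re norm_nat_powr)
  have summ_u: "summable (\<lambda>n. mangoldt n * real n powr (- (c + \<delta> + \<kappa>)))"
    using assms by (intro summable_mangoldt_powr) auto
  have u_cont: "continuous_on UNIV (\<lambda>t. u n (Complex c t))" for n
  proof (cases "n = 0")
    case False
    thus ?thesis
      unfolding u_def using continuous_of_nat_powr_line[of n "of_real (\<delta> + \<kappa>)" c]
      by (intro continuous_intros) (simp_all add: algebra_simps)
  qed (simp add: u_def)
  have F_eq: "F s = (\<Sum>n. u n s) * R s" if "Re s = c" for s
  proof -
    have summ: "summable (\<lambda>n. norm (u n s))" using summ_u by (simp add: norm_u[OF that])
    have "((\<lambda>n. u n s) has_sum (\<Sum>n. u n s)) UNIV"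
      by (rule norm_summable_imp_has_sum[OF summ summable_sums[OF summable_norm_cancel[OF summ]]])
    \<comment> \<open>The statement has an unordered sum over n >= 2; it agrees with the full series
      since \<open>mangoldt\<close> vanishes at 0 and 1.\<close>
    hence "((\<lambda>n. u n s) has_sum (\<Sum>n. u n s)) {2..}"
      by (rule has_sum_cong_neutral[THEN iffD1, rotated -1])
         (auto simp: u_def not_le less_Suc_eq numeral_2_eq_2)
    hence "infsum (\<lambda>n. u n s) {2..} = (\<Sum>n. u n s)" by (rule infsumI)
    thus ?thesis
      unfolding F_def R_def refl_kernel_eq_powr[OF q] u_def [symmetric]
      by (simp add: q_def mult_ac)
  qed
  have F_int: "vline_integrable c F"
    using vline_integrable_suminf[OF R u_cont eq_refl[OF norm_u] summ_u] vline_cong(1)[OF F_eq] by simp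
  have u_term: "vline_integral c (\<lambda>s. u n s * R s) = 2 * pi * \<i> * Gamma (of_real (1 + \<delta>)) * (Z n * (E - J n))" for n
  proof (cases "n \<ge> 2")
    case False
    hence "mangoldt n = (0 :: complex)" by (auto simp: not_le less_Suc_eq numeral_2_eq_2)
    thus ?thesis by (simp add: u_def Z_def vline_integral_def)
  next
    case n: True
    define V where "V = (LINT v|lborel. indicator {0<..} v *\<^sub>R exp (- (1 + of_real \<delta>) * of_real (ln (1 + v)) - \<i> * of_real (q * n) * v))"
    define A where "A = mangoldt n * exp (- \<i> * of_real (q * n)) * exp (- of_real (\<delta> + \<kappa>) * of_real (ln n))"
    \<comment> \<open>The factor n^(-s) turns the kernel parameter from q into q n; what is left of
      the term is the constant \<open>A\<close>.\<close>
    have "u n s * R s = A * (refl_kernel (q * n) s * Gamma (s + of_real \<delta>))" for s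
    proof -
      have "refl_kernel q s * exp (s * of_real (ln (1 / n))) = refl_kernel (q / (1 / n)) s"
        using n q by (intro refl_kernel_scale) auto
      hence "refl_kernel (q * n) s = refl_kernel q s * exp (- s * of_real (ln n))"
        using n by (simp add: ln_div)
      moreover have "1 / of_nat n powr (s + \<delta> + \<kappa>) = exp (- of_real (\<delta> + \<kappa>) * of_real (ln n)) * exp (- s * of_real (ln n))"
      proof -
        have "1 / of_nat n powr (s + \<delta> + \<kappa>) = exp (- ((s + \<delta> + \<kappa>) * of_real (ln n)))"
          using n by (simp add: of_nat_powr_eq_exp exp_minus inverse_eq_divide)
        also have "\<dots> = exp (- of_real (\<delta> + \<kappa>) * of_real (ln n)) * exp (- s * of_real (ln n))"
          by (rule exp_eq_mult) (simp add: algebra_simps)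
        finally show ?thesis .
      qed
      moreover have "u n s = mangoldt n * exp (- \<i> * of_real (q * n)) * (1 / of_nat n powr (s + \<delta> + \<kappa>))"
        by (simp add: u_def q_def mult_ac)
      ultimately show ?thesis by (simp add: R_def A_def mult_ac)
    qed
    hence "vline_integral c (\<lambda>s. u n s * R s) = A * vline_integral c (\<lambda>s. refl_kernel (q * n) s * Gamma (s + of_real \<delta>))"
      by (simp add: vline_integral_def)
    also have "vline_integral c (\<lambda>s. refl_kernel (q * n) s * Gamma (s + of_real \<delta>)) = 2 * pi * \<i> * (Gamma (of_real (1 + \<delta>)) * V)"
    proof -
      have qn: "q * n > 0" using q n by simp
      show ?thesis
        unfolding V_def vline_integral_refl_kernel_Gamma[OF assms(1,2) qn assms(3)]
          integral_gamma_over_linear[OF assms(3) qn] ..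
    qed
    also have "A * (2 * pi * \<i> * (Gamma (of_real (1 + \<delta>)) * V)) = 2 * pi * \<i> * Gamma (of_real (1 + \<delta>)) * (A * V)"
      by (simp add: mult_ac)
    also have "A * V = Z n * (E - J n)"
    proof -
      have "E - J n = exp (- of_real \<delta> * of_real (ln n)) * exp (- \<i> * of_real (q * n)) * V"
        unfolding E_def J_def V_def a_def using assms q n by (intro expint_cutoff) auto
      moreover have "exp (- of_real (\<delta> + \<kappa>) * complex_of_real (ln n)) = exp (- of_real \<kappa> * of_real (ln n)) * exp (- of_real \<delta> * of_real (ln n))"
        by (rule exp_eq_mult) (simp add: algebra_simps)
      ultimately show ?thesis
        using n by (simp add: A_def Z_def of_nat_powr_eq_exp mult_ac)
    qed
    finally show ?thesis .
  qed
  have F_sums: "(\<lambda>n. 2 * pi * \<i> * Gamma (of_real (1 + \<delta>)) * (Z n * (E - J n))) sums vline_integral c F"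
  proof -
    have "(\<lambda>n. vline_integral c (\<lambda>s. u n s * R s)) sums vline_integral c (\<lambda>s. (\<Sum>n. u n s) * R s)"
      by (rule vline_integral_sums[OF R u_cont _ summ_u]) (simp add: norm_u)
    moreover have "vline_integral c F = vline_integral c (\<lambda>s. (\<Sum>n. u n s) * R s)"
      by (rule vline_cong(2), rule F_eq)
    ultimately show ?thesis unfolding u_term by simp
  qed

  \<comment> \<open>Right side. The logarithmic derivative at \<kappa> - w is a sum of \<Lambda>(n)
    n^(-\<kappa> + w), absolutely convergent because \<kappa> - c' > 1.\<close>
  define v where "v n w = mangoldt n * complex_of_nat n powr (- of_real \<kappa> + w)" for n w
  define Q where "Q w = bracket p (1 + of_real \<delta> + w) / w" for w
  have Q_eq: "Q w = expint a (1 + of_real \<delta> + w) / w" if "Re w = c'" for w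
    using that assms by (simp add: Q_def bracket)
  have Q: "vline_integrable c' Q"
  proof -
    \<comment> \<open>The integrated-by-parts form at l = 0 shows that the bracket divided by w is
      absolutely integrable on the line.\<close>
    have Q_alt: "Q w = exp (- a) * perron_kernel \<delta> 0 w - a * (perron_kernel \<delta> 0 w * expint a (of_real \<delta> + w))" if "Re w = c'" for w
      using Q_eq[OF that] exp_times_expint_over_eq[of a w \<delta> 0] that assms Re_a by simp
    have "vline_integrable c' Q \<longleftrightarrow> vline_integrable c' (\<lambda>w. exp (- a) * perron_kernel \<delta> 0 w - a * (perron_kernel \<delta> 0 w * expint a (of_real \<delta> + w)))"
      by (rule vline_cong(1), rule Q_alt)
    moreover have "vline_integrable c' (\<lambda>w. exp (- a) * perron_kernel \<delta> 0 w - a * (perron_kernel \<delta> 0 w * expint a (of_real \<delta> + w)))"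
      using vline_integrable_perron_kernel[of c' \<delta> 0] vline_integrable_perron_expint[of a c' \<delta> 0] assms Re_a
      by (auto simp: vline_integrable_def)
    ultimately show ?thesis by (rule iffD2)
  qed
  have norm_v: "norm (v n w) = mangoldt n * real n powr (- (\<kappa> - c'))" if "Re w = c'" for n w
    using that by (simp add: v_def norm_mult norm_nat_powr)
  have summ_v: "summable (\<lambda>n. mangoldt n * real n powr (- (\<kappa> - c')))"
    using assms by (intro summable_mangoldt_powr) auto
  have v_cont: "continuous_on UNIV (\<lambda>t. v n (Complex c' t))" for n
    unfolding v_def by (intro continuous_intros continuous_of_nat_powr_line)
  have G_eq: "G w = (\<Sum>n. v n w) * Q w" if "Re w = c'" for w
  proof -
    have "(\<lambda>n. v n w) sums (- (deriv zeta (\<kappa> - w) / zeta (\<kappa> - w)))"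
      using zeta_nonzero_and_logderiv(2)[of "\<kappa> - w"] that assms by (simp add: v_def)
    from sums_unique[OF this] show ?thesis
      unfolding G_def Q_def by (simp only: times_divide_eq_right of_real_add of_real_1)
  qed
  have G_int: "vline_integrable c' G"
    using vline_integrable_suminf[OF Q v_cont eq_refl[OF norm_v] summ_v] vline_cong(1)[OF G_eq] by simp
  have v_term: "vline_integral c' (\<lambda>w. v n w * Q w) = 2 * pi * \<i> * (Z n * J n)" for n
  proof (cases "n \<ge> 2")
    case False
    hence "mangoldt n = (0 :: complex)" by (auto simp: not_le less_Suc_eq numeral_2_eq_2)
    thus ?thesis by (simp add: v_def Z_def vline_integral_def)
  next
    case n: True
    have "v n w * Q w = Z n * (exp (w * of_real (ln n)) * (expint a (1 + of_real \<delta> + w) / w))" if "Re w = c'" for w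
    proof -
      have "exp ((- of_real \<kappa> + w) * complex_of_real (ln n)) = exp (- of_real \<kappa> * of_real (ln n)) * exp (w * of_real (ln n))"
        by (rule exp_eq_mult) (simp add: algebra_simps)
      hence "v n w = Z n * exp (w * of_real (ln n))"
        using n by (simp add: v_def Z_def of_nat_powr_eq_exp)
      thus ?thesis using Q_eq[OF that] by simp
    qed
    hence "vline_integral c' (\<lambda>w. v n w * Q w) = vline_integral c' (\<lambda>w. Z n * (exp (w * of_real (ln n)) * (expint a (1 + of_real \<delta> + w) / w)))"
      by (intro vline_cong(2))
    also have "\<dots> = Z n * vline_integral c' (\<lambda>w. (exp (w * of_real (ln n)) * (expint a (1 + of_real \<delta> + w) / w)))"
      unfolding vline_integral_def integral_mult_right_zero by (rule mult.left_commute)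
    also have "vline_integral c' (\<lambda>w. exp (w * of_real (ln n)) * (expint a (1 + of_real \<delta> + w) / w)) = 2 * pi * \<i> * J n"
      unfolding J_def using assms Re_a n by (intro vline_integral_expint_term) auto
    finally show ?thesis by (simp add: mult_ac)
  qed
  have G_sums: "(\<lambda>n. 2 * pi * \<i> * (Z n * J n)) sums vline_integral c' G"
  proof -
    have "(\<lambda>n. vline_integral c' (\<lambda>w. v n w * Q w)) sums vline_integral c' (\<lambda>w. (\<Sum>n. v n w) * Q w)"
      by (rule vline_integral_sums[OF Q v_cont _ summ_v]) (simp add: norm_v)
    moreover have "vline_integral c' G = vline_integral c' (\<lambda>w. (\<Sum>n. v n w) * Q w)"
      by (rule vline_cong(2), rule G_eq)
    ultimately show ?thesis unfolding v_term by simp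
  qed

  define L where "L = - (deriv zeta \<kappa> / zeta \<kappa>)"
  have "Z sums L"
    using zeta_nonzero_and_logderiv(2)[of "of_real \<kappa>"] assms unfolding Z_def L_def by simp
  \<comment> \<open>Subtracting termwise leaves multiples of \<open>Z n * (E - J n)\<close>, the
    series already found for the left side.\<close>
  hence "(\<lambda>n. 2 * pi * \<i> * Gamma (of_real (1 + \<delta>)) * (Z n * E) - Gamma (of_real (1 + \<delta>)) * (2 * pi * \<i> * (Z n * J n)))
      sums (2 * pi * \<i> * Gamma (of_real (1 + \<delta>)) * (L * E) - Gamma (of_real (1 + \<delta>)) * vline_integral c' G)"
    by (intro sums_diff sums_mult sums_mult2 G_sums)
  also have "(\<lambda>n. 2 * pi * \<i> * Gamma (of_real (1 + \<delta>)) * (Z n * E) - Gamma (of_real (1 + \<delta>)) * (2 * pi * \<i> * (Z n * J n)))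
      = (\<lambda>n. 2 * pi * \<i> * Gamma (of_real (1 + \<delta>)) * (Z n * (E - J n)))"
    by (simp add: algebra_simps)
  finally have "vline_integral c F = 2 * pi * \<i> * Gamma (of_real (1 + \<delta>)) * (L * E) - Gamma (of_real (1 + \<delta>)) * vline_integral c' G"
    using F_sums sums_unique2 by blast
  moreover have "bracket p (1 + \<delta>) = E"
    using assms by (simp add: bracket E_def)
  ultimately have "1 / (2 * pi * \<i>) * vline_integral c F
      = Gamma (of_real (1 + \<delta>)) * L * bracket p (1 + \<delta>) - Gamma (of_real (1 + \<delta>)) / (2 * pi * \<i>) * vline_integral c' G"
    by (simp add: field_simps)
  thus ?thesis
    using F_int G_int by (simp add: L_def Gamma_complex_of_real [symmetric])
qed

end
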